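(* Let $N_c\ge2$ be an integer and let $0\le t,\tilde t<1$. Then the unrefined Hilbert series of $SU(N_c)$ SQCD with $N_f=N_c+1$ flavours is $$\begin{aligned}g_{N_c+1,SU(N_c)}(t,\tilde t)=\frac{1}{(1-t\tilde t)^{(N_c+1)^2}}\Bigg[&1-(t\tilde t)^{N_c+1}+(1-t\tilde t)\sum_{m=0}^{N_c}\sum_{n=0}^{N_c+1}(-1)^{m+n}\binom{N_c+1}{m+n+1}\\&\times\left(\frac{t^{(m+n+1)N_c}}{(1-t^{N_c})^{N_c+1}}+\frac{\tilde t^{\,(m+n+1)N_c}}{(1-\tilde t^{N_c})^{N_c+1}}\right)(t\tilde t)^n\Bigg].\end{aligned}$$
   Context: The unrefined Hilbert series of $SU(N_c)$ SQCD with $N_f$ flavours is $$g_{N_f,SU(N_c)}(t,\tilde t)=\int_{SU(N_c)}\prod_{a=1}^{N_c}\frac{1}{(1-t/z_a)^{N_f}(1-\tilde t z_a)^{N_f}}\,d\mu,$$ where $\mu$ is the normalised Haar measure on $SU(N_c)$ and $z_1,\dots,z_{N_c}$ are the eigenvalues of the group element. Binomial coefficients $\binom{n}{k}$ with $k>n\ge 0$ are zero. *)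

theory Defs
  imports "HOL-Analysis.Analysis" "HOL-Probability.Probability_Measure"
    "HOL-Computational_Algebra.Polynomial"
begin

definition conj_transpose :: "complex^'n^'m \<Rightarrow> complex^'m^'n" where
  "conj_transpose A = (\<chi> i j. cnj (A $ j $ i))"

definition special_unitary :: "(complex^'n^'n) set" where
  "special_unitary = {U. U ** conj_transpose U = mat 1 \<and> conj_transpose U ** U = mat 1 \<and> det U = 1}"

definition char_polynomial :: "complex^'n^'n \<Rightarrow> complex poly" where
  "char_polynomial A = det (mat [:0, 1:] - (\<chi> i j. [:A $ i $ j:]))"

text \<open>Eigenvalues are counted with algebraic multiplicity.\<close>

definition eigenvalues :: "complex^'n^'n \<Rightarrow> complex multiset" where
  "eigenvalues A = proots (char_polynomial A)"

text \<open>
  For a compact matrix group \<open>G\<close> this determines the measure uniquely. A finite Borel measure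
  on \<open>G\<close> is automatically regular, and left invariance implies right invariance, so
  neither is demanded separately.
\<close>

definition normalised_haar_measure ::
    "(complex^'n^'n) set \<Rightarrow> (complex^'n^'n) measure \<Rightarrow> bool" where
  "normalised_haar_measure G M \<longleftrightarrow>
     prob_space M \<and> space M = G \<and> sets M = sets (restrict_space borel G) \<and>
     (\<forall>g\<in>G. \<forall>A\<in>sets M. emeasure M ((\<lambda>h. g ** h) ` A) = emeasure M A)"

text \<open>
  \<open>\<mu>\<close> is meant to be the normalised Haar measure on \<open>SU(N\<^sub>c)\<close>, where \<open>N\<^sub>c = CARD('n)\<close>,
  and \<open>N\<^sub>f\<close> is the number of flavours.
\<close>

definition sqcd_hilbert_series ::
    "(complex^'n^'n) measure \<Rightarrow> nat \<Rightarrow> real \<Rightarrow> real \<Rightarrow> complex" where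
  "sqcd_hilbert_series \<mu> N\<^sub>f t t' =
     (LINT U|\<mu>. (\<Prod>z\<in>#eigenvalues U.
        1 / ((1 - complex_of_real t / z) ^ N\<^sub>f * (1 - complex_of_real t' * z) ^ N\<^sub>f)))"

end

(*
Put P(x) = det(1 - xU), so that the integrand is the product of 1/P(t')^(N+1) and 1/cnj(P(t))^(N+1).

The complete symmetric functions h_m of the eigenvalues are averages of (v* U v)^m over the unit sphere:
integration by parts on the sphere (an infinitesimal form of Haar invariance) turns these averages into a
sequence satisfying Newton's identities. For fixed v_1, ..., v_(N-1) the integral over U of a nonconstant
product of powers of v_k* U v_k vanishes, since a group element that is scalar on the span of the v_k
multiplies it by a nontrivial phase. Hence the integral of any nonconstant product of N - 1 functions h_m
is zero. By Jacobi-Trudi every Schur function is, up to a power of det U = 1, a polynomial in such products;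
so the nontrivial Schur functions integrate to zero, and the integral of det f(U) is the sum over all integers
k of the Toeplitz determinants det(c_(k+j-i)) of the Laurent coefficients of f. This replaces the Weyl
integration formula.

For N distinct nodes x and N distinct nodes y the symbol 1/prod (1 - x z)(1 - y/z) has partial fractions for
which these determinants are geometric in k. As P has degree N and P(0) = 1, Lagrange interpolation at 0 through
N + 1 nodes expresses N + 1 flavours by N flavours, and the resulting double sum is again evaluated by
interpolation. The nodes then tend to t' and t, giving with q = t t', T = t^N, T' = t'^N
  (1-q)^(-(N+1)^2) [((1-qT)/(1-T))^(N+1) + ((1-qT')/(1-T'))^(N+1) - 1 - q^(N+1)].
*)

theory Submission
  imports Defs "HOL-Computational_Algebra.Fundamental_Theorem_Algebra" "HOL-Real_Asymp.Real_Asymp"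
begin

section \<open>Characteristic polynomials\<close>

text \<open>The measure is given only through left invariance, so neither a maximal torus nor a
  measurable choice of eigenvalues is at hand. Integrands are therefore built from matrix entries
  and from determinants of \<open>a + bU\<close>. A random unit vector is realised as a column of a
  second Haar matrix, which turns sphere averages into expectations and lets Fubini's theorem
  exchange them with the integral over the group. Companion matrices take the place of
  diagonalisation: right multiplication by one shifts a sequence obeying the recurrence of
  \<open>U\<close>, so multiplying a Jacobi-Trudi determinant by \<open>det (a + bU)\<close> amounts
  to applying a difference operator to the sequence. The Toeplitz determinants of order N are
  geometric in k because N simple poles on one side supply exactly N geometric sequences for an N by
  N matrix, which then factors through a diagonal one. With N + 1 poles this factorisation is lost;
  hence one flavour is interpolated away first. Simple poles in turn require distinct nodes, hence
  the limit at the end.\<close>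

definition lin :: "'a \<Rightarrow> 'a \<Rightarrow> 'a^'n^'n \<Rightarrow> 'a::comm_ring_1^'n^'n" where
  "lin a b A = (\<chi> i j. (if i = j then a else 0) + b * A $ i $ j)"

lemma lin_nth: "lin a b A $ i $ j = (if i = j then a else 0) + b * A $ i $ j"
  by (simp add: lin_def)

lemma det_scale: "det (\<chi> i j. c * A $ i $ j) = c ^ CARD('n) * det (A :: 'a::comm_ring_1^'n^'n)"
  using det_rows_mul[of "\<lambda>_. c" "\<lambda>i. A $ i"] by (simp add: vector_scalar_mult_def)

text \<open>Two coefficients make the family homogeneous: \<open>1 - xU\<close>,
  \<open>y - U\<close> and \<open>U - y\<close> are all instances of \<open>lin\<close>, and scaling
  passes from one to another.\<close>

lemma det_lin_scale: "det (lin (c * a) (c * b) A) = c ^ CARD('n) * det (lin a b (A :: 'a::comm_ring_1^'n^'n))"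
proof -
  have "lin (c * a) (c * b) A = (\<chi> i j. c * lin a b A $ i $ j)"
    by (simp add: lin_def vec_eq_iff algebra_simps)
  then show ?thesis by (simp add: det_scale)
qed

lemma poly_det: "poly (det M) x = det (\<chi> i j. poly (M $ i $ j) x)"
  for M :: "'a::comm_ring_1 poly^'n^'n"
  by (simp add: det_def poly_sum poly_prod)

lemma continuous_on_det:
  fixes f :: "'b::topological_space \<Rightarrow> complex^'n^'n"
  assumes "\<And>i j. continuous_on S (\<lambda>x. f x $ i $ j)"
  shows "continuous_on S (\<lambda>x. det (f x))"
  unfolding det_def using assms
  by (intro continuous_on_sum continuous_on_mult continuous_on_const continuous_on_prod) auto

text \<open>Scaling covers every nonzero \<open>a\<close>; the case \<open>a = 0\<close>, which
  contains the determinant of the matrix itself, follows by continuity in \<open>a\<close>. A matrix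
  may thus be replaced by a companion matrix with the same \<open>rev_char_poly\<close>.\<close>

lemma det_lin_cong:
  fixes A B :: "complex^'n^'n"
  assumes "\<And>x. det (lin 1 (-x) A) = det (lin 1 (-x) B)"
  shows "det (lin a b A) = det (lin a b B)"
proof -
  have ne: "det (lin a b A) = det (lin a b B)" if "a \<noteq> 0" for a
    using det_lin_scale[of a 1 "b / a" A] det_lin_scale[of a 1 "b / a" B] assms[of "- b / a"] that
    by simp
  let ?f = "\<lambda>a. det (lin a b A) - det (lin a b B)"
  have "continuous_on UNIV (\<lambda>a. lin a b M $ i $ j)" for M :: "complex^'n^'n" and i j
    by (cases "i = j") (auto simp: lin_nth intro!: continuous_intros)
  then have "continuous_on UNIV ?f"
    by (intro continuous_on_diff continuous_on_det)
  then have "isCont ?f 0"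
    by (simp add: continuous_on_eq_continuous_at)
  then have "(?f \<longlongrightarrow> ?f 0) (at 0)"
    by (simp add: isCont_def)
  moreover have "(?f \<longlongrightarrow> 0) (at 0)"
    by (rule tendsto_eventually) (simp add: eventually_at_filter ne)
  ultimately have "?f 0 = 0"
    using tendsto_unique[OF at_neq_bot] by blast
  then show ?thesis using ne by (cases "a = 0") auto
qed

text \<open>Chosen over det(x - A) because its constant term is 1: it is invertible as a power
  series, and its inverse generates the complete symmetric functions of the eigenvalues.\<close>

definition rev_char_poly :: "complex^'n^'n \<Rightarrow> complex poly" where
  "rev_char_poly A = det (lin 1 [:0, -1:] (\<chi> i j. [:A $ i $ j:]))"

lemma poly_rev_char_poly: "poly (rev_char_poly A) x = det (lin 1 (-x) A)"
  unfolding rev_char_poly_def poly_det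
  by (rule arg_cong[where f = det]) (simp add: vec_eq_iff lin_nth)

lemma coeff_rev_char_poly_0: "coeff (rev_char_poly A) 0 = 1"
proof -
  have "lin 1 0 A = mat 1" by (simp add: lin_def mat_def)
  then show ?thesis
    using poly_rev_char_poly[of A 0] by (simp add: poly_0_coeff_0)
qed

lemma degree_rev_char_poly: "degree (rev_char_poly A) \<le> CARD('n)" for A :: "complex^'n^'n"
proof -
  have deg: "degree (lin 1 [:0, -1:] (\<chi> i j. [:A $ i $ j:]) $ i $ j) \<le> 1" for i j
    by (auto simp: lin_nth intro!: degree_add_le degree_mult_le order_trans[OF degree_mult_le])
  have "degree (\<Prod>i\<in>UNIV. lin 1 [:0, -1:] (\<chi> i j. [:A $ i $ j:]) $ i $ p i) \<le> CARD('n)" for p :: "'n \<Rightarrow> 'n"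
    by (rule order_trans[OF degree_prod_sum_le]) (auto intro!: order_trans[OF sum_mono[OF deg]])
  then show ?thesis
    unfolding rev_char_poly_def det_def
    by (intro degree_sum_le order_trans[OF degree_mult_le]) (auto simp: sign_def)
qed

lemma det_lin_rev_char_poly:
  "det (lin 1 (-x) A) = (\<Sum>r\<le>CARD('n). coeff (rev_char_poly A) r * x ^ r)" for A :: "complex^'n^'n"
proof -
  have "poly (rev_char_poly A) x = poly (\<Sum>r\<le>CARD('n). monom (coeff (rev_char_poly A) r) r) x"
    by (simp only: poly_as_sum_of_monoms'[OF degree_rev_char_poly])
  then show ?thesis by (simp add: poly_rev_char_poly poly_sum poly_monom)
qed

lemma poly_char_polynomial: "poly (char_polynomial A) y = det (lin y (-1) A)"
  unfolding char_polynomial_def poly_det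
  by (rule arg_cong[where f = det]) (simp add: vec_eq_iff lin_nth mat_def)

lemma poly_eqI_nonzero:
  fixes p q :: "complex poly"
  assumes "\<And>x. x \<noteq> 0 \<Longrightarrow> poly p x = poly q x"
  shows "p = q"
proof -
  have "poly ([:0, 1:] * p) y = poly ([:0, 1:] * q) y" for y
    using assms by (cases "y = 0") simp_all
  then have "[:0, 1:] * p = [:0, 1:] * q"
    by (simp add: poly_eq_poly_eq_iff[symmetric] fun_eq_iff)
  then show ?thesis by simp
qed

lemma char_polynomial_altdef:
  "char_polynomial A = (\<Sum>r\<le>CARD('n). monom (coeff (rev_char_poly A) r) (CARD('n) - r))"
  for A :: "complex^'n^'n"
proof -
  let ?R = "\<Sum>r\<le>CARD('n). monom (coeff (rev_char_poly A) r) (CARD('n) - r)"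
  show ?thesis
  proof (rule poly_eqI_nonzero)
    fix y :: complex assume y: "y \<noteq> 0"
    have "poly (char_polynomial A) y = y ^ CARD('n) * det (lin 1 (- (1/y)) A)"
      using det_lin_scale[of y 1 "-(1/y)" A] y by (simp add: poly_char_polynomial)
    also have "\<dots> = (\<Sum>r\<le>CARD('n). coeff (rev_char_poly A) r * y ^ (CARD('n) - r))"
      unfolding det_lin_rev_char_poly sum_distrib_left
      using y by (intro sum.cong) (auto simp: power_diff field_simps)
    finally show "poly (char_polynomial A) y = poly ?R y" by (simp add: poly_sum poly_monom)
  qed
qed

lemma char_polynomial_monic:
  "degree (char_polynomial A) = CARD('n)" "lead_coeff (char_polynomial A) = 1" for A :: "complex^'n^'n"
proof -
  have c: "coeff (char_polynomial A) (CARD('n)) = 1"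
  proof -
    have "coeff (char_polynomial A) (CARD('n)) =
      (\<Sum>r\<le>CARD('n). if r = 0 then coeff (rev_char_poly A) r else 0)"
      unfolding char_polynomial_altdef coeff_sum by (intro sum.cong) (auto simp: coeff_monom)
    then show ?thesis by (simp add: coeff_rev_char_poly_0)
  qed
  moreover have "degree (char_polynomial A) \<le> CARD('n)"
    unfolding char_polynomial_altdef
    by (intro degree_sum_le order_trans[OF degree_monom_le]) auto
  ultimately show "degree (char_polynomial A) = CARD('n)" "lead_coeff (char_polynomial A) = 1"
    by (metis le_antisym le_degree zero_neq_one)+
qed

lemma char_polynomial_eigenvalues:
  "char_polynomial A = (\<Prod>z\<in>#eigenvalues A. [:- z, 1:])" "size (eigenvalues A) = CARD('n)"
  for A :: "complex^'n^'n"
proof -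
  have "char_polynomial A \<noteq> 0"
    using char_polynomial_monic(2)[of A] by auto
  then obtain B where B: "char_polynomial A = (\<Prod>z\<in>#B. [:- z, 1:])" "size B = CARD('n)"
    using alg_closed_imp_factorization[of "char_polynomial A"]
    unfolding char_polynomial_monic(2) smult_1_left unfolding char_polynomial_monic(1) by blast
  have "eigenvalues A = B"
  proof -
    have "0 \<notin># image_mset (\<lambda>z. [:- z, 1:]) B" by auto
    then show ?thesis
      using proots_prod_mset[of "image_mset (\<lambda>z. [:- z, 1:]) B"]
      unfolding eigenvalues_def B by (simp add: image_mset.compositionality o_def)
  qed
  with B show "char_polynomial A = (\<Prod>z\<in>#eigenvalues A. [:- z, 1:])" "size (eigenvalues A) = CARD('n)"
    by simp_all
qed

lemma prod_mset_distrib_pow: "(\<Prod>z\<in>#B. (c::complex) * f z) = c ^ size B * (\<Prod>z\<in>#B. f z)"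
  by (induction B) auto

text \<open>The passage from the eigenvalue multiset to determinants. It serves to keep det(1 - xU)
  away from 0 and to rewrite the integrand of the Hilbert series.\<close>

lemma det_lin_eigenvalues: "det (lin a b A) = (\<Prod>z\<in>#eigenvalues A. a + b * z)"
  for A :: "complex^'n^'n"
proof (cases "b = 0")
  case True
  then have "lin a b A = (\<chi> i j. a * mat 1 $ i $ j)" by (simp add: lin_def mat_def vec_eq_iff)
  then have "det (lin a b A) = a ^ CARD('n)" by (simp add: det_scale del: vec_lambda_beta)
  then show ?thesis using True prod_mset_distrib_pow[of a "\<lambda>_. 1" "eigenvalues A"]
    by (simp add: char_polynomial_eigenvalues)
next
  case False
  then have "det (lin a b A) = (- b) ^ CARD('n) * det (lin (- a / b) (-1) A)"
    using det_lin_scale[of "- b" "- a / b" "-1" A] by simp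
  also have "\<dots> = (- b) ^ CARD('n) * poly (\<Prod>z\<in>#eigenvalues A. [:- z, 1:]) (- a / b)"
    by (simp only: poly_char_polynomial[symmetric] char_polynomial_eigenvalues(1)[symmetric])
  also have "\<dots> = (\<Prod>z\<in>#eigenvalues A. (- b) * (- a / b - z))"
    unfolding prod_mset_distrib_pow
    by (simp add: char_polynomial_eigenvalues poly_prod_mset image_mset.compositionality o_def minus_diff_commute)
  also have "\<dots> = (\<Prod>z\<in>#eigenvalues A. a + b * z)"
    using False by (simp add: algebra_simps)
  finally show ?thesis .
qed

section \<open>Newton identities for the determinant\<close>

primrec mpow :: "'a::comm_ring_1^'n^'n \<Rightarrow> nat \<Rightarrow> 'a^'n^'n" where
  "mpow A 0 = mat 1"
| "mpow A (Suc k) = A ** mpow A k"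

text \<open>Row i of \<open>M ** A\<close> is a combination of the rows of A, and every term except
  the multiple of row i itself repeats a row.\<close>

lemma det_row_replaced_by_product:
  "det (\<chi> k. if k = i then (M ** A) $ i else A $ k) = M $ i $ i * det A"
  for A M :: "'a::comm_ring_1^'n^'n"
proof -
  have row: "(M ** A) $ i = (\<Sum>j\<in>UNIV. M $ i $ j *s A $ j)"
    by (simp add: vec_eq_iff matrix_matrix_mult_def)
  have "det (\<chi> k. if k = i then (M ** A) $ i else A $ k)
    = (\<Sum>j\<in>UNIV. det (\<chi> k. if k = i then M $ i $ j *s A $ j else A $ k))"
    unfolding row using det_linear_row_sum[of UNIV i "\<lambda>_ j. M $ i $ j *s A $ j" "\<lambda>k. A $ k"] by simp
  also have "\<dots> = (\<Sum>j\<in>UNIV. M $ i $ j * det (\<chi> k. if k = i then A $ j else A $ k))"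
    by (simp add: det_row_mul)
  also have "\<dots> = (\<Sum>j\<in>UNIV. if j = i then M $ i $ i * det A else 0)"
  proof (rule sum.cong[OF refl])
    fix j :: 'n
    show "M $ i $ j * det (\<chi> k. if k = i then A $ j else A $ k) = (if j = i then M $ i $ i * det A else 0)"
    proof (cases "j = i")
      case True
      then have "(\<chi> k. if k = i then A $ j else A $ k) = A" by (simp add: vec_eq_iff)
      then show ?thesis using True by simp
    next
      case False
      then show ?thesis
        by (subst det_identical_rows[of j i]) (auto simp: row_def vec_eq_iff)
    qed
  qed
  finally show ?thesis by simp
qed

lemma fps_deriv_prod:
  "finite S \<Longrightarrow> fps_deriv (\<Prod>i\<in>S. f i) = (\<Sum>i\<in>S. \<Prod>k\<in>S. if k = i then fps_deriv (f k) else f k)"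
  for f :: "'b \<Rightarrow> 'a::comm_ring_1 fps"
proof (induction S rule: finite_induct)
  case (insert x S)
  have "(\<Prod>k\<in>insert x S. if k = x then fps_deriv (f k) else f k) = fps_deriv (f x) * prod f S"
    using insert.hyps by (auto intro!: arg_cong2[where f = "(*)"] prod.cong)
  moreover have "(\<Prod>k\<in>insert x S. if k = i then fps_deriv (f k) else f k)
      = f x * (\<Prod>k\<in>S. if k = i then fps_deriv (f k) else f k)" if "i \<in> S" for i
    using insert.hyps that by auto
  ultimately show ?case
    using insert by (simp add: sum_distrib_left mult.commute)
qed simp

lemma fps_deriv_sum': "fps_deriv (\<Sum>i\<in>S. f i) = (\<Sum>i\<in>S. fps_deriv (f i))"
  for f :: "'b \<Rightarrow> 'a::comm_ring_1 fps"
  by (induction S rule: infinite_finite_induct) auto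

lemma fps_deriv_det:
  "fps_deriv (det A) = (\<Sum>i\<in>UNIV. det (\<chi> k. if k = i then (\<chi> j. fps_deriv (A $ i $ j)) else A $ k))"
  for A :: "'a::comm_ring_1 fps^'n^'n"
proof -
  have sgn: "fps_deriv (of_int (sign p)) = (0 :: 'a fps)" for p :: "'n \<Rightarrow> 'n"
    by (simp add: sign_def)
  have "fps_deriv (det A) = (\<Sum>p\<in>{p. p permutes UNIV}. \<Sum>i\<in>UNIV. of_int (sign p) *
      (\<Prod>k\<in>UNIV. if k = i then fps_deriv (A $ k $ p k) else A $ k $ p k))"
    by (simp add: det_def fps_deriv_sum' fps_deriv_prod sgn sum_distrib_left)
  also have "\<dots> = (\<Sum>i\<in>UNIV. \<Sum>p\<in>{p. p permutes UNIV}. of_int (sign p) *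
      (\<Prod>k\<in>UNIV. if k = i then fps_deriv (A $ k $ p k) else A $ k $ p k))"
    by (rule sum.swap)
  also have "\<dots> = (\<Sum>i\<in>UNIV. det (\<chi> k. if k = i then (\<chi> j. fps_deriv (A $ i $ j)) else A $ k))"
    unfolding det_def by (intro sum.cong refl arg_cong2[where f = "(*)"] prod.cong) auto
  finally show ?thesis .
qed

lemma fps_of_poly_det: "fps_of_poly (det M) = det (\<chi> i j. fps_of_poly (M $ i $ j))"
  for M :: "'a::comm_ring_1 poly^'n^'n"
proof -
  have "fps_of_poly (of_int (sign p)) = (of_int (sign p) :: 'a fps)" for p :: "'n \<Rightarrow> 'n"
    by (simp add: sign_def fps_of_poly_uminus)
  then show ?thesis
    by (simp add: det_def fps_of_poly_sum fps_of_poly_prod fps_of_poly_mult)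
qed

text \<open>Jacobi's formula for \<open>det (1 - xA)\<close>; on coefficients these are Newton's identities.\<close>

lemma fps_deriv_rev_char_poly:
  "fps_deriv (fps_of_poly (rev_char_poly A)) =
     - (fps_of_poly (rev_char_poly A) * Abs_fps (\<lambda>k. trace (mpow A (Suc k))))"
  for A :: "complex^'n^'n"
proof -
  define B :: "complex fps^'n^'n" where "B = (\<chi> i j. fps_of_poly (lin 1 [:0, -1:] (\<chi> i j. [:A $ i $ j:]) $ i $ j))"
  \<comment> \<open>G is the expansion of A (1 - xA)^-1 and B is 1 - xA. Hence G B = A, and
    differentiating row i of B gives minus row i of G B.\<close>
  define G :: "complex fps^'n^'n" where "G = (\<chi> i j. Abs_fps (\<lambda>k. mpow A (Suc k) $ i $ j))"
  have B_nth: "B $ i $ j = (if i = j then 1 else 0) - fps_X * fps_const (A $ i $ j)" for i j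
    by (simp add: B_def lin_nth fps_of_poly_add fps_of_poly_mult fps_of_poly_pCons fps_of_poly_linear)
  have comm: "A ** mpow A k = mpow A k ** A" for k
    by (induction k) (simp, metis mpow.simps(2) matrix_mul_assoc)
  have GB: "(G ** B) $ i $ j = fps_const (A $ i $ j)" for i j
  proof (rule fps_ext)
    fix n
    have sw: "(\<Sum>k\<in>UNIV. mpow A (Suc m) $ i $ k * A $ k $ j) = mpow A (Suc (Suc m)) $ i $ j" for m
      using comm[of "Suc m"] by (simp add: matrix_matrix_mult_def vec_eq_iff)
    have "(G ** B) $ i $ j = G $ i $ j - fps_X * (\<Sum>k\<in>UNIV. G $ i $ k * fps_const (A $ k $ j))"
      by (simp add: matrix_matrix_mult_def B_nth right_diff_distrib sum_subtractf sum_distrib_left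
          algebra_simps if_distrib[of "\<lambda>x. x * _"] if_distrib[of "\<lambda>x. _ * x"] cong: if_cong)
    then have "fps_nth ((G ** B) $ i $ j) n = fps_nth (G $ i $ j) n -
        (if n = 0 then 0 else \<Sum>k\<in>UNIV. fps_nth (G $ i $ k) (n - 1) * A $ k $ j)"
      by (simp add: fps_sum_nth)
    also have "\<dots> = (if n = 0 then A $ i $ j else 0)"
      using sw[of "n - 1"] by (cases n) (simp_all add: G_def del: mpow.simps(2), simp)
    finally show "fps_nth ((G ** B) $ i $ j) n = fps_nth (fps_const (A $ i $ j)) n" by simp
  qed
  have "fps_deriv (det B) = (\<Sum>i\<in>UNIV. - det (\<chi> k. if k = i then (G ** B) $ i else B $ k))"
    unfolding fps_deriv_det
  proof (rule sum.cong[OF refl])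
    fix i :: 'n
    have row: "(\<chi> j. fps_deriv (B $ i $ j)) = - 1 *s (G ** B) $ i"
      by (simp add: vec_eq_iff B_nth GB)
    show "det (\<chi> k. if k = i then \<chi> j. fps_deriv (B $ i $ j) else B $ k) =
        - det (\<chi> k. if k = i then (G ** B) $ i else B $ k)"
      unfolding row using det_row_mul[of i "- 1" "\<lambda>_. (G ** B) $ i" "\<lambda>k. B $ k"] by simp
  qed
  also have "\<dots> = - (det B * trace G)"
    by (simp add: det_row_replaced_by_product sum_negf trace_def sum_distrib_left mult.commute)
  also have "trace G = Abs_fps (\<lambda>k. trace (mpow A (Suc k)))"
    by (simp add: fps_eq_iff trace_def G_def fps_sum_nth)
  also have "det B = fps_of_poly (rev_char_poly A)"
    by (simp add: rev_char_poly_def fps_of_poly_det B_def)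
  finally show ?thesis .
qed

lemma trace_rank_one: "trace (mpow (\<chi> i j. b $ i * cnj (b $ j)) (Suc k)) = (\<Sum>i\<in>UNIV. b $ i * cnj (b $ i)) ^ Suc k"
  for b :: "complex^'n"
proof -
  define \<tau> where "\<tau> = (\<Sum>i\<in>UNIV. b $ i * cnj (b $ i))"
  have red: "(\<Sum>i\<in>UNIV. x * cnj (b $ i) * (b $ i * y)) = x * \<tau> * y" for x y
    by (simp add: \<tau>_def sum_distrib_left sum_distrib_right mult_ac)
  have "mpow (\<chi> i j. b $ i * cnj (b $ j)) (Suc k) = (\<chi> i j. b $ i * (cnj (b $ j) * \<tau> ^ k))"
  proof (induction k)
    case (Suc k)
    show ?case
      unfolding mpow.simps(2)[of _ "Suc k"] Suc
      by (simp add: vec_eq_iff matrix_matrix_mult_def red)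
  qed (simp add: vec_eq_iff)
  then show ?thesis
    using red[of 1 "\<tau> ^ k"] by (simp add: trace_def mult_ac flip: \<tau>_def)
qed

text \<open>All powers of the projection have trace 1, so Jacobi's formula reads P' = - P / (1 - x).
  Then P / (1 - x) has derivative 0 and constant term 1, whence P = 1 - x.\<close>

lemma det_rank_one_update:
  fixes b :: "complex^'n"
  assumes "(\<Sum>i\<in>UNIV. b $ i * cnj (b $ i)) = 1"
  shows "det (lin 1 c (\<chi> i j. b $ i * cnj (b $ j))) = 1 + c"
proof -
  let ?A = "(\<chi> i j. b $ i * cnj (b $ j)) :: complex^'n^'n"
  let ?P = "fps_of_poly (rev_char_poly ?A)"
  have d: "fps_deriv ?P = - (?P * Abs_fps (\<lambda>_. 1))"
    unfolding fps_deriv_rev_char_poly trace_rank_one assms by simp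
  have inv: "Abs_fps (\<lambda>_. 1) * (1 - fps_X) = (1 :: complex fps)"
    by (rule fps_ext) (simp add: right_diff_distrib fps_X_mult_right_nth)
  have "fps_deriv (?P * Abs_fps (\<lambda>_. 1)) = 0"
  proof -
    have "fps_deriv (Abs_fps (\<lambda>_. 1) * (1 - fps_X)) = (0 :: complex fps)" by (simp add: inv)
    then have "fps_deriv (Abs_fps (\<lambda>_. 1)) * (1 - fps_X) = (Abs_fps (\<lambda>_. 1) :: complex fps)"
      by (simp add: algebra_simps)
    then have "fps_deriv (Abs_fps (\<lambda>_. 1)) * ((1 - fps_X) * Abs_fps (\<lambda>_. 1)) = Abs_fps (\<lambda>_. 1) * (Abs_fps (\<lambda>_. 1) :: complex fps)"
      by (metis mult.assoc)
    then have "fps_deriv (Abs_fps (\<lambda>_. 1)) = Abs_fps (\<lambda>_. 1) * (Abs_fps (\<lambda>_. 1) :: complex fps)"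
      using inv by (simp add: mult.commute)
    then show ?thesis by (simp add: d algebra_simps)
  qed
  then have "?P * Abs_fps (\<lambda>_. 1) = fps_const (fps_nth (?P * Abs_fps (\<lambda>_. 1)) 0)"
    unfolding fps_deriv_eq_0_iff .
  also have "\<dots> = 1" by (simp add: coeff_rev_char_poly_0)
  finally have "(?P * Abs_fps (\<lambda>_. 1)) * (1 - fps_X) = 1 - fps_X" by simp
  then have "?P * 1 = 1 - fps_X"
    by (simp only: mult.assoc inv)
  then have "?P = fps_of_poly [:1, -1:]"
    by (simp add: fps_of_poly_linear)
  then have "rev_char_poly ?A = [:1, -1:]"
    by (simp only: fps_of_poly_eq_iff)
  then show ?thesis
    using poly_rev_char_poly[of ?A "- c"] by simp
qed

section \<open>Unitary matrices\<close>

definition hip :: "complex^'n \<Rightarrow> complex^'n \<Rightarrow> complex" where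
  "hip v w = (\<Sum>i\<in>UNIV. cnj (v $ i) * w $ i)"

lemma hip_self: "hip v v = of_real ((norm v)\<^sup>2)"
proof -
  have "(norm v)\<^sup>2 = (\<Sum>i\<in>UNIV. (cmod (v $ i))\<^sup>2)"
    by (simp add: norm_vec_def L2_set_def sum_nonneg)
  then have "complex_of_real ((norm v)\<^sup>2) = (\<Sum>i\<in>UNIV. of_real ((cmod (v $ i))\<^sup>2))"
    by (simp only: of_real_sum)
  then show ?thesis
    unfolding complex_norm_square by (simp add: hip_def mult.commute)
qed

lemma norm_hip_le: "cmod (hip v w) \<le> norm v * norm w"
proof -
  have "cmod (hip v w) \<le> (\<Sum>i\<in>UNIV. cmod (v $ i) * cmod (w $ i))"
    unfolding hip_def by (rule order_trans[OF norm_sum]) (simp add: norm_mult)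
  also have "\<dots> \<le> norm v * norm w"
    using L2_set_mult_ineq[of "\<lambda>i. cmod (v $ i)" "\<lambda>i. cmod (w $ i)" UNIV]
    by (simp add: norm_vec_def)
  finally show ?thesis .
qed

lemma hip_conj_transpose: "hip (A *v v) w = hip v (conj_transpose A *v w)"
proof -
  have "hip (A *v v) w = (\<Sum>i\<in>UNIV. \<Sum>j\<in>UNIV. cnj (A $ i $ j) * cnj (v $ j) * w $ i)"
    by (simp add: hip_def matrix_vector_mult_def sum_distrib_right)
  also have "\<dots> = (\<Sum>j\<in>UNIV. \<Sum>i\<in>UNIV. cnj (A $ i $ j) * cnj (v $ j) * w $ i)"
    by (rule sum.swap)
  also have "\<dots> = hip v (conj_transpose A *v w)"
    by (simp add: hip_def matrix_vector_mult_def conj_transpose_def sum_distrib_left mult_ac)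
  finally show ?thesis .
qed

lemma conj_transpose_mult: "conj_transpose (A ** B) = conj_transpose B ** conj_transpose A"
  by (simp add: conj_transpose_def matrix_matrix_mult_def vec_eq_iff mult.commute)

lemma conj_transpose_involution [simp]: "conj_transpose (conj_transpose A) = A"
  by (simp add: conj_transpose_def vec_eq_iff)

lemma det_conj_transpose: "det (conj_transpose A) = cnj (det A)"
proof -
  have "conj_transpose A = transpose (\<chi> i j. cnj (A $ i $ j))"
    by (simp add: conj_transpose_def transpose_def vec_eq_iff)
  then have "det (conj_transpose A) = det (\<chi> i j. cnj (A $ i $ j))"
    by (simp only: det_transpose)
  then show ?thesis by (simp add: det_def)
qed

definition unitary :: "complex^'n^'n \<Rightarrow> bool" where
  "unitary U \<longleftrightarrow> U ** conj_transpose U = mat 1 \<and> conj_transpose U ** U = mat 1"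

lemma special_unitary_iff: "U \<in> special_unitary \<longleftrightarrow> unitary U \<and> det U = 1"
  by (auto simp: special_unitary_def unitary_def)

lemma unitary_mult: "unitary U \<Longrightarrow> unitary V \<Longrightarrow> unitary (U ** V)"
  unfolding unitary_def conj_transpose_mult by (metis matrix_mul_assoc matrix_mul_lid)

lemma unitary_conj_transpose: "unitary U \<Longrightarrow> unitary (conj_transpose U)"
  by (simp add: unitary_def)

lemma special_unitary_mult: "U \<in> special_unitary \<Longrightarrow> V \<in> special_unitary \<Longrightarrow> U ** V \<in> special_unitary"
  by (simp add: special_unitary_iff unitary_mult det_mul)

lemma special_unitary_conj_transpose: "U \<in> special_unitary \<Longrightarrow> conj_transpose U \<in> special_unitary"
  by (simp add: special_unitary_iff unitary_conj_transpose det_conj_transpose)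

lemma hip_unitary: "unitary U \<Longrightarrow> hip (U *v v) (U *v w) = hip v w"
  by (simp add: hip_conj_transpose matrix_vector_mul_assoc unitary_def)

lemma norm_unitary: "unitary U \<Longrightarrow> norm (U *v v) = norm v"
  using hip_unitary[of U v v] unfolding hip_self of_real_eq_iff by (simp add: power2_eq_iff_nonneg)

lemma norm_column_unitary: "unitary U \<Longrightarrow> norm (column k U) = 1"
proof -
  have "U *v axis k 1 = column k U"
    by (simp add: vec_eq_iff matrix_vector_mult_def column_def axis_def if_distrib[of "\<lambda>x. _ * x"] cong: if_cong)
  then show "unitary U \<Longrightarrow> norm (column k U) = 1"
    using norm_unitary[of U "axis k 1"] by simp
qed

lemma unitary_entry_le: "unitary U \<Longrightarrow> cmod (U $ i $ j) \<le> 1"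
  using Finite_Cartesian_Product.norm_nth_le[of "column j U" i] norm_column_unitary[of U j]
  by (simp add: column_def)

lemma norm_hip_unitary_le: "unitary U \<Longrightarrow> norm v = 1 \<Longrightarrow> cmod (hip v (U *v v)) \<le> 1"
  using norm_hip_le[of v "U *v v"] by (simp add: norm_unitary)

lemma norm_det_unitary: "unitary U \<Longrightarrow> cmod (det U) = 1"
proof -
  assume "unitary U"
  then have "det U * cnj (det U) = 1"
    by (metis det_I det_conj_transpose det_mul unitary_def)
  then have "(cmod (det U))\<^sup>2 = 1"
    by (metis complex_norm_square of_real_eq_1_iff)
  then show ?thesis
    by (metis norm_ge_zero one_power2 power2_eq_iff_nonneg zero_le_one)
qed

lemma unitary_scale: "unitary U \<Longrightarrow> cmod c = 1 \<Longrightarrow> unitary (\<chi> i j. c * U $ i $ j)"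
proof -
  assume U: "unitary U" and c: "cmod c = 1"
  have cc: "c * cnj c = 1" using c by (simp add: complex_norm_square[symmetric])
  have "(\<chi> i j. c * U $ i $ j) ** conj_transpose (\<chi> i j. c * U $ i $ j) =
      (\<chi> i j. c * cnj c * (U ** conj_transpose U) $ i $ j)"
    by (simp add: vec_eq_iff matrix_matrix_mult_def conj_transpose_def sum_distrib_left mult_ac)
  moreover have "conj_transpose (\<chi> i j. c * U $ i $ j) ** (\<chi> i j. c * U $ i $ j) =
      (\<chi> i j. c * cnj c * (conj_transpose U ** U) $ i $ j)"
    by (simp add: vec_eq_iff matrix_matrix_mult_def conj_transpose_def sum_distrib_left mult_ac)
  ultimately show ?thesis using U by (simp add: unitary_def cc)
qed

text \<open>The phase is an N-th root of 1 / det U. It makes the whole unitary group available to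
  functions that do not see phases.\<close>

lemma unitary_scale_special:
  assumes "unitary (U :: complex^'n^'n)"
  obtains c where "cmod c = 1" "(\<chi> i j. c * U $ i $ j) \<in> special_unitary"
proof -
  define c where "c = cis (- Arg (det U) / CARD('n))"
  have "c ^ CARD('n) = cis (- Arg (det U))"
    unfolding c_def Complex.DeMoivre by simp
  then have "c ^ CARD('n) * det U = cis (- Arg (det U)) * rcis (cmod (det U)) (Arg (det U))"
    by (simp add: rcis_cmod_Arg)
  also have "\<dots> = 1"
    using assms by (simp add: norm_det_unitary rcis_def cis_mult)
  finally have "(\<chi> i j. c * U $ i $ j) \<in> special_unitary"
    using unitary_scale[OF assms, of c] by (simp add: special_unitary_iff det_scale c_def)
  then show ?thesis using that[of c] by (simp add: c_def)
qed

text \<open>The unitary maps which multiply \<open>u\<close> by a phase and fix its orthogonal complement.\<close>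

lemma unitary_rank_one_update:
  fixes u :: "complex^'n"
  assumes "cmod (1 + e * hip u u) = 1" and "u = 0 \<Longrightarrow> e = 0"
  shows "unitary (lin 1 e (\<chi> i j. u $ i * cnj (u $ j)))"
proof -
  define k where "k = hip u u"
  have k: "cnj k = k" by (simp add: k_def hip_self)
  \<comment> \<open>This scalar identity is all that unitarity of 1 + e u u^H amounts to; it is |1 +
    e k|^2 = 1 divided by k.\<close>
  have "e + cnj e + e * cnj e * k = 0"
  proof (cases "u = 0")
    case False
    then have "k \<noteq> 0" by (simp add: k_def hip_self)
    have "(1 + e * k) * cnj (1 + e * k) = 1"
      using assms(1) by (simp add: complex_norm_square[symmetric] k_def del: complex_cnj_add complex_cnj_mult)
    then have "k * (e + cnj e + e * cnj e * k) = 0"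
      by (simp add: k algebra_simps)
    with \<open>k \<noteq> 0\<close> show ?thesis by simp
  qed (simp add: assms(2))
  then have z: "e * x + cnj e * x + e * cnj e * k * x = 0" for x
    by (metis distrib_right mult_zero_left)
  let ?g = "lin 1 e (\<chi> i j. u $ i * cnj (u $ j)) :: complex^'n^'n"
  have s: "(\<Sum>l\<in>UNIV. e * (u $ i * cnj (u $ l)) * (cnj e * (cnj (u $ j) * u $ l))) = e * cnj e * k * (u $ i * cnj (u $ j))"
    "(\<Sum>l\<in>UNIV. cnj e * (cnj (u $ l) * u $ i) * (e * (u $ l * cnj (u $ j)))) = e * cnj e * k * (u $ i * cnj (u $ j))" for i j
    by (simp_all add: k_def hip_def sum_distrib_left sum_distrib_right mult_ac)
  have d: "(\<Sum>l\<in>UNIV. ((if i = l then 1 else 0) + f l) * ((if j = l then 1 else 0) + h l)) =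
     (if i = j then 1 else 0) + f j + h i + (\<Sum>l\<in>UNIV. f l * h l)" for i j :: 'n and f h :: "'n \<Rightarrow> complex"
    by (simp add: algebra_simps sum.distrib if_distrib[of "\<lambda>x. _ * x"] if_distrib[of "\<lambda>x. x * _"] cong: if_cong)
  have "(?g ** conj_transpose ?g) $ i $ j = mat 1 $ i $ j" for i j
  proof -
    have "(?g ** conj_transpose ?g) $ i $ j = (\<Sum>l\<in>UNIV. ((if i = l then 1 else 0) + e * (u $ i * cnj (u $ l))) *
        ((if j = l then 1 else 0) + cnj e * (cnj (u $ j) * u $ l)))"
      by (simp add: matrix_matrix_mult_def conj_transpose_def lin_nth) (intro sum.cong, auto)
    also have "\<dots> = mat 1 $ i $ j"
      unfolding d s using z[of "u $ i * cnj (u $ j)"] by (simp add: mat_def algebra_simps)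
    finally show ?thesis .
  qed
  moreover have "(conj_transpose ?g ** ?g) $ i $ j = mat 1 $ i $ j" for i j
  proof -
    have "(conj_transpose ?g ** ?g) $ i $ j = (\<Sum>l\<in>UNIV. ((if i = l then 1 else 0) + cnj e * (cnj (u $ l) * u $ i)) *
        ((if j = l then 1 else 0) + e * (u $ l * cnj (u $ j))))"
      by (simp add: matrix_matrix_mult_def conj_transpose_def lin_nth) (intro sum.cong, auto)
    also have "\<dots> = mat 1 $ i $ j"
      unfolding d s using z[of "u $ i * cnj (u $ j)"] by (simp add: mat_def algebra_simps)
    finally show ?thesis .
  qed
  ultimately show ?thesis by (simp add: unitary_def vec_eq_iff)
qed

lemma rank_one_update_mult: "lin 1 e (\<chi> i j. u $ i * cnj (u $ j)) *v v = (\<chi> i. v $ i + e * hip u v * u $ i)"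
  for u v :: "complex^'n"
  by (simp add: vec_eq_iff matrix_vector_mult_def lin_nth hip_def distrib_right sum.distrib
      if_distrib[of "\<lambda>x. x * _"] cong: if_cong) (simp add: sum_distrib_left sum_distrib_right mult_ac)

section \<open>Invariance of the Haar measure\<close>

text \<open>The bounds are uniform in V and \<theta>, which provides a constant dominating function
  for differentiation under the integral. Carrying derivative and bound together lets both pass
  through sums, products and conjugation at once.\<close>

definition bounded_deriv :: "'a set \<Rightarrow> (real \<Rightarrow> 'a \<Rightarrow> complex) \<Rightarrow> (real \<Rightarrow> 'a \<Rightarrow> complex) \<Rightarrow> bool" where
  "bounded_deriv S f f' \<longleftrightarrow>
     (\<forall>V\<in>S. \<forall>\<theta>. ((\<lambda>\<theta>. f \<theta> V) has_vector_derivative f' \<theta> V) (at \<theta>)) \<and>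
     (\<exists>C. \<forall>V\<in>S. \<forall>\<theta>. cmod (f \<theta> V) \<le> C \<and> cmod (f' \<theta> V) \<le> C)"

lemma bounded_deriv_const: "bounded_deriv S (\<lambda>_ _. c) (\<lambda>_ _. 0)"
  by (auto simp: bounded_deriv_def intro!: exI[of _ "cmod c"])

lemma bounded_deriv_add:
  assumes "bounded_deriv S f f'" "bounded_deriv S g g'"
  shows "bounded_deriv S (\<lambda>\<theta> V. f \<theta> V + g \<theta> V) (\<lambda>\<theta> V. f' \<theta> V + g' \<theta> V)"
proof -
  obtain C D where "\<And>V \<theta>. V \<in> S \<Longrightarrow> cmod (f \<theta> V) \<le> C \<and> cmod (f' \<theta> V) \<le> C"
    "\<And>V \<theta>. V \<in> S \<Longrightarrow> cmod (g \<theta> V) \<le> D \<and> cmod (g' \<theta> V) \<le> D"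
    using assms unfolding bounded_deriv_def by metis
  then show ?thesis
    using assms unfolding bounded_deriv_def
    by (auto intro!: has_vector_derivative_add exI[of _ "C + D"] norm_add_rule_thm)
qed

lemma bounded_deriv_mult:
  assumes "bounded_deriv S f f'" "bounded_deriv S g g'"
  shows "bounded_deriv S (\<lambda>\<theta> V. f \<theta> V * g \<theta> V) (\<lambda>\<theta> V. f \<theta> V * g' \<theta> V + f' \<theta> V * g \<theta> V)"
proof -
  obtain C D where CD: "\<And>V \<theta>. V \<in> S \<Longrightarrow> cmod (f \<theta> V) \<le> C \<and> cmod (f' \<theta> V) \<le> C"
    "\<And>V \<theta>. V \<in> S \<Longrightarrow> cmod (g \<theta> V) \<le> D \<and> cmod (g' \<theta> V) \<le> D"
    using assms unfolding bounded_deriv_def by metis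
  have b: "cmod (x * y) \<le> \<bar>C\<bar> * \<bar>D\<bar>" if "cmod x \<le> C" "cmod y \<le> D" for x y
    using that by (auto simp: norm_mult intro!: mult_mono)
  have "cmod (f \<theta> V * g \<theta> V) \<le> 2 * (\<bar>C\<bar> * \<bar>D\<bar>)" if "V \<in> S" for V \<theta>
    using b[of "f \<theta> V" "g \<theta> V"] CD[OF that] by (auto intro: order_trans)
  moreover have "cmod (f \<theta> V * g' \<theta> V + f' \<theta> V * g \<theta> V) \<le> 2 * (\<bar>C\<bar> * \<bar>D\<bar>)" if "V \<in> S" for V \<theta>
    using b[of "f \<theta> V" "g' \<theta> V"] b[of "f' \<theta> V" "g \<theta> V"] CD[OF that, of \<theta>]
      norm_triangle_ineq[of "f \<theta> V * g' \<theta> V" "f' \<theta> V * g \<theta> V"] by linarith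
  ultimately show ?thesis
    using assms unfolding bounded_deriv_def
    by (auto intro!: has_vector_derivative_mult exI[of _ "2 * (\<bar>C\<bar> * \<bar>D\<bar>)"])
qed

lemma bounded_deriv_cnj:
  assumes "bounded_deriv S f f'"
  shows "bounded_deriv S (\<lambda>\<theta> V. cnj (f \<theta> V)) (\<lambda>\<theta> V. cnj (f' \<theta> V))"
  using assms unfolding bounded_deriv_def by (auto intro: has_vector_derivative_cnj)

lemma bounded_deriv_sum:
  assumes "\<And>i. i \<in> I \<Longrightarrow> bounded_deriv S (f i) (f' i)"
  shows "bounded_deriv S (\<lambda>\<theta> V. \<Sum>i\<in>I. f i \<theta> V) (\<lambda>\<theta> V. \<Sum>i\<in>I. f' i \<theta> V)"
  using assms
proof (induction I rule: infinite_finite_induct)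
  case (insert x I)
  then show ?case using bounded_deriv_add[of S "f x" "f' x"] by simp
qed (auto intro: bounded_deriv_const)

lemma bounded_deriv_power:
  assumes "bounded_deriv S f f'"
  shows "bounded_deriv S (\<lambda>\<theta> V. f \<theta> V ^ j) (\<lambda>\<theta> V. of_nat j * f \<theta> V ^ (j - 1) * f' \<theta> V)"
proof (induction j)
  case 0
  then show ?case using bounded_deriv_const[of S 1] by simp
next
  case (Suc j)
  have "bounded_deriv S (\<lambda>\<theta> V. f \<theta> V * f \<theta> V ^ j) (\<lambda>\<theta> V. f \<theta> V * (of_nat j * f \<theta> V ^ (j - 1) * f' \<theta> V) + f' \<theta> V * f \<theta> V ^ j)"
    by (rule bounded_deriv_mult[OF assms Suc])
  moreover have "f \<theta> V * (of_nat j * f \<theta> V ^ (j - 1) * f' \<theta> V) + f' \<theta> V * f \<theta> V ^ j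
      = of_nat (Suc j) * f \<theta> V ^ (Suc j - 1) * f' \<theta> V" for \<theta> V
    by (cases j) (simp_all add: algebra_simps)
  ultimately show ?case by simp
qed

locale su_haar =
  fixes \<mu> :: "(complex^'n^'n) measure"
  assumes haar: "normalised_haar_measure special_unitary \<mu>"
begin

sublocale prob_space \<mu>
  using haar by (simp add: normalised_haar_measure_def)

lemma space_eq: "space \<mu> = special_unitary"
  using haar by (simp add: normalised_haar_measure_def)

lemma sets_eq: "sets \<mu> = sets (restrict_space borel special_unitary)"
  using haar by (simp add: normalised_haar_measure_def)

lemma unitary_space: "V \<in> space \<mu> \<Longrightarrow> unitary V"
  by (simp add: space_eq special_unitary_iff)

lemma borel_measurable_continuous: "continuous_on UNIV f \<Longrightarrow> f \<in> borel_measurable \<mu>"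
  for f :: "complex^'n^'n \<Rightarrow> 'b::topological_space"
  unfolding measurable_cong_sets[OF sets_eq refl]
  by (intro measurable_restrict_space1 borel_measurable_continuous_onI)

lemma measurable_entry [measurable]: "(\<lambda>V. V $ i $ j) \<in> borel_measurable \<mu>"
  by (intro borel_measurable_continuous continuous_intros)

lemma measurable_translate [measurable]:
  assumes "g \<in> special_unitary"
  shows "(\<lambda>V. g ** V) \<in> measurable \<mu> \<mu>"
proof -
  have "continuous_on UNIV (\<lambda>V. g ** V)"
    unfolding matrix_matrix_mult_def by (intro continuous_intros)
  then have "(\<lambda>V. g ** V) \<in> measurable \<mu> borel"
    by (rule borel_measurable_continuous)
  then have "(\<lambda>V. g ** V) \<in> measurable \<mu> (restrict_space borel special_unitary)"
    by (rule measurable_restrict_space2[rotated]) (auto simp: space_eq special_unitary_mult assms)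
  then show ?thesis
    unfolding measurable_cong_sets[OF refl sets_eq] .
qed

lemma distr_translate:
  assumes g: "g \<in> special_unitary"
  shows "distr \<mu> \<mu> (\<lambda>V. g ** V) = \<mu>"
proof (rule measure_eqI)
  fix A assume "A \<in> sets (distr \<mu> \<mu> ((**) g))"
  then have A: "A \<in> sets \<mu>" by simp
  let ?h = "conj_transpose g"
  have h: "?h \<in> special_unitary" by (rule special_unitary_conj_transpose[OF g])
  \<comment> \<open>Invariance is assumed for images, the pushforward needs preimages: the preimage
    under g is the image under its conjugate transpose.\<close>
  have "(\<lambda>V. g ** V) -` A \<inter> space \<mu> = (\<lambda>V. ?h ** V) ` A"
  proof (intro equalityI subsetI)
    fix V assume "V \<in> (\<lambda>V. g ** V) -` A \<inter> space \<mu>"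
    moreover have "?h ** (g ** V) = V"
      using g by (simp add: matrix_mul_assoc special_unitary_def)
    ultimately show "V \<in> (\<lambda>V. ?h ** V) ` A" by (metis IntD1 imageI vimageD)
  next
    fix V assume "V \<in> (\<lambda>V. ?h ** V) ` A"
    then obtain W where W: "W \<in> A" "V = ?h ** W" by auto
    have "W \<in> special_unitary" using sets.sets_into_space[OF A] W(1) by (auto simp: space_eq)
    then show "V \<in> (\<lambda>V. g ** V) -` A \<inter> space \<mu>"
      using W g h by (auto simp: matrix_mul_assoc special_unitary_mult space_eq) (simp add: special_unitary_def)
  qed
  then show "emeasure (distr \<mu> \<mu> ((**) g)) A = emeasure \<mu> A"
    using haar h A measurable_translate[OF g] by (simp add: emeasure_distr normalised_haar_measure_def)
qed simp

lemma expectation_translate: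
  fixes f :: "complex^'n^'n \<Rightarrow> complex"
  assumes "g \<in> special_unitary" and [measurable]: "f \<in> borel_measurable \<mu>"
  shows "expectation (\<lambda>V. f (g ** V)) = expectation f"
proof -
  have "expectation f = (\<integral>V. f V \<partial>distr \<mu> \<mu> (\<lambda>V. g ** V))"
    by (simp add: distr_translate[OF assms(1)])
  also have "\<dots> = expectation (\<lambda>V. f (g ** V))"
    by (rule integral_distr[OF measurable_translate[OF assms(1)] assms(2)])
  finally show ?thesis by simp
qed

text \<open>Bounded measurable functions: an algebra closed under conjugation, all of whose members
  are integrable.\<close>

definition bm :: "(complex^'n^'n \<Rightarrow> complex) \<Rightarrow> bool" where
  "bm f \<longleftrightarrow> f \<in> borel_measurable \<mu> \<and> (\<exists>C. \<forall>V\<in>space \<mu>. cmod (f V) \<le> C)"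

lemma bmI: "f \<in> borel_measurable \<mu> \<Longrightarrow> (\<And>V. V \<in> space \<mu> \<Longrightarrow> cmod (f V) \<le> C) \<Longrightarrow> bm f"
  by (auto simp: bm_def)

lemma bm_measurable: "bm f \<Longrightarrow> f \<in> borel_measurable \<mu>"
  by (simp add: bm_def)

lemma bm_integrable: "bm f \<Longrightarrow> integrable \<mu> f"
  by (auto simp: bm_def intro!: integrable_const_bound)

lemma bm_const: "bm (\<lambda>_. c)"
  by (rule bmI[of _ "cmod c"]) auto

lemma bm_add: "bm f \<Longrightarrow> bm g \<Longrightarrow> bm (\<lambda>V. f V + g V)"
  unfolding bm_def by (auto intro!: norm_add_rule_thm exI)

lemma bm_mult: "bm f \<Longrightarrow> bm g \<Longrightarrow> bm (\<lambda>V. f V * g V)"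
proof -
  assume "bm f" "bm g"
  then obtain C D where "f \<in> borel_measurable \<mu>" "g \<in> borel_measurable \<mu>"
    "\<And>V. V \<in> space \<mu> \<Longrightarrow> cmod (f V) \<le> C" "\<And>V. V \<in> space \<mu> \<Longrightarrow> cmod (g V) \<le> D"
    by (auto simp: bm_def)
  note m = this
  show ?thesis
  proof (rule bmI)
    show "cmod (f V * g V) \<le> \<bar>C\<bar> * \<bar>D\<bar>" if "V \<in> space \<mu>" for V
      unfolding norm_mult using m(3,4)[OF that] by (intro mult_mono) auto
  qed (use m in measurable)
qed

lemma bm_cnj: "bm f \<Longrightarrow> bm (\<lambda>V. cnj (f V))"
  by (auto simp: bm_def intro!: measurable_compose[OF _ borel_measurable_continuous_onI[OF continuous_on_cnj[OF continuous_on_id]]])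

lemma bm_sum: "(\<And>i. i \<in> I \<Longrightarrow> bm (f i)) \<Longrightarrow> bm (\<lambda>V. \<Sum>i\<in>I. f i V)"
  by (induction I rule: infinite_finite_induct) (auto intro: bm_const bm_add)

lemma bm_prod: "(\<And>i. i \<in> I \<Longrightarrow> bm (f i)) \<Longrightarrow> bm (\<lambda>V. \<Prod>i\<in>I. f i V)"
  by (induction I rule: infinite_finite_induct) (auto intro: bm_const bm_mult)

lemma bm_power: "bm f \<Longrightarrow> bm (\<lambda>V. f V ^ j)"
  by (induction j) (auto intro: bm_const bm_mult)

lemma bm_entry: "bm (\<lambda>V. V $ i $ j)"
  by (rule bmI[of _ 1]) (auto simp: unitary_space unitary_entry_le)

lemma bm_diff: "bm f \<Longrightarrow> bm g \<Longrightarrow> bm (\<lambda>V. f V - g V)"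
  using bm_add[of f "\<lambda>V. (-1) * g V"] bm_mult[of "\<lambda>_. -1" g] bm_const[of "-1"] by simp

lemma bm_minus: "bm f \<Longrightarrow> bm (\<lambda>V. - f V)"
  using bm_mult[of "\<lambda>_. -1" f] bm_const[of "-1"] by simp

lemmas bm_intros = bm_const bm_add bm_diff bm_minus bm_mult bm_cnj bm_sum bm_prod bm_power bm_entry

text \<open>Infinitesimal invariance. The difference quotients have expectation 0 and converge to
  the derivative under a constant bound, so the derivative has expectation 0 as well.\<close>

lemma expectation_deriv:
  assumes bounded_deriv: "bounded_deriv (space \<mu>) f f'" and meas: "\<And>\<theta>. f \<theta> \<in> borel_measurable \<mu>"
    and inv: "\<And>\<theta>. expectation (f \<theta>) = expectation (f 0)" and meas': "f' 0 \<in> borel_measurable \<mu>"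
  shows "expectation (f' 0) = 0"
proof -
  obtain C where C: "\<And>V \<theta>. V \<in> space \<mu> \<Longrightarrow> cmod (f \<theta> V) \<le> C \<and> cmod (f' \<theta> V) \<le> C"
    using bounded_deriv unfolding bounded_deriv_def by metis
  have vd: "((\<lambda>\<theta>. f \<theta> V) has_vector_derivative f' \<theta> V) (at \<theta>)" if "V \<in> space \<mu>" for V \<theta>
    using bounded_deriv that unfolding bounded_deriv_def by blast
  define \<epsilon> where "\<epsilon> n = 1 / (real n + 1)" for n
  have e0: "\<epsilon> n > 0" for n by (simp add: \<epsilon>_def)
  have elim: "filterlim \<epsilon> (at 0) sequentially"
  proof (rule filterlim_atI)
    show "\<epsilon> \<longlonglongrightarrow> 0" unfolding \<epsilon>_def by (rule LIMSEQ_inverse_real_of_nat[unfolded inverse_eq_divide of_nat_Suc add.commute[of _ 1], unfolded add.commute[of 1]])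
  qed (use e0 in \<open>auto intro!: always_eventually simp: less_imp_neq[symmetric]\<close>)
  define D where "D n V = (f (\<epsilon> n) V - f 0 V) /\<^sub>R \<epsilon> n" for n V
  have "(\<lambda>n. expectation (D n)) \<longlonglongrightarrow> expectation (f' 0)"
  proof (rule integral_dominated_convergence[where w = "\<lambda>_. C"])
    show "f' 0 \<in> borel_measurable \<mu>" by fact
    show "D n \<in> borel_measurable \<mu>" for n using meas unfolding D_def by measurable
    show "integrable \<mu> (\<lambda>_. C)" by simp
    show "AE V in \<mu>. (\<lambda>n. D n V) \<longlonglongrightarrow> f' 0 V"
    proof (rule AE_I2)
      fix V assume V: "V \<in> space \<mu>"
      have "((\<lambda>\<theta>. (f \<theta> V - f 0 V) /\<^sub>R \<theta>) \<longlongrightarrow> f' 0 V) (at 0)"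
      proof (rule Lim_null[THEN iffD2], rule tendsto_norm_zero_cancel)
        have "((\<lambda>\<theta>. norm (f \<theta> V - f 0 V - \<theta> *\<^sub>R f' 0 V) / norm \<theta>) \<longlongrightarrow> 0) (at 0)"
          using vd[OF V, of 0] unfolding has_vector_derivative_def has_derivative_iff_norm by simp
        moreover have "\<forall>\<^sub>F \<theta> in at 0. norm (f \<theta> V - f 0 V - \<theta> *\<^sub>R f' 0 V) / norm \<theta> =
            norm ((f \<theta> V - f 0 V) /\<^sub>R \<theta> - f' 0 V)"
        proof (unfold eventually_at_filter, rule always_eventually, intro allI impI)
          fix \<theta> :: real assume "\<theta> \<noteq> 0"
          then have "f \<theta> V - f 0 V - \<theta> *\<^sub>R f' 0 V = \<theta> *\<^sub>R ((f \<theta> V - f 0 V) /\<^sub>R \<theta> - f' 0 V)"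
            by (simp add: scaleR_diff_right)
          then show "norm (f \<theta> V - f 0 V - \<theta> *\<^sub>R f' 0 V) / norm \<theta> = norm ((f \<theta> V - f 0 V) /\<^sub>R \<theta> - f' 0 V)"
            using \<open>\<theta> \<noteq> 0\<close> by simp
        qed
        ultimately show "((\<lambda>\<theta>. norm ((f \<theta> V - f 0 V) /\<^sub>R \<theta> - f' 0 V)) \<longlongrightarrow> 0) (at 0)"
          by (rule Lim_transform_eventually)
      qed
      then show "(\<lambda>n. D n V) \<longlonglongrightarrow> f' 0 V"
        unfolding D_def by (rule filterlim_compose[OF _ elim])
    qed
    show "AE V in \<mu>. norm (D n V) \<le> C" for n
    proof (rule AE_I2)
      fix V assume V: "V \<in> space \<mu>"
      \<comment> \<open>The mean value inequality turns the bound on the derivative into the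
        dominating constant for the difference quotients.\<close>
      have "norm (f (\<epsilon> n) V - f 0 V) \<le> C * norm (\<epsilon> n - 0)"
      proof (rule differentiable_bound[of UNIV "\<lambda>\<theta>. f \<theta> V" "\<lambda>\<theta> h. h *\<^sub>R f' \<theta> V"])
        show "onorm (\<lambda>h. h *\<^sub>R f' \<theta> V) \<le> C" for \<theta>
          using C[OF V, of \<theta>] by (intro onorm_le) (simp add: mult.commute[of C] mult_left_mono)
      qed (use vd[OF V] in \<open>auto simp: has_vector_derivative_def\<close>)
      then show "norm (D n V) \<le> C"
        using e0[of n] unfolding D_def norm_scaleR by (simp add: field_simps)
    qed
  qed
  moreover have "expectation (D n) = 0" for n
  proof -
    have "integrable \<mu> (f \<theta>)" for \<theta>
      using C meas by (intro bm_integrable bmI) auto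
    then show ?thesis unfolding D_def using inv[of "\<epsilon> n"] by simp
  qed
  ultimately have "(\<lambda>n. 0) \<longlonglongrightarrow> expectation (f' 0)" by simp
  then show ?thesis by (rule LIMSEQ_unique) simp
qed

end

section \<open>Sphere averages and complete symmetric functions\<close>

context su_haar
begin

text \<open>The random unit vector. \<open>undefined\<close> stands for some fixed column index, and
  which one it is makes no difference.\<close>

abbreviation fcol :: "complex^'n^'n \<Rightarrow> complex^'n" where
  "fcol V \<equiv> column undefined V"

lemma fcol_mult: "fcol (g ** V) = g *v fcol V"
  by (simp add: column_def vec_eq_iff matrix_matrix_mult_def matrix_vector_mult_def)

lemma bm_fcol: "bm (\<lambda>V. fcol V $ i)"
  by (simp add: column_def bm_entry)

lemma bm_hip_fcol: "bm (\<lambda>V. hip (fcol V) (A *v fcol V))"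
  unfolding hip_def matrix_vector_mult_def by (simp, intro bm_intros bm_fcol)

lemma hip_fcol_self: "V \<in> space \<mu> \<Longrightarrow> hip (fcol V) (fcol V) = 1"
  by (simp add: hip_self norm_column_unitary unitary_space)

text \<open>The phase that corrects the determinant of \<open>g\<close> is absorbed by the phase
  invariance of \<open>F\<close>. Rank-one updates, whose determinant is not 1, thereby become
  admissible.\<close>

lemma expectation_unitary:
  fixes F :: "complex^'n \<Rightarrow> complex"
  assumes g: "unitary g" and meas: "(\<lambda>V. F (fcol V)) \<in> borel_measurable \<mu>"
    and balanced: "\<And>c v. cmod c = 1 \<Longrightarrow> F (\<chi> i. c * v $ i) = F v"
  shows "expectation (\<lambda>V. F (g *v fcol V)) = expectation (\<lambda>V. F (fcol V))"
proof -
  obtain c where c: "cmod c = 1" "(\<chi> i j. c * g $ i $ j) \<in> special_unitary"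
    using unitary_scale_special[OF g] by blast
  have "(\<chi> i j. c * g $ i $ j) *v v = (\<chi> i. c * (g *v v) $ i)" for v
    by (simp add: vec_eq_iff matrix_vector_mult_def sum_distrib_left mult_ac)
  then show ?thesis
    using expectation_translate[OF c(2) meas] balanced[OF c(1)] by (simp add: fcol_mult)
qed

text \<open>The derivative of \<open>cnj v\<^sub>b (Bv)\<^sub>a (v\<^sup>*Av)\<^sup>j\<close> in the direction \<open>w\<close>.\<close>

definition dirder :: "complex^'n^'n \<Rightarrow> complex^'n^'n \<Rightarrow> nat \<Rightarrow> 'n \<Rightarrow> 'n \<Rightarrow> complex^'n \<Rightarrow> complex^'n \<Rightarrow> complex" where
  "dirder A B j a b v w =
     cnj (w $ b) * (B *v v) $ a * hip v (A *v v) ^ j + cnj (v $ b) * (B *v w) $ a * hip v (A *v v) ^ j +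
     cnj (v $ b) * (B *v v) $ a * (of_nat j * hip v (A *v v) ^ (j - 1) * (hip w (A *v v) + hip v (A *v w)))"

text \<open>Differentiates the invariance under the one-parameter group exp(i \<theta> u u^H) at
  \<theta> = 0; its velocity at v is i u (u^H v). The family is explicit, being a rank-one update of
  the identity.\<close>

lemma expectation_dirder:
  "expectation (\<lambda>V. dirder A B j a b (fcol V) (\<chi> i. \<i> * u $ i * hip u (fcol V))) = 0"
proof -
  define k where "k = Re (hip u u)"
  have k: "hip u u = of_real k" by (simp add: k_def hip_self)
  have k0: "k = 0 \<longleftrightarrow> u = 0" by (simp add: k_def hip_self)
  \<comment> \<open>Chosen so that 1 + e k = exp(i k \<theta>), the factor by which the group
    multiplies u.\<close>
  define e where "e \<theta> = (if u = 0 then 0 else (cis (k * \<theta>) - 1) / of_real k)" for \<theta>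
  define e' where "e' \<theta> = (if u = 0 then 0 else \<i> * cis (k * \<theta>))" for \<theta>
  define v where "v i \<theta> V = fcol V $ i + e \<theta> * (u $ i * hip u (fcol V))" for i \<theta> V
  define v' where "v' i \<theta> V = e' \<theta> * (u $ i * hip u (fcol V))" for i \<theta> V
  define g where "g \<theta> = lin 1 (e \<theta>) (\<chi> i j. u $ i * cnj (u $ j))" for \<theta>
  define F where "F x = cnj (x $ b) * (B *v x) $ a * hip x (A *v x) ^ j" for x
  have e_der: "(e has_vector_derivative e' \<theta>) (at \<theta>)" for \<theta>
  proof (cases "u = 0")
    case False
    have "((\<lambda>z. (exp (\<i> * of_real k * z) - 1) / of_real k) has_field_derivative \<i> * exp (\<i> * of_real k * of_real \<theta>)) (at (of_real \<theta>))"
      using False k0 by (auto intro!: derivative_eq_intros)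
    then have "((\<lambda>x. (exp (\<i> * of_real k * of_real x) - 1) / of_real k) has_vector_derivative \<i> * exp (\<i> * of_real k * of_real \<theta>)) (at \<theta>)"
      by (rule has_vector_derivative_real_field)
    then show ?thesis
      using False by (simp add: e_def[abs_def] e'_def cis_conv_exp mult.assoc)
  qed (simp add: e_def[abs_def] e'_def)
  have e_bound: "cmod (e \<theta>) \<le> 2 / \<bar>k\<bar>" "cmod (e' \<theta>) \<le> 1" for \<theta>
    using norm_triangle_ineq4[of "cis (k * \<theta>)" 1]
    by (auto simp: e_def e'_def norm_divide norm_mult intro!: divide_right_mono)
  have bounded_deriv_v: "bounded_deriv (space \<mu>) (v i) (v' i)" for i
  proof -
    obtain C where C: "\<And>V. V \<in> space \<mu> \<Longrightarrow> cmod (u $ i * hip u (fcol V)) \<le> C"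
    proof -
      have "bm (\<lambda>V. u $ i * hip u (fcol V))"
        unfolding hip_def by (intro bm_intros bm_fcol)
      then show ?thesis using that by (auto simp: bm_def)
    qed
    obtain D where D: "\<And>V. V \<in> space \<mu> \<Longrightarrow> cmod (fcol V $ i) \<le> D"
      using bm_fcol[of i] by (auto simp: bm_def)
    have "bounded_deriv (space \<mu>) (\<lambda>\<theta> V. e \<theta>) (\<lambda>\<theta> V. e' \<theta>)"
    proof -
      have "cmod (e \<theta>) \<le> 2 / \<bar>k\<bar> + 1 \<and> cmod (e' \<theta>) \<le> 2 / \<bar>k\<bar> + 1" for \<theta>
        using e_bound[of \<theta>] norm_ge_zero[of "e \<theta>"] by linarith
      then show ?thesis unfolding bounded_deriv_def using e_der by blast
    qed
    moreover have "bounded_deriv (space \<mu>) (\<lambda>\<theta> V. u $ i * hip u (fcol V)) (\<lambda>\<theta> V. 0)"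
      unfolding bounded_deriv_def using C by (auto intro!: exI[of _ "max C 0"] simp: le_max_iff_disj)
    moreover have "bounded_deriv (space \<mu>) (\<lambda>\<theta> V. fcol V $ i) (\<lambda>\<theta> V. 0)"
      unfolding bounded_deriv_def using D by (auto intro!: exI[of _ "max D 0"] simp: le_max_iff_disj)
    ultimately have "bounded_deriv (space \<mu>) (\<lambda>\<theta> V. fcol V $ i + e \<theta> * (u $ i * hip u (fcol V)))
        (\<lambda>\<theta> V. 0 + (e \<theta> * 0 + e' \<theta> * (u $ i * hip u (fcol V))))"
      by (intro bounded_deriv_add bounded_deriv_mult)
    then show ?thesis by (simp add: v_def[abs_def] v'_def[abs_def])
  qed
  define s where "s \<theta> V = (\<Sum>i\<in>UNIV. cnj (v i \<theta> V) * (\<Sum>l\<in>UNIV. A $ i $ l * v l \<theta> V))" for \<theta> V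
  define s' where "s' \<theta> V = (\<Sum>i\<in>UNIV. cnj (v i \<theta> V) * (\<Sum>l\<in>UNIV. A $ i $ l * v' l \<theta> V + 0 * v l \<theta> V)
      + cnj (v' i \<theta> V) * (\<Sum>l\<in>UNIV. A $ i $ l * v l \<theta> V))" for \<theta> V
  have bounded_deriv_s: "bounded_deriv (space \<mu>) s s'"
    unfolding s_def[abs_def] s'_def[abs_def] by (intro bounded_deriv_sum bounded_deriv_mult bounded_deriv_cnj bounded_deriv_v bounded_deriv_const)
  define r where "r \<theta> V = (\<Sum>l\<in>UNIV. B $ a $ l * v l \<theta> V)" for \<theta> V
  define r' where "r' \<theta> V = (\<Sum>l\<in>UNIV. B $ a $ l * v' l \<theta> V + 0 * v l \<theta> V)" for \<theta> V
  have bounded_deriv_r: "bounded_deriv (space \<mu>) r r'"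
    unfolding r_def[abs_def] r'_def[abs_def] by (intro bounded_deriv_sum bounded_deriv_mult bounded_deriv_v bounded_deriv_const)
  define f where "f \<theta> V = cnj (v b \<theta> V) * r \<theta> V * s \<theta> V ^ j" for \<theta> V
  define f' where "f' \<theta> V = cnj (v b \<theta> V) * r \<theta> V * (of_nat j * s \<theta> V ^ (j - 1) * s' \<theta> V) +
      (cnj (v b \<theta> V) * r' \<theta> V + cnj (v' b \<theta> V) * r \<theta> V) * s \<theta> V ^ j" for \<theta> V
  have bounded_deriv_f: "bounded_deriv (space \<mu>) f f'"
    unfolding f_def[abs_def] f'_def[abs_def] by (intro bounded_deriv_mult bounded_deriv_power bounded_deriv_cnj bounded_deriv_v bounded_deriv_s bounded_deriv_r)
  have F_eq: "F x = cnj (x $ b) * (\<Sum>l\<in>UNIV. B $ a $ l * x $ l) *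
      (\<Sum>i\<in>UNIV. cnj (x $ i) * (\<Sum>l\<in>UNIV. A $ i $ l * x $ l)) ^ j" for x
    by (simp add: F_def hip_def matrix_vector_mult_def)
  have gv: "(g \<theta> *v fcol V) $ i = v i \<theta> V" for i \<theta> V
    by (simp add: g_def rank_one_update_mult v_def mult_ac)
  have f_eq: "f \<theta> V = F (g \<theta> *v fcol V)" for \<theta> V
    by (simp only: F_eq gv f_def r_def s_def)
  have g_unitary: "unitary (g \<theta>)" for \<theta>
    unfolding g_def
  proof (rule unitary_rank_one_update)
    show "cmod (1 + e \<theta> * hip u u) = 1" using k0 by (simp add: e_def k)
  qed (simp add: e_def)
  have bm_F: "bm (\<lambda>V. F (fcol V))"
    unfolding F_def hip_def matrix_vector_mult_def by (simp, intro bm_intros bm_fcol)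
  \<comment> \<open>Every factor pairs one conjugated with one plain entry of x, so the phases
    cancel.\<close>
  have balanced: "F (\<chi> i. c * x $ i) = F x" if "cmod c = 1" for c x
  proof -
    have c: "cnj c * c = 1" using that by (simp add: complex_norm_square[symmetric] mult.commute[of "cnj c"])
    have "M *v (\<chi> i. c * x $ i) = (\<chi> i. c * (M *v x) $ i)" for M :: "complex^'n^'n"
      by (simp add: vec_eq_iff matrix_vector_mult_def sum_distrib_left mult_ac)
    moreover have "hip (\<chi> i. c * x $ i) (\<chi> i. c * y $ i) = (cnj c * c) * hip x y" for y
      by (simp add: hip_def sum_distrib_left mult_ac)
    moreover have "cnj (c * x $ b) * (c * y) = (cnj c * c) * (cnj (x $ b) * y)" for y by simp
    ultimately show ?thesis unfolding F_def by (simp add: c)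
  qed
  have "bm (\<lambda>V. F (g \<theta> *v fcol V))" for \<theta>
    unfolding F_def hip_def matrix_vector_mult_def by (simp, intro bm_intros bm_fcol)
  then have meas: "f \<theta> \<in> borel_measurable \<mu>" for \<theta>
    using bm_measurable by (simp add: f_eq[abs_def])
  have inv: "expectation (f \<theta>) = expectation (\<lambda>V. F (fcol V))" for \<theta>
    unfolding f_eq[abs_def] by (rule expectation_unitary[OF g_unitary bm_measurable[OF bm_F] balanced])
  have f'0: "f' 0 = (\<lambda>V. dirder A B j a b (fcol V) (\<chi> i. \<i> * u $ i * hip u (fcol V)))"
  proof
    fix V
    have v0: "v i 0 V = fcol V $ i" for i by (simp add: v_def e_def)
    have v'0: "v' i 0 V = (\<chi> i. \<i> * u $ i * hip u (fcol V)) $ i" for i by (simp add: v'_def e'_def)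
    have "s 0 V = hip (fcol V) (A *v fcol V)"
      by (simp add: s_def v0 hip_def matrix_vector_mult_def)
    moreover have "r 0 V = (B *v fcol V) $ a"
      by (simp add: r_def v0 matrix_vector_mult_def)
    moreover have "r' 0 V = (B *v (\<chi> i. \<i> * u $ i * hip u (fcol V))) $ a"
      by (simp only: r'_def v'0 matrix_vector_mult_def) simp
    moreover have "s' 0 V = hip (\<chi> i. \<i> * u $ i * hip u (fcol V)) (A *v fcol V) +
        hip (fcol V) (A *v (\<chi> i. \<i> * u $ i * hip u (fcol V)))"
      by (simp only: s'_def v0 v'0 hip_def matrix_vector_mult_def sum.distrib) (simp add: sum.distrib)
    ultimately show "f' 0 V = dirder A B j a b (fcol V) (\<chi> i. \<i> * u $ i * hip u (fcol V))"
      unfolding f'_def dirder_def v0 v'0 by (simp only: algebra_simps)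
  qed
  have meas': "f' 0 \<in> borel_measurable \<mu>"
    unfolding f'0 dirder_def hip_def matrix_vector_mult_def
    by (rule bm_measurable, simp, intro bm_intros bm_fcol)
  show ?thesis
    using expectation_deriv[OF bounded_deriv_f meas _ meas'] inv unfolding f'0 by simp
qed

text \<open>The derivative is only real-linear in w. Separating the parts linear and antilinear in w
  lets complex combinations of directions act on each with its own coefficient.\<close>

lemma dirder_linear:
  "dirder A B j a b v w =
    (\<Sum>c\<in>UNIV. (cnj (v $ b) * B $ a $ c * hip v (A *v v) ^ j +
        cnj (v $ b) * (B *v v) $ a * (of_nat j * hip v (A *v v) ^ (j - 1) * (\<Sum>i\<in>UNIV. cnj (v $ i) * A $ i $ c))) * w $ c) +
    (\<Sum>c\<in>UNIV. ((if c = b then (B *v v) $ a * hip v (A *v v) ^ j else 0) +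
        cnj (v $ b) * (B *v v) $ a * (of_nat j * hip v (A *v v) ^ (j - 1) * (A *v v) $ c)) * cnj (w $ c))"
proof -
  have 1: "hip v (A *v w) = (\<Sum>c\<in>UNIV. (\<Sum>i\<in>UNIV. cnj (v $ i) * A $ i $ c) * w $ c)"
    unfolding hip_def matrix_vector_mult_def
    by (simp add: sum_distrib_left sum_distrib_right mult.assoc) (rule sum.swap)
  have 2: "hip w x = (\<Sum>c\<in>UNIV. x $ c * cnj (w $ c))" for x
    by (simp add: hip_def mult.commute)
  have 3: "(B *v w) $ a = (\<Sum>c\<in>UNIV. B $ a $ c * w $ c)"
    by (simp add: matrix_vector_mult_def)
  define P where "P = cnj (v $ b) * (B *v v) $ a * (of_nat j * hip v (A *v v) ^ (j - 1))"
  define S where "S = hip v (A *v v) ^ j"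
  define T where "T = (B *v v) $ a"
  have "dirder A B j a b v w = cnj (w $ b) * T * S + cnj (v $ b) * (B *v w) $ a * S + P * (hip w (A *v v) + hip v (A *v w))"
    by (simp add: dirder_def P_def S_def T_def mult.assoc)
  also have "\<dots> = (\<Sum>c\<in>UNIV. (cnj (v $ b) * B $ a $ c * S + P * (\<Sum>i\<in>UNIV. cnj (v $ i) * A $ i $ c)) * w $ c) +
    (\<Sum>c\<in>UNIV. ((if c = b then T * S else 0) + P * (A *v v) $ c) * cnj (w $ c))"
    unfolding 1 2 3
    by (simp add: distrib_right sum.distrib if_distrib[of "\<lambda>x. x * _"] cong: if_cong)
       (simp add: sum_distrib_left sum_distrib_right algebra_simps)
  finally show ?thesis unfolding P_def S_def T_def by (simp only: mult.assoc)
qed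

text \<open>Polarisation: the four directions \<open>e\<^sub>a + \<omega> e\<^sub>b\<close> with \<open>\<omega>\<^sup>4 = 1\<close> isolate one matrix unit of the Lie algebra.\<close>

lemma expectation_matrix_unit:
  "expectation (\<lambda>V. let v = fcol V; s = hip v (A *v v) in
     (cnj (v $ b) * B $ a $ a * s ^ j + cnj (v $ b) * (B *v v) $ a *
        (of_nat j * s ^ (j - 1) * (\<Sum>i\<in>UNIV. cnj (v $ i) * A $ i $ a))) * v $ b -
     ((B *v v) $ a * s ^ j + cnj (v $ b) * (B *v v) $ a * (of_nat j * s ^ (j - 1) * (A *v v) $ b)) * cnj (v $ a)) = 0"
proof -
  define u where "u \<omega> = (\<chi> i. (if i = a then 1 else 0) + (if i = b then \<omega> else 0))" for \<omega> :: complex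
  define W where "W \<omega> v = (\<chi> i. \<i> * u \<omega> $ i * hip (u \<omega>) v)" for \<omega> v
  \<comment> \<open>The factor - i cancels the i of the direction \<open>W\<close>. Averaging
    \<omega> times the product over the fourth roots of unity kills the terms in \<omega> and
    \<omega>^2 and keeps those in \<omega> cnj \<omega>.\<close>
  define K :: "complex \<Rightarrow> complex" where "K \<omega> = - \<i> * \<omega> / 4" for \<omega>
  define O4 :: "complex set" where "O4 = {1, \<i>, -1, -\<i>}"
  have O4: "sum f O4 = f 1 + f \<i> + f (-1) + f (-\<i>)" for f :: "complex \<Rightarrow> complex"
    by (simp add: O4_def complex_eq_iff add_ac)
  have u: "u \<omega> $ i = (if i = a then 1 else 0) + (if i = b then \<omega> else 0)" for \<omega> i
    by (simp add: u_def)
  have h: "hip (u \<omega>) v = v $ a + cnj \<omega> * v $ b" for \<omega> v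
    by (simp add: hip_def u_def distrib_right sum.distrib if_distrib[of cnj] if_distrib[of "\<lambda>x. x * _"] cong: if_cong)
  have W1: "(\<Sum>\<omega>\<in>O4. K \<omega> * W \<omega> v $ c) = (if c = a then v $ b else 0)" for v c
    unfolding O4 by (cases "c = a"; cases "c = b"; simp add: K_def W_def h u algebra_simps)
  have W2: "(\<Sum>\<omega>\<in>O4. K \<omega> * cnj (W \<omega> v $ c)) = (if c = b then - cnj (v $ a) else 0)" for v c
    unfolding O4 by (cases "c = a"; cases "c = b"; simp add: K_def W_def h u algebra_simps)
  have comb: "(\<Sum>\<omega>\<in>O4. K \<omega> * ((\<Sum>c\<in>UNIV. l c * W \<omega> v $ c) + (\<Sum>c\<in>UNIV. m c * cnj (W \<omega> v $ c)))) = l a * v $ b - m b * cnj (v $ a)"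
    for l m :: "'n \<Rightarrow> complex" and v
  proof -
    have "(\<Sum>\<omega>\<in>O4. K \<omega> * ((\<Sum>c\<in>UNIV. l c * W \<omega> v $ c) + (\<Sum>c\<in>UNIV. m c * cnj (W \<omega> v $ c)))) =
      (\<Sum>c\<in>UNIV. l c * (\<Sum>\<omega>\<in>O4. K \<omega> * W \<omega> v $ c)) + (\<Sum>c\<in>UNIV. m c * (\<Sum>\<omega>\<in>O4. K \<omega> * cnj (W \<omega> v $ c)))"
      unfolding O4 by (simp add: sum_distrib_left sum.distrib algebra_simps)
    then show ?thesis
      unfolding W1 W2 by (simp add: if_distrib[of "\<lambda>x. _ * x"] cong: if_cong)
  qed
  have z: "expectation (\<lambda>V. dirder A B j a b (fcol V) (W \<omega> (fcol V))) = 0" for \<omega>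
    unfolding W_def by (rule expectation_dirder)
  have bm: "bm (\<lambda>V. dirder A B j a b (fcol V) (W \<omega> (fcol V)))" for \<omega>
    unfolding dirder_def W_def hip_def matrix_vector_mult_def by (simp, intro bm_intros bm_fcol)
  have "expectation (\<lambda>V. \<Sum>\<omega>\<in>O4. K \<omega> * dirder A B j a b (fcol V) (W \<omega> (fcol V))) = 0"
    using z bm_integrable[OF bm] by (simp add: Bochner_Integration.integral_sum)
  then show ?thesis
    unfolding dirder_linear comb by (simp add: Let_def)
qed

text \<open>Integration by parts on the unit sphere.\<close>

lemma expectation_stein:
  "of_nat (CARD('n) + j) * expectation (\<lambda>V. hip (fcol V) (B *v fcol V) * hip (fcol V) (A *v fcol V) ^ j) =
     trace B * expectation (\<lambda>V. hip (fcol V) (A *v fcol V) ^ j) +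
     of_nat j * expectation (\<lambda>V. hip (fcol V) ((A ** B) *v fcol V) * hip (fcol V) (A *v fcol V) ^ (j - 1))"
proof -
  define v where "v = fcol"
  define s where "s V = hip (v V) (A *v v V)" for V
  define P where "P V a = (\<Sum>i\<in>UNIV. cnj (v V $ i) * A $ i $ a)" for V a
  define T where "T a b V =
     (cnj (v V $ b) * B $ a $ a * s V ^ j + cnj (v V $ b) * (B *v v V) $ a * (of_nat j * s V ^ (j - 1) * P V a)) * v V $ b -
     ((B *v v V) $ a * s V ^ j + cnj (v V $ b) * (B *v v V) $ a * (of_nat j * s V ^ (j - 1) * (A *v v V) $ b)) * cnj (v V $ a)" for a b V
  have T0: "expectation (T a b) = 0" for a b
    using expectation_matrix_unit[where a = a and b = b and A = A and B = B and j = j] unfolding T_def s_def v_def P_def Let_def .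
  have bm_T: "bm (T a b)" for a b
    unfolding T_def s_def v_def P_def hip_def matrix_vector_mult_def
    by (simp, intro bm_intros bm_fcol)
  have AB: "hip x ((A ** B) *v x) = (\<Sum>a\<in>UNIV. (B *v x) $ a * (\<Sum>i\<in>UNIV. cnj (x $ i) * A $ i $ a))" for x
  proof -
    have "hip x ((A ** B) *v x) = (\<Sum>i\<in>UNIV. \<Sum>a\<in>UNIV. cnj (x $ i) * (A $ i $ a * (B *v x) $ a))"
      unfolding matrix_vector_mul_assoc[symmetric] hip_def
      by (subst matrix_vector_mult_def) (simp add: sum_distrib_left)
    also have "\<dots> = (\<Sum>a\<in>UNIV. \<Sum>i\<in>UNIV. cnj (x $ i) * (A $ i $ a * (B *v x) $ a))"
      by (rule sum.swap)
    finally show ?thesis by (simp add: sum_distrib_left mult_ac)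
  qed
  \<comment> \<open>Summation over all matrix units. Since v has norm 1, the sum over b collapses; N
    comes from the N equal terms without b, and j from differentiating the power.\<close>
  have pointwise: "(\<Sum>a\<in>UNIV. \<Sum>b\<in>UNIV. T a b V) = trace B * s V ^ j +
      of_nat j * (hip (v V) ((A ** B) *v v V) * s V ^ (j - 1)) -
      of_nat (CARD('n) + j) * (hip (v V) (B *v v V) * s V ^ j)" if V: "V \<in> space \<mu>" for V
  proof -
    define x y z Q S R where "x = v V" and "y = B *v v V" and "z = A *v v V" and "Q = P V" and "S = s V ^ j"
      and "R = of_nat j * s V ^ (j - 1)"
    have xx: "(\<Sum>b\<in>UNIV. cnj (x $ b) * x $ b) = 1"
      using hip_fcol_self[OF V] by (simp add: hip_def x_def v_def)
    have sx: "(\<Sum>b\<in>UNIV. cnj (x $ b) * z $ b) = s V"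
      by (simp add: s_def hip_def x_def z_def)
    \<comment> \<open>Holds for j = 0 too, where the truncated exponent j - 1 is harmless because of
      the factor j.\<close>
    have Rs: "R * s V = of_nat j * S"
      by (cases j) (simp_all add: R_def S_def)
    have "(\<Sum>b\<in>UNIV. T a b V) = B $ a $ a * S + (y $ a * Q a) * R - of_nat CARD('n) * (cnj (x $ a) * y $ a) * S - (cnj (x $ a) * y $ a) * (of_nat j * S)" for a
    proof -
      have "(\<Sum>b\<in>UNIV. T a b V) = (\<Sum>b\<in>UNIV. (B $ a $ a * S + y $ a * Q a * R) * (cnj (x $ b) * x $ b) - y $ a * cnj (x $ a) * S
          - y $ a * cnj (x $ a) * R * (cnj (x $ b) * z $ b))"
        by (intro sum.cong refl) (simp add: T_def x_def y_def z_def Q_def S_def R_def algebra_simps)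
      also have "\<dots> = (B $ a $ a * S + y $ a * Q a * R) - of_nat CARD('n) * (y $ a * cnj (x $ a) * S) - y $ a * cnj (x $ a) * (R * s V)"
        unfolding sum_subtractf sum_distrib_left[symmetric] xx sx by simp
      finally show ?thesis unfolding Rs by (simp add: algebra_simps)
    qed
    then have "(\<Sum>a\<in>UNIV. \<Sum>b\<in>UNIV. T a b V) = trace B * S + (\<Sum>a\<in>UNIV. y $ a * Q a) * R -
        of_nat CARD('n) * (\<Sum>a\<in>UNIV. cnj (x $ a) * y $ a) * S - (\<Sum>a\<in>UNIV. cnj (x $ a) * y $ a) * (of_nat j * S)"
      by (simp add: sum.distrib sum_subtractf sum_distrib_left sum_distrib_right trace_def)
    moreover have "(\<Sum>a\<in>UNIV. y $ a * Q a) = hip (v V) ((A ** B) *v v V)"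
      by (simp add: AB y_def Q_def P_def)
    moreover have "(\<Sum>a\<in>UNIV. cnj (x $ a) * y $ a) = hip (v V) (B *v v V)"
      by (simp add: hip_def x_def y_def)
    ultimately show ?thesis by (simp add: S_def R_def algebra_simps)
  qed
  have "0 = expectation (\<lambda>V. \<Sum>a\<in>UNIV. \<Sum>b\<in>UNIV. T a b V)"
    using T0 by (simp add: Bochner_Integration.integral_sum bm_integrable bm_T bm_sum)
  also have "\<dots> = expectation (\<lambda>V. trace B * s V ^ j +
      of_nat j * (hip (v V) ((A ** B) *v v V) * s V ^ (j - 1)) -
      of_nat (CARD('n) + j) * (hip (v V) (B *v v V) * s V ^ j))"
    by (rule Bochner_Integration.integral_cong[OF refl pointwise])
  also have "\<dots> = trace B * expectation (\<lambda>V. s V ^ j) +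
      of_nat j * expectation (\<lambda>V. hip (v V) ((A ** B) *v v V) * s V ^ (j - 1)) -
      of_nat (CARD('n) + j) * expectation (\<lambda>V. hip (v V) (B *v v V) * s V ^ j)"
  proof -
    have "bm (\<lambda>V. s V ^ j)" "bm (\<lambda>V. hip (v V) ((A ** B) *v v V) * s V ^ (j - 1))" "bm (\<lambda>V. hip (v V) (B *v v V) * s V ^ j)"
      unfolding s_def v_def by (intro bm_intros bm_hip_fcol)+
    note i = this[THEN bm_integrable]
    show ?thesis using i by simp
  qed
  finally show ?thesis by (simp add: s_def v_def)
qed

text \<open>The prefactor is binom(N + m - 1, m), the number of monomials of degree m in N
  variables. It is the value of h_m at the identity matrix, where the expectation equals 1.\<close>

definition csym :: "nat \<Rightarrow> complex^'n^'n \<Rightarrow> complex" where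
  "csym m U = pochhammer (of_nat CARD('n)) m / fact m * expectation (\<lambda>V. hip (fcol V) (U *v fcol V) ^ m)"

lemma csym_0: "csym 0 U = 1"
  by (simp add: csym_def prob_space)

text \<open>With \<beta> the normalised average of (v^H B v)(v^H U v)^j, integration by parts peels
  off tr(B) h_j and replaces B by U B and j by j - 1. Starting from B = U, this unrolls to Newton's
  identity.\<close>

lemma csym_newton:
  "of_nat (Suc m) * csym (Suc m) U = (\<Sum>i\<le>m. trace (mpow U (Suc i)) * csym (m - i) U)"
proof -
  define \<rho> :: "nat \<Rightarrow> complex" where "\<rho> j = pochhammer (of_nat CARD('n)) j / fact j" for j
  define \<beta> where "\<beta> B j = of_nat (CARD('n) + j) * \<rho> j *
      expectation (\<lambda>V. hip (fcol V) (B *v fcol V) * hip (fcol V) (U *v fcol V) ^ j)" for B j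
  have \<rho>_Suc: "of_nat (Suc j) * \<rho> (Suc j) = of_nat (CARD('n) + j) * \<rho> j" for j
    by (simp add: \<rho>_def pochhammer_Suc divide_simps del: of_nat_Suc)
  have \<beta>_0: "\<beta> B 0 = trace B * csym 0 U" for B
    using expectation_stein[of 0 B U] by (simp add: \<beta>_def csym_def \<rho>_def mult_ac)
  have \<beta>_Suc: "\<beta> B (Suc j) = trace B * csym (Suc j) U + \<beta> (U ** B) j" for B j
  proof -
    have "\<beta> B (Suc j) = \<rho> (Suc j) * (trace B * expectation (\<lambda>V. hip (fcol V) (U *v fcol V) ^ Suc j) +
        of_nat (Suc j) * expectation (\<lambda>V. hip (fcol V) ((U ** B) *v fcol V) * hip (fcol V) (U *v fcol V) ^ j))"
      using expectation_stein[of "Suc j" B U] unfolding \<beta>_def by (simp only: diff_Suc_1 mult.assoc mult.left_commute[of _ "\<rho> (Suc j)"])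
    also have "\<dots> = trace B * csym (Suc j) U + \<beta> (U ** B) j"
      unfolding \<beta>_def \<rho>_Suc[symmetric] csym_def \<rho>_def[symmetric] by (simp only: algebra_simps)
    finally show ?thesis .
  qed
  have "\<beta> (mpow U (Suc k)) j = (\<Sum>i\<le>j. trace (mpow U (Suc (k + i))) * csym (j - i) U)" for j k
  proof (induction j arbitrary: k)
    case (Suc j)
    have "\<beta> (mpow U (Suc k)) (Suc j) = trace (mpow U (Suc k)) * csym (Suc j) U + \<beta> (mpow U (Suc (Suc k))) j"
      unfolding \<beta>_Suc by simp
    then show ?case
      unfolding Suc by (subst sum.atMost_Suc_shift) simp
  qed (simp add: \<beta>_0)
  from this[of 0 m] have "\<beta> U m = (\<Sum>i\<le>m. trace (mpow U (Suc i)) * csym (m - i) U)" by simp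
  moreover have "\<beta> U m = of_nat (Suc m) * csym (Suc m) U"
    unfolding csym_def \<beta>_def \<rho>_def[symmetric] \<rho>_Suc[symmetric] by (simp del: of_nat_Suc add: mult_ac)
  ultimately show ?thesis by simp
qed

text \<open>So \<open>csym m U\<close> is the complete symmetric polynomial of degree \<open>m\<close> in the eigenvalues of \<open>U\<close>.\<close>

lemma csym_fps: "Abs_fps (\<lambda>m. csym m U) * fps_of_poly (rev_char_poly U) = 1"
proof -
  let ?H = "Abs_fps (\<lambda>m. csym m U)" and ?P = "fps_of_poly (rev_char_poly U)"
  let ?T = "Abs_fps (\<lambda>k. trace (mpow U (Suc k)))"
  have "fps_deriv ?H = ?T * ?H"
  proof (rule fps_ext)
    fix n
    show "fps_nth (fps_deriv ?H) n = fps_nth (?T * ?H) n"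
      using csym_newton[of n U] by (simp add: fps_mult_nth atMost_atLeast0 del: mpow.simps)
  qed
  then have "fps_deriv (?H * ?P) = 0"
    by (simp add: fps_deriv_rev_char_poly algebra_simps del: mpow.simps)
  then have "?H * ?P = fps_const (fps_nth (?H * ?P) 0)"
    unfolding fps_deriv_eq_0_iff .
  then show ?thesis by (simp add: csym_0 coeff_rev_char_poly_0)
qed

lemma csym_recurrence: "(\<Sum>r\<le>m. coeff (rev_char_poly U) r * csym (m - r) U) = (if m = 0 then 1 else 0)"
proof -
  have "fps_nth (fps_of_poly (rev_char_poly U) * Abs_fps (\<lambda>m. csym m U)) m = (if m = 0 then 1 else 0)"
    using csym_fps[of U] by (simp add: mult.commute)
  then show ?thesis by (simp add: fps_mult_nth atMost_atLeast0)
qed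

lemma norm_csym_le:
  assumes "unitary U"
  shows "cmod (csym m U) \<le> pochhammer (real CARD('n)) m / fact m"
proof -
  have int: "integrable \<mu> (\<lambda>V. hip (fcol V) (U *v fcol V) ^ m)"
    by (intro bm_integrable bm_power bm_hip_fcol)
  have "cmod (hip (fcol V) (U *v fcol V) ^ m) \<le> 1" if "V \<in> space \<mu>" for V
    using norm_hip_unitary_le[OF assms norm_column_unitary[OF unitary_space[OF that]]]
    by (simp add: norm_power power_le_one)
  then have "cmod (expectation (\<lambda>V. hip (fcol V) (U *v fcol V) ^ m)) \<le> expectation (\<lambda>V. 1)"
    by (intro order_trans[OF integral_norm_bound] integral_mono integrable_norm int) auto
  then have "cmod (expectation (\<lambda>V. hip (fcol V) (U *v fcol V) ^ m)) \<le> 1"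
    by (simp add: prob_space)
  then show ?thesis
    unfolding csym_def norm_mult by (simp add: pochhammer_of_nat norm_divide norm_mult mult_left_le divide_right_mono)
qed

section \<open>Integrals of products of N - 1 complete symmetric functions\<close>

lemma ex_orthogonal_unit:
  fixes w :: "'n \<Rightarrow> complex^'n"
  obtains b where "hip b b = 1" "\<And>k. k \<noteq> k0 \<Longrightarrow> hip (w k) b = 0"
proof -
  \<comment> \<open>Leaving out the index \<open>k0\<close> is how N - 1 vectors are encoded: the
    zero row makes the matrix singular, and a normalised kernel vector is the common normal.\<close>
  define M :: "complex^'n^'n" where "M = (\<chi> k i. if k = k0 then 0 else cnj (w k $ i))"
  have "row k0 M = 0" by (simp add: M_def row_def vec_eq_iff)
  then have "det M = 0" by (rule det_zero_row)
  then have "\<nexists>B. B ** M = mat 1"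
    by (metis det_I det_mul mult_zero_right zero_neq_one)
  then obtain b where b: "M *v b = 0" "b \<noteq> 0"
    unfolding matrix_left_invertible_ker by blast
  define c where "c = (\<chi> i. b $ i / of_real (norm b))"
  have "hip b b / of_real (norm b) ^ 2 = 1"
    using b(2) by (simp add: hip_self)
  moreover have "hip c c = hip b b / of_real (norm b) ^ 2"
    by (simp add: hip_def c_def power2_eq_square sum_divide_distrib)
  moreover have "hip (w k) c = 0" if "k \<noteq> k0" for k
  proof -
    have "(M *v b) $ k = 0" using b by simp
    then have "hip (w k) b = 0" using that by (simp add: M_def matrix_vector_mult_def hip_def)
    moreover have "hip (w k) c = hip (w k) b / of_real (norm b)"
      by (simp add: hip_def c_def sum_divide_distrib)
    ultimately show ?thesis by simp
  qed
  ultimately show ?thesis using that by metis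
qed

text \<open>Fewer than \<open>N\<close> vectors have a common normal \<open>b\<close>; the element of the group which acts as a scalar
  off \<open>b\<close> multiplies the integrand by a nontrivial phase.\<close>

lemma expectation_prod_hip_eq_0:
  fixes w :: "'n \<Rightarrow> complex^'n"
  assumes pos: "(\<Sum>k\<in>UNIV - {k0}. m k) > 0"
  shows "expectation (\<lambda>U. \<Prod>k\<in>UNIV - {k0}. hip (w k) (U *v w k) ^ m k) = 0"
proof -
  define d where "d = (\<Sum>k\<in>UNIV - {k0}. m k)"
  obtain b where b: "hip b b = 1" "\<And>k. k \<noteq> k0 \<Longrightarrow> hip (w k) b = 0"
    using ex_orthogonal_unit by blast
  \<comment> \<open>With this phase a product of total degree d changes sign, so its integral is its
    own negative.\<close>
  define c where "c = cis (pi / d)"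
  have "d > 0" using pos by (simp add: d_def)
  then have cd: "c ^ d = -1"
    unfolding c_def Complex.DeMoivre by simp
  \<comment> \<open>The eigenvalue on b is adjusted so that c h has determinant c^N z = 1.\<close>
  define z where "z = 1 / c ^ CARD('n)"
  define h where "h = lin 1 (z - 1) (\<chi> i j. b $ i * cnj (b $ j))"
  define g where "g = (\<chi> i j. c * h $ i $ j)"
  have c1: "cmod c = 1" by (simp add: c_def)
  have "unitary h"
    unfolding h_def using b(1) c1
    by (intro unitary_rank_one_update) (auto simp: z_def norm_divide norm_power hip_def)
  moreover have "det h = z"
    unfolding h_def by (subst det_rank_one_update) (use b(1) in \<open>simp_all add: hip_def mult.commute\<close>)
  ultimately have g: "g \<in> special_unitary"
    using c1 by (auto simp: special_unitary_iff g_def det_scale z_def intro!: unitary_scale)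
  have gw: "hip (w k) (g *v x) = c * hip (w k) x" if "k \<noteq> k0" for k x
  proof -
    have "g *v x = (\<chi> i. c * (h *v x) $ i)"
      by (simp add: g_def vec_eq_iff matrix_vector_mult_def sum_distrib_left mult_ac)
    moreover have "hip (w k) (\<chi> i. c * (\<chi> i. x $ i + t * b $ i) $ i) = c * hip (w k) x + c * t * hip (w k) b" for t
      by (simp add: hip_def distrib_left sum.distrib sum_distrib_left mult_ac)
    ultimately have "hip (w k) (g *v x) = c * hip (w k) x + c * ((z - 1) * hip b x) * hip (w k) b"
      unfolding h_def rank_one_update_mult by simp
    then show ?thesis using b(2)[OF that] by simp
  qed
  let ?f = "\<lambda>U. \<Prod>k\<in>UNIV - {k0}. hip (w k) (U *v w k) ^ m k"
  have bm: "bm ?f"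
    unfolding hip_def matrix_vector_mult_def by (simp, intro bm_intros)
  have "?f (g ** U) = c ^ d * ?f U" for U
  proof -
    have "?f (g ** U) = (\<Prod>k\<in>UNIV - {k0}. c ^ m k * hip (w k) (U *v w k) ^ m k)"
      by (intro prod.cong) (auto simp: gw matrix_vector_mul_assoc[symmetric] power_mult_distrib)
    then show ?thesis by (simp add: prod.distrib power_sum d_def)
  qed
  then have "expectation ?f = - expectation ?f"
    using expectation_translate[OF g bm_measurable[OF bm]] by (simp add: cd)
  then show ?thesis by simp
qed

lemma measurable_hip_pair:
  "(\<lambda>p. hip (fcol (snd p)) (fst p *v fcol (snd p)) ^ m) \<in> borel_measurable (\<mu> \<Otimes>\<^sub>M \<mu>)"
proof -
  have 1: "(\<lambda>p. fst p $ i $ j) \<in> borel_measurable (\<mu> \<Otimes>\<^sub>M \<mu>)" for i j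
    by (rule measurable_compose[OF measurable_fst measurable_entry])
  have 2: "(\<lambda>p. snd p $ i $ j) \<in> borel_measurable (\<mu> \<Otimes>\<^sub>M \<mu>)" for i j
    by (rule measurable_compose[OF measurable_snd measurable_entry])
  have 3: "(\<lambda>p. cnj (snd p $ i $ j)) \<in> borel_measurable (\<mu> \<Otimes>\<^sub>M \<mu>)" for i j
    by (rule measurable_compose[OF 2 borel_measurable_continuous_onI[OF continuous_on_cnj[OF continuous_on_id]]])
  show ?thesis
    unfolding hip_def matrix_vector_mult_def column_def
    by (simp, intro borel_measurable_power borel_measurable_sum borel_measurable_times 1 2 3)
qed

lemma bm_csym: "bm (csym m)"
proof (rule bmI)
  have "(\<lambda>U. expectation (\<lambda>V. hip (fcol V) (U *v fcol V) ^ m)) \<in> borel_measurable \<mu>"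
    using borel_measurable_lebesgue_integral[of "\<lambda>U V. hip (fcol V) (U *v fcol V) ^ m" \<mu>] measurable_hip_pair[of m]
    by (simp add: case_prod_beta')
  then show "csym m \<in> borel_measurable \<mu>"
    unfolding csym_def[abs_def] by measurable
  show "cmod (csym m U) \<le> pochhammer (real CARD('n)) m / fact m" if "U \<in> space \<mu>" for U
    using norm_csym_le unitary_space that by blast
qed

text \<open>Induction on the number of factors that are already averaged. By Fubini one more average
  over unit vectors may be taken last, and for each fixed vector the integral vanishes by the
  induction hypothesis.\<close>

lemma expectation_mixed_eq_0:
  fixes w :: "'n \<Rightarrow> complex^'n"
  assumes pos: "(\<Sum>k\<in>UNIV - {k0}. m k) > 0" and "finite I" "I \<subseteq> UNIV - {k0}"
  shows "expectation (\<lambda>U. (\<Prod>k\<in>I. csym (m k) U) * (\<Prod>k\<in>UNIV - {k0} - I. hip (w k) (U *v w k) ^ m k)) = 0"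
  using assms(2,3)
proof (induction I arbitrary: w rule: finite_induct)
  case empty
  then show ?case using expectation_prod_hip_eq_0[OF pos, of w] by simp
next
  case (insert x I)
  interpret P: pair_prob_space \<mu> \<mu> ..
  define \<rho> :: complex where "\<rho> = pochhammer (of_nat CARD('n)) (m x) / fact (m x)"
  define R where "R U = (\<Prod>k\<in>I. csym (m k) U) * (\<Prod>k\<in>UNIV - {k0} - insert x I. hip (w k) (U *v w k) ^ m k)" for U
  define H where "H U V = hip (fcol V) (U *v fcol V) ^ m x" for U V
  have bm_R: "bm R"
    unfolding R_def hip_def matrix_vector_mult_def by (simp, intro bm_intros bm_csym)
  have inner: "expectation (\<lambda>U. R U * H U V) = 0" for V
  proof -
    \<comment> \<open>For frozen V the new factor is a power attached to the vector
      \<open>fcol V\<close> in slot x; this is why the induction runs over all families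
      \<open>w\<close>.\<close>
    have "R U * H U V = (\<Prod>k\<in>I. csym (m k) U) * (\<Prod>k\<in>UNIV - {k0} - I. hip ((w(x := fcol V)) k) (U *v (w(x := fcol V)) k) ^ m k)" for U
    proof -
      have "UNIV - {k0} - I = insert x (UNIV - {k0} - insert x I)" using insert by auto
      moreover have "(\<Prod>k\<in>UNIV - {k0} - insert x I. hip ((w(x := fcol V)) k) (U *v (w(x := fcol V)) k) ^ m k)
        = (\<Prod>k\<in>UNIV - {k0} - insert x I. hip (w k) (U *v w k) ^ m k)"
        by (intro prod.cong) auto
      ultimately show ?thesis by (simp add: R_def H_def mult_ac)
    qed
    then show ?thesis using insert by simp
  qed
  obtain C where C: "\<And>U. U \<in> space \<mu> \<Longrightarrow> cmod (R U) \<le> C" using bm_R by (auto simp: bm_def)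
  have "integrable (\<mu> \<Otimes>\<^sub>M \<mu>) (\<lambda>p. R (fst p) * H (fst p) (snd p))"
  proof (rule P.integrable_const_bound[where B = "\<bar>C\<bar> * 1"])
    show "(\<lambda>p. R (fst p) * H (fst p) (snd p)) \<in> borel_measurable (\<mu> \<Otimes>\<^sub>M \<mu>)"
      unfolding H_def
      by (intro borel_measurable_times measurable_hip_pair measurable_compose[OF measurable_fst bm_measurable[OF bm_R]])
    show "AE p in \<mu> \<Otimes>\<^sub>M \<mu>. norm (R (fst p) * H (fst p) (snd p)) \<le> \<bar>C\<bar> * 1"
    proof (rule AE_I2)
      fix p assume "p \<in> space (\<mu> \<Otimes>\<^sub>M \<mu>)"
      then have p: "fst p \<in> space \<mu>" "snd p \<in> space \<mu>" by (auto simp: space_pair_measure)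
      have "cmod (hip (fcol (snd p)) (fst p *v fcol (snd p))) \<le> 1"
        by (intro norm_hip_unitary_le norm_column_unitary unitary_space p)
      then have "cmod (H (fst p) (snd p)) \<le> 1"
        unfolding H_def norm_power by (intro power_le_one) auto
      then show "norm (R (fst p) * H (fst p) (snd p)) \<le> \<bar>C\<bar> * 1"
        unfolding norm_mult using C[OF p(1)] by (intro mult_mono) auto
    qed
  qed
  then have "expectation (\<lambda>U. expectation (\<lambda>V. R U * H U V)) = expectation (\<lambda>V. expectation (\<lambda>U. R U * H U V))"
    using P.Fubini_integral[of "\<lambda>U V. R U * H U V"] by (simp add: case_prod_beta')
  also have "\<dots> = 0" by (simp add: inner)
  finally have 0: "expectation (\<lambda>U. expectation (\<lambda>V. R U * H U V)) = 0" .
  have "(\<Prod>k\<in>insert x I. csym (m k) U) * (\<Prod>k\<in>UNIV - {k0} - insert x I. hip (w k) (U *v w k) ^ m k)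
     = \<rho> * expectation (\<lambda>V. R U * H U V)" for U
    using insert.hyps by (simp add: R_def csym_def H_def \<rho>_def mult_ac)
  then show ?case using 0 by simp
qed

lemma expectation_prod_csym:
  fixes m :: "'n \<Rightarrow> nat"
  shows
  "expectation (\<lambda>U. \<Prod>k\<in>UNIV - {k0}. csym (m k) U) = (if \<forall>k\<in>UNIV - {k0}. m k = 0 then 1 else 0)"
proof (cases "\<forall>k\<in>UNIV - {k0}. m k = 0")
  case True
  then show ?thesis by (simp add: csym_0 prob_space)
next
  case False
  then have "(\<Sum>k\<in>UNIV - {k0}. m k) > 0" by (meson finite gr_zeroI sum_eq_0_iff)
  from expectation_mixed_eq_0[OF this, of "UNIV - {k0}"] False show ?thesis by simp
qed

end

section \<open>Companion matrices and Schur functions\<close>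

text \<open>The index type carries no order, while Toeplitz and companion matrices need one; an
  arbitrary numbering by 0, ..., N - 1 supplies it.\<close>

definition phi :: "'n::finite \<Rightarrow> nat" where
  "phi = (SOME f. bij_betw f (UNIV :: 'n set) {0..<CARD('n)})"

lemma bij_phi: "bij_betw phi (UNIV :: 'n::finite set) {..<CARD('n)}"
  unfolding phi_def using ex_bij_betw_finite_nat[of "UNIV :: 'n set"] by (metis finite lessThan_atLeast0 someI_ex)

lemma phi_less: "phi (i :: 'n::finite) < CARD('n)"
  using bij_phi[where ?'n = 'n] by (auto simp: bij_betw_def)

lemma phi_eq_iff [simp]: "phi i = phi j \<longleftrightarrow> i = j"
  using bij_phi by (auto simp: bij_betw_def inj_on_def)

lemma ex_phi: "r < CARD('n) \<Longrightarrow> \<exists>i :: 'n::finite. phi i = r"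
  using bij_phi[where ?'n = 'n] unfolding bij_betw_def by (metis imageE lessThan_iff)

lemma sum_phi: "(\<Sum>k\<in>(UNIV :: 'n::finite set). f (phi k)) = (\<Sum>r<CARD('n). f r)"
  by (rule sum.reindex_bij_betw[OF bij_phi])

text \<open>Both sides have the same sum over all i, so the inequalities are equalities.\<close>

lemma permutes_phi_ge:
  assumes "p permutes (UNIV :: 'n::finite set)" "\<And>i. phi i \<le> phi (p i)"
  shows "p = id"
proof -
  have "(\<Sum>i\<in>UNIV. phi (p i)) = (\<Sum>i\<in>(UNIV :: 'n set). phi i)"
    using sum.permute[OF assms(1), of phi] by (simp add: o_def)
  then have "phi i = phi (p i)" for i
    using sum_mono_inv[of phi UNIV "\<lambda>i. phi (p i)" i] assms(2) by simp
  then show ?thesis by (metis eq_id_iff phi_eq_iff)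
qed

lemma det_upper_triangular_phi:
  fixes A :: "'a::comm_ring_1^'n^'n"
  assumes "\<And>i j. phi j < phi i \<Longrightarrow> A $ i $ j = 0"
  shows "det A = (\<Prod>i\<in>UNIV. A $ i $ i)"
proof -
  have "(\<Prod>i\<in>UNIV. A $ i $ p i) = 0" if p: "p permutes UNIV" "p \<noteq> id" for p
  proof -
    obtain i where "phi (p i) < phi i"
      using permutes_phi_ge[OF p(1)] p(2) by (metis not_le)
    then show ?thesis using assms by (intro prod_zero) auto
  qed
  then have "det A = (\<Sum>p\<in>{id}. of_int (sign p) * (\<Prod>i\<in>UNIV. A $ i $ p i))"
    unfolding det_def by (intro sum.mono_neutral_right) (auto simp: permutes_id)
  then show ?thesis by simp
qed

lemma det_lower_triangular_phi:
  fixes A :: "'a::comm_ring_1^'n^'n"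
  assumes "\<And>i j. phi i < phi j \<Longrightarrow> A $ i $ j = 0"
  shows "det A = (\<Prod>i\<in>UNIV. A $ i $ i)"
  using det_upper_triangular_phi[of "transpose A"] assms unfolding det_transpose by (simp add: transpose_def)

text \<open>Arranged to act from the right on rows (G(a), G(a - 1), ..., G(a - N + 1)): every column
  but the first shifts, and the first computes G(a + 1) from the recurrence.\<close>

definition companion :: "(nat \<Rightarrow> complex) \<Rightarrow> complex^'n^'n" where
  "companion p = (\<chi> k j. if phi j = 0 then - p (Suc (phi k)) else if Suc (phi k) = phi j then 1 else 0)"

text \<open>The unitriangular matrix Y of powers of x performs row operations after which all
  columns with positive number are unit vectors; the remaining diagonal entry accumulates the whole
  polynomial.\<close>

lemma det_lin_companion:
  assumes "p 0 = 1"
  shows "det (lin 1 (-x) (companion p :: complex^'n^'n)) = (\<Sum>r\<le>CARD('n). p r * x ^ r)"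
proof -
  define Y :: "complex^'n^'n" where "Y = (\<chi> i j. if phi i \<le> phi j then x ^ (phi j - phi i) else 0)"
  let ?L = "Y ** lin 1 (-x) (companion p :: complex^'n^'n)"
  have L: "?L $ i $ j = Y $ i $ j - x * (\<Sum>k\<in>UNIV. Y $ i $ k * companion p $ k $ j)" for i j
    by (simp add: matrix_matrix_mult_def lin_nth distrib_left sum.distrib sum_subtractf right_diff_distrib
        if_distrib[of "\<lambda>x. _ * x"] sum_distrib_left mult_ac cong: if_cong)
  have L1: "?L $ i $ j = (if i = j then 1 else 0)" if j: "phi j > 0" for i j
  proof -
    obtain k0 :: 'n where k0: "phi k0 = phi j - 1"
      using ex_phi[of "phi j - 1", where ?'n = 'n] phi_less[of j] by (metis less_imp_diff_less)
    have "(\<Sum>k\<in>UNIV. Y $ i $ k * companion p $ k $ j) = (\<Sum>k\<in>UNIV. if k = k0 then Y $ i $ k0 else 0)"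
    proof (intro sum.cong refl)
      fix k
      have "Suc (phi k) = phi j \<longleftrightarrow> k = k0" using k0 j by (metis Suc_pred diff_Suc_1 phi_eq_iff)
      then show "Y $ i $ k * companion p $ k $ j = (if k = k0 then Y $ i $ k0 else 0)"
        using j by (auto simp: companion_def)
    qed
    then have "?L $ i $ j = Y $ i $ j - x * Y $ i $ k0" by (simp add: L)
    moreover have "phi i = phi j \<longleftrightarrow> i = j" by simp
    ultimately show ?thesis
      using j k0 by (cases "phi i" "phi j" rule: linorder_cases)
        (auto simp: Y_def power_Suc[symmetric] Suc_diff_Suc simp del: power_Suc phi_eq_iff)
  qed
  obtain i0 :: 'n where i0: "phi i0 = 0" using ex_phi[of 0, where ?'n = 'n] by auto
  have "?L $ i0 $ i0 = (\<Sum>r\<le>CARD('n). p r * x ^ r)"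
  proof -
    have "(\<Sum>k\<in>UNIV. Y $ i0 $ k * companion p $ k $ i0) = (\<Sum>k\<in>(UNIV :: 'n set). (\<lambda>r. - (x ^ r * p (Suc r))) (phi k))"
      by (intro sum.cong) (simp_all add: Y_def companion_def i0)
    also have "\<dots> = (\<Sum>r<CARD('n). - (x ^ r * p (Suc r)))" by (rule sum_phi)
    finally have s: "(\<Sum>k\<in>UNIV. Y $ i0 $ k * companion p $ k $ i0) = (\<Sum>r<CARD('n). - (x ^ r * p (Suc r)))" .
    have "Y $ i0 $ i0 = 1" by (simp add: Y_def)
    then have "?L $ i0 $ i0 = 1 + x * (\<Sum>r<CARD('n). x ^ r * p (Suc r))"
      unfolding L s by (simp add: sum_negf)
    also have "\<dots> = (\<Sum>r\<le>CARD('n). p r * x ^ r)"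
      by (subst sum.atMost_shift) (simp add: assms sum_distrib_left mult_ac)
    finally show ?thesis .
  qed
  then have "?L $ i $ i = (if i = i0 then (\<Sum>r\<le>CARD('n). p r * x ^ r) else 1)" for i
    using L1[of i i] i0 by (cases "phi i = 0") (auto, metis i0 phi_eq_iff)
  then have "det ?L = (\<Sum>r\<le>CARD('n). p r * x ^ r)"
    by (subst det_lower_triangular_phi) (use L1 in auto)
  moreover have "det Y = 1"
    by (subst det_upper_triangular_phi) (auto simp: Y_def)
  ultimately show ?thesis by (simp add: det_mul)
qed

text \<open>Sequences run over all integers, so shifts act in both directions;
  \<open>p 0 = 1\<close> lets the leading term be solved for.\<close>

definition lin_rec :: "nat \<Rightarrow> (nat \<Rightarrow> complex) \<Rightarrow> (int \<Rightarrow> complex) \<Rightarrow> bool" where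
  "lin_rec N p G \<longleftrightarrow> p 0 = 1 \<and> (\<forall>m. (\<Sum>r\<le>N. p r * G (m - int r)) = 0)"

text \<open>For G the sequence of complete symmetric functions this is the Jacobi-Trudi matrix, with
  \<alpha> listing the parts displaced by the numbering.\<close>

definition row_mat :: "(int \<Rightarrow> complex) \<Rightarrow> ('n \<Rightarrow> int) \<Rightarrow> complex^'n^'n" where
  "row_mat G \<alpha> = (\<chi> i j. G (\<alpha> i - int (phi j)))"

lemma row_mat_companion:
  fixes \<alpha> :: "'n::finite \<Rightarrow> int"
  assumes "lin_rec CARD('n) p G"
  shows "row_mat G \<alpha> ** companion p = row_mat (\<lambda>m. G (m + 1)) \<alpha>"
proof -
  have "(row_mat G \<alpha> ** companion p) $ i $ j = G (\<alpha> i - int (phi j) + 1)" for i j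
  proof (cases "phi j = 0")
    case True
    have "(row_mat G \<alpha> ** companion p) $ i $ j = (\<Sum>k\<in>(UNIV :: 'n set). (\<lambda>r. - (p (Suc r) * G (\<alpha> i - int r))) (phi k))"
      by (simp add: matrix_matrix_mult_def row_mat_def companion_def True mult.commute)
    also have "\<dots> = (\<Sum>r<CARD('n). - (p (Suc r) * G (\<alpha> i - int r)))" by (rule sum_phi)
    also have "\<dots> = G (\<alpha> i + 1) - (\<Sum>r\<le>CARD('n). p r * G (\<alpha> i + 1 - int r))"
      using assms by (subst sum.atMost_shift) (simp add: lin_rec_def sum_negf)
    finally show ?thesis using assms True by (simp add: lin_rec_def)
  next
    case False
    obtain k0 :: 'n where k0: "phi k0 = phi j - 1"
      using ex_phi[of "phi j - 1", where ?'n = 'n] phi_less[of j] by (metis less_imp_diff_less)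
    have "(row_mat G \<alpha> ** companion p) $ i $ j = (\<Sum>k\<in>UNIV. if k = k0 then G (\<alpha> i - int (phi k0)) else 0)"
      unfolding matrix_matrix_mult_def vec_lambda_beta
    proof (intro sum.cong refl)
      fix k
      have "Suc (phi k) = phi j \<longleftrightarrow> k = k0" using k0 False by (metis Suc_pred diff_Suc_1 phi_eq_iff gr0I)
      then show "row_mat G \<alpha> $ i $ k * companion p $ k $ j = (if k = k0 then G (\<alpha> i - int (phi k0)) else 0)"
        using False by (auto simp: companion_def row_mat_def)
    qed
    then show ?thesis using k0 False by (simp add: of_nat_diff algebra_simps)
  qed
  then show ?thesis by (simp add: vec_eq_iff row_mat_def algebra_simps)
qed

text \<open>Right multiplication by a + b C, with C the companion matrix, applies a + b shift to the
  sequence. C may be exchanged for U because only the determinants \<open>det (lin a b U)\<close>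
  enter.\<close>

lemma det_row_mat_lin:
  fixes \<alpha> :: "'n::finite \<Rightarrow> int" and U :: "complex^'n^'n"
  assumes G: "lin_rec CARD('n) (coeff (rev_char_poly U)) G"
  shows "det (row_mat (\<lambda>m. a * G m + b * G (m + 1)) \<alpha>) = det (row_mat G \<alpha>) * det (lin a b U)"
proof -
  let ?C = "companion (coeff (rev_char_poly U)) :: complex^'n^'n"
  have "row_mat G \<alpha> ** lin a b ?C = (\<chi> i j. a * row_mat G \<alpha> $ i $ j + b * (row_mat G \<alpha> ** ?C) $ i $ j)"
    by (simp add: vec_eq_iff matrix_matrix_mult_def lin_nth distrib_left sum.distrib sum_distrib_left
        if_distrib[of "\<lambda>x. _ * x"] if_distrib[of "\<lambda>x. x * _"] mult_ac cong: if_cong)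
  also have "\<dots> = row_mat (\<lambda>m. a * G m + b * G (m + 1)) \<alpha>"
    unfolding row_mat_companion[OF G] by (simp add: vec_eq_iff row_mat_def)
  finally have "det (row_mat (\<lambda>m. a * G m + b * G (m + 1)) \<alpha>) = det (row_mat G \<alpha>) * det (lin a b ?C)"
    by (metis det_mul)
  moreover have "det (lin a b ?C) = det (lin a b U)"
    by (rule det_lin_cong)
       (simp only: det_lin_companion[where p = "coeff (rev_char_poly U)", OF coeff_rev_char_poly_0], simp only: det_lin_rev_char_poly)
  ultimately show ?thesis by simp
qed

text \<open>A unit translation of \<alpha> multiplies the determinant by det U. Hence in SU(N) only
  the differences of the entries of \<alpha> matter.\<close>

lemma det_row_mat_shift:
  fixes \<alpha> :: "'n::finite \<Rightarrow> int" and U :: "complex^'n^'n"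
  assumes G: "lin_rec CARD('n) (coeff (rev_char_poly U)) G" and "det U = 1"
  shows "det (row_mat G (\<lambda>i. \<alpha> i + k)) = det (row_mat G \<alpha>)"
proof -
  have lU: "lin 0 1 U = U" by (simp add: lin_def vec_eq_iff)
  have step: "det (row_mat G (\<lambda>i. \<alpha> i + 1)) = det (row_mat G \<alpha>)" for \<alpha> :: "'n \<Rightarrow> int"
    using det_row_mat_lin[OF G, of 0 1 \<alpha>] assms(2) by (simp add: lU row_mat_def algebra_simps)
  show ?thesis
  proof (induction k rule: int_induct[of _ 0])
    case (step1 k)
    then show ?case using step[of "\<lambda>i. \<alpha> i + k"] by (simp add: add.assoc)
  next
    case (step2 k)
    then show ?case using step[of "\<lambda>i. \<alpha> i + (k - 1)"] by (simp add: add.assoc)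
  qed simp
qed

lemma det_lin_conj_transpose: "det (lin a b (conj_transpose U)) = cnj (det (lin (cnj a) (cnj b) U))"
proof -
  have "lin a b (conj_transpose U) = conj_transpose (lin (cnj a) (cnj b) U)"
    by (auto simp: lin_def conj_transpose_def vec_eq_iff)
  then show ?thesis by (simp add: det_conj_transpose)
qed

text \<open>Multiplication by the conjugate transpose, whose determinant is 1, exchanges the two
  coefficients. This reflection makes \<open>rev_char_poly\<close> palindromic up to sign and
  conjugation.\<close>

lemma det_lin_special_unitary:
  assumes "U \<in> special_unitary"
  shows "det (lin a b U) = cnj (det (lin (cnj b) (cnj a) U))"
proof -
  have "conj_transpose U ** lin a b U = lin b a (conj_transpose U)"
  proof -
    have "(conj_transpose U ** lin a b U) $ i $ j = a * conj_transpose U $ i $ j + b * (conj_transpose U ** U) $ i $ j" for i j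
      by (simp add: matrix_matrix_mult_def lin_nth distrib_left sum.distrib sum_distrib_left
          if_distrib[of "\<lambda>x. _ * x"] mult_ac cong: if_cong)
    then show ?thesis
      using assms by (simp add: special_unitary_def vec_eq_iff lin_nth mat_def)
  qed
  then have "det (conj_transpose U) * det (lin a b U) = det (lin b a (conj_transpose U))"
    by (metis det_mul)
  then show ?thesis
    using assms by (simp add: det_conj_transpose special_unitary_def det_lin_conj_transpose)
qed

lemma coeff_rev_char_poly_palindromic:
  fixes U :: "complex^'n^'n"
  assumes U: "U \<in> special_unitary" and r: "r \<le> CARD('n)"
  shows "coeff (rev_char_poly U) (CARD('n) - r) = (-1) ^ CARD('n) * cnj (coeff (rev_char_poly U) r)"
proof -
  let ?p = "coeff (rev_char_poly U)" and ?N = "CARD('n)"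
  let ?R = "\<Sum>r\<le>?N. monom ((-1) ^ ?N * cnj (?p r)) (?N - r)"
  have "rev_char_poly U = ?R"
  proof (rule poly_eqI_nonzero)
    fix x :: complex assume x: "x \<noteq> 0"
    have a: "poly (rev_char_poly U) x = cnj (det (lin (- cnj x) 1 U))"
      unfolding poly_rev_char_poly using det_lin_special_unitary[OF U, of 1 "- x"] by simp
    have b: "det (lin (- cnj x) 1 U) = (- cnj x) ^ ?N * det (lin 1 (- (1 / cnj x)) U)"
      using det_lin_scale[of "- cnj x" 1 "- (1 / cnj x)" U] x by simp
    have pw: "(- x) ^ ?N * (1 / x) ^ r = (-1) ^ ?N * x ^ (?N - r)" if "r \<le> ?N" for r
    proof -
      have "x ^ ?N = x ^ (?N - r) * x ^ r" using that by (metis le_add_diff_inverse2 power_add)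
      then have "(- x) ^ ?N = (-1) ^ ?N * x ^ (?N - r) * x ^ r" by (metis power_minus mult.assoc)
      moreover have "x ^ r * (1 / x) ^ r = 1" using x by (simp flip: power_mult_distrib)
      ultimately show ?thesis by (metis mult.assoc mult_1_right)
    qed
    have c: "cnj ((- cnj x) ^ ?N * det (lin 1 (- (1 / cnj x)) U)) = (\<Sum>r\<le>?N. (-1) ^ ?N * cnj (?p r) * x ^ (?N - r))"
      unfolding det_lin_rev_char_poly complex_cnj_mult cnj_sum sum_distrib_left
    proof (intro sum.cong refl)
      fix r assume "r \<in> {..?N}"
      then show "cnj ((- cnj x) ^ ?N) * (cnj (?p r) * cnj ((1 / cnj x) ^ r)) = (-1) ^ ?N * cnj (?p r) * x ^ (?N - r)"
        using pw[of r] by (simp add: mult_ac)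
    qed
    show "poly (rev_char_poly U) x = poly ?R x"
      unfolding a b c by (simp add: poly_sum poly_monom)
  qed
  then have "?p (?N - r) = coeff ?R (?N - r)" by simp
  also have "\<dots> = (\<Sum>s\<le>?N. if s = r then (-1) ^ ?N * cnj (?p r) else 0)"
    unfolding coeff_sum using r by (intro sum.cong) (auto simp: coeff_monom)
  finally show ?thesis using r by simp
qed

section \<open>Complete symmetric functions of all integer degrees and integrals of Schur
  functions\<close>

context su_haar
begin

text \<open>The two-sided extension of \<open>csym\<close> by the recurrence \<open>\<Sum>\<^sub>r p\<^sub>r h (m - r) = 0\<close>, where
  \<open>det (1 - xU) = \<Sum>\<^sub>r p\<^sub>r x\<^sup>r\<close>; its values at \<open>m \<le> -N\<close> are those of \<open>U\<^sup>-\<^sup>1\<close>.\<close>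

definition hz :: "int \<Rightarrow> complex^'n^'n \<Rightarrow> complex" where
  "hz m U = (if 0 \<le> m then csym (nat m) U else if - int CARD('n) < m then 0
     else (-1) ^ (CARD('n) - 1) * cnj (csym (nat (- m - int CARD('n))) U))"

lemma hz_0: "hz 0 U = 1"
  by (simp add: hz_def csym_0)

lemma hz_neg: "m < 0 \<Longrightarrow> - int CARD('n) < m \<Longrightarrow> hz m U = 0"
  by (simp add: hz_def)

text \<open>For m > 0 this is the one-sided recurrence, since the values next below 0 are 0. For m
  at most 0 the reflection r to N - r and the palindromic coefficients reduce it to the conjugate of
  the same recurrence.\<close>

lemma lin_rec_hz:
  assumes U: "U \<in> special_unitary"
  shows "lin_rec CARD('n) (coeff (rev_char_poly U)) (\<lambda>m. hz m U)"
  unfolding lin_rec_def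
proof (intro conjI allI)
  let ?p = "coeff (rev_char_poly U)" and ?N = "CARD('n)"
  show "?p 0 = 1" by (rule coeff_rev_char_poly_0)
  have p0: "?p r = 0" if "r > ?N" for r
    using degree_rev_char_poly[of U] that by (intro coeff_eq_0) simp
  have conv: "(\<Sum>r\<le>?N. if r \<le> k then ?p r * csym (k - r) U else 0) = (if k = 0 then 1 else 0)" for k
  proof -
    have "(\<Sum>r\<le>?N. if r \<le> k then ?p r * csym (k - r) U else 0) = (\<Sum>r\<le>k. ?p r * csym (k - r) U)"
      by (intro sum.mono_neutral_cong) (auto simp: p0)
    then show ?thesis by (simp add: csym_recurrence)
  qed
  fix m :: int
  show "(\<Sum>r\<le>?N. ?p r * hz (m - int r) U) = 0"
  proof (cases "m > 0")
    case True
    have "(\<Sum>r\<le>?N. ?p r * hz (m - int r) U) = (\<Sum>r\<le>?N. if r \<le> nat m then ?p r * csym (nat m - r) U else 0)"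
      using True by (intro sum.cong refl) (auto simp: hz_def nat_diff_distrib)
    then show ?thesis using conv[of "nat m"] True by simp
  next
    case False
    define l where "l = nat (- m)"
    have m: "m = - int l" using False by (simp add: l_def)
    have N: "?N > 0" by simp
    have "(\<Sum>r\<le>?N. ?p r * hz (m - int r) U) = (\<Sum>r\<le>?N. ?p (?N - r) * hz (m - int (?N - r)) U)"
      by (rule sum.reindex_bij_witness[of _ "\<lambda>r. ?N - r" "\<lambda>r. ?N - r"]) auto
    \<comment> \<open>For l = 0 the term r = N meets h_0 = 1 on the nonnegative side; this extra 1
      cancels the - 1 left by the convolution at degree 0.\<close>
    also have "\<dots> = (\<Sum>r\<le>?N. - cnj (if r \<le> l then ?p r * csym (l - r) U else 0) + (if r = ?N \<and> l = 0 then 1 else 0))"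
    proof (intro sum.cong refl)
      fix r assume r: "r \<in> {..?N}"
      have pal: "?p (?N - r) = (-1) ^ ?N * cnj (?p r)"
        using r by (intro coeff_rev_char_poly_palindromic[OF U]) auto
      have "(-1) ^ ?N = - ((-1 :: complex) ^ (?N - 1))"
        using N by (metis Suc_pred' mult_minus1 power_Suc)
      moreover have "(-1 :: complex) ^ (?N - 1) * (-1) ^ (?N - 1) = 1"
        by (simp flip: power_mult_distrib)
      ultimately have sgn: "(-1) ^ ?N * x * ((-1) ^ (?N - 1) * y) = - (x * y)" for x y :: complex
        by (metis mult.assoc mult.commute mult.left_commute mult_1 mult_minus_left)
      consider "r \<le> l" | "l < r" "r = ?N" "l = 0" | "l < r" "\<not> (r = ?N \<and> l = 0)" by linarith
      then show "?p (?N - r) * hz (m - int (?N - r)) U = - cnj (if r \<le> l then ?p r * csym (l - r) U else 0) + (if r = ?N \<and> l = 0 then 1 else 0)"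
      proof cases
        case 1
        have i: "m - int (?N - r) = - int ?N - int (l - r)" using 1 r by (simp add: m of_nat_diff)
        have "\<not> int (l - r) \<le> - int ?N" using N by linarith
        then have "hz (m - int (?N - r)) U = (-1) ^ (?N - 1) * cnj (csym (l - r) U)"
          unfolding i hz_def by simp
        then have "?p (?N - r) * hz (m - int (?N - r)) U = - (cnj (?p r) * cnj (csym (l - r) U))"
          unfolding pal by (simp only: sgn)
        moreover have "\<not> (r = ?N \<and> l = 0)" using 1 N by linarith
        ultimately show ?thesis
          using 1 by auto
      next
        case 2
        then show ?thesis by (simp add: m hz_0 coeff_rev_char_poly_0)
      next
        case 3
        have "m - int (?N - r) = - int ?N + int (r - l)" using 3 r by (simp add: m of_nat_diff)
        moreover have "int (r - l) < int ?N" using 3 r by auto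
        ultimately have "hz (m - int (?N - r)) U = 0"
          using 3 by (intro hz_neg) auto
        then show ?thesis using 3 by auto
      qed
    qed
    also have "\<dots> = - cnj (if l = 0 then 1 else 0) + (if l = 0 then 1 else 0)"
      unfolding sum.distrib sum_negf cnj_sum[symmetric] conv by (auto simp: if_distrib if_bool_eq_conj cong: if_cong)
    finally show ?thesis by simp
  qed
qed

lemma bm_hz: "bm (hz m)"
  unfolding hz_def[abs_def]
  by (cases "0 \<le> m"; cases "- int CARD('n) < m") (auto intro!: bm_intros bm_csym)

text \<open>On unitary matrices |h_m| is at most binom(N + m - 1, m), which grows polynomially. A
  geometric bound with any ratio above 1 is what is later set against geometrically decaying
  coefficients.\<close>

lemma norm_hz_le:
  assumes q: "0 < q" "q < 1"
  obtains K where "K \<ge> 0" "\<And>U m. U \<in> special_unitary \<Longrightarrow> cmod (hz m U) \<le> K * (1 / q) ^ nat \<bar>m\<bar>"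
proof -
  define a where "a m = pochhammer (real CARD('n)) m / fact m * q ^ m" for m
  have a0: "a m > 0" for m
    using q by (auto simp: a_def intro!: mult_pos_pos divide_pos_pos pochhammer_pos)
  have a_Suc: "a (Suc m) = (real CARD('n) + real m) / (real m + 1) * q * a m" for m
    by (simp add: a_def pochhammer_Suc divide_simps)
  have "(\<lambda>m. (real CARD('n) + real m) / (real m + 1) * q) \<longlonglongrightarrow> q"
    by real_asymp
  then have "\<forall>\<^sub>F m in sequentially. (real CARD('n) + real m) / (real m + 1) * q < (1 + q) / 2"
    by (rule order_tendstoD) (use q in simp)
  then obtain M where M: "\<And>m. m \<ge> M \<Longrightarrow> (real CARD('n) + real m) / (real m + 1) * q < (1 + q) / 2"
    by (auto simp: eventually_sequentially)
  have "summable a"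
  proof (rule summable_ratio_test[of "(1 + q) / 2" M])
    fix m assume "M \<le> m"
    then have "a (Suc m) \<le> (1 + q) / 2 * a m"
      unfolding a_Suc using M[of m] a0[of m] by (intro mult_right_mono) auto
    then show "norm (a (Suc m)) \<le> (1 + q) / 2 * norm (a m)"
      using a0[of m] a0[of "Suc m"] by simp
  qed (use q in simp)
  then have "a \<longlonglongrightarrow> 0" by (rule summable_LIMSEQ_zero)
  then have "Bseq a" by (intro convergent_imp_Bseq convergentI)
  then obtain K where K: "K > 0" "\<And>m. a m \<le> K"
    by (auto simp: Bseq_def) (metis abs_le_D1)
  have csym: "cmod (csym m U) \<le> K * (1 / q) ^ m" if "U \<in> special_unitary" for m U
  proof -
    have "cmod (csym m U) \<le> a m * (1 / q) ^ m"
      using norm_csym_le[of U m] that q by (simp add: a_def special_unitary_iff power_divide)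
    also have "\<dots> \<le> K * (1 / q) ^ m" using K(2)[of m] q by (intro mult_right_mono) auto
    finally show ?thesis .
  qed
  have "cmod (hz m U) \<le> K * (1 / q) ^ nat \<bar>m\<bar>" if U: "U \<in> special_unitary" for m U
  proof (cases "m \<le> - int CARD('n)")
    case True
    then have "\<not> 0 \<le> m" using zero_less_card_finite[where ?'a = 'n] by linarith
    then have "cmod (hz m U) = cmod (csym (nat (- m - int CARD('n))) U)"
      using True by (simp add: hz_def norm_mult norm_power)
    also have "\<dots> \<le> K * (1 / q) ^ nat (- m - int CARD('n))" by (rule csym[OF U])
    also have "\<dots> \<le> K * (1 / q) ^ nat \<bar>m\<bar>"
      using q K True by (intro mult_left_mono power_increasing) auto
    finally show ?thesis .
  next
    case False
    then show ?thesis using csym[OF U, of "nat m"] K q by (auto simp: hz_def)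
  qed
  then show ?thesis using that[of K] K by auto
qed

text \<open>The Schur functions \<open>det (h (\<alpha>\<^sub>i - j))\<close> integrate to zero unless they are powers of the determinant:
  after a shift some \<open>\<alpha>\<^sub>i\<close> is \<open>0\<close>, and what remains is a polynomial in \<open>N - 1\<close> complete symmetric functions.\<close>

lemma expectation_prod_hz:
  fixes \<alpha> :: "'n \<Rightarrow> int" and \<tau> :: "'n \<Rightarrow> 'n"
  assumes \<alpha>: "\<And>i. \<alpha> i \<ge> 0" "\<alpha> i0 = 0"
  shows "expectation (\<lambda>U. \<Prod>i\<in>UNIV. hz (\<alpha> i - int (phi (\<tau> i))) U) = (if \<forall>i. \<alpha> i = int (phi (\<tau> i)) then 1 else 0)"
proof (cases "\<exists>i. \<alpha> i < int (phi (\<tau> i))")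
  case True
  then obtain i where i: "\<alpha> i < int (phi (\<tau> i))" by blast
  then have "hz (\<alpha> i - int (phi (\<tau> i))) U = 0" for U
    using \<alpha>(1)[of i] phi_less[of "\<tau> i"] by (intro hz_neg) auto
  then have pz: "(\<Prod>i\<in>UNIV. hz (\<alpha> i - int (phi (\<tau> i))) U) = 0" for U
    by (intro prod_zero) auto
  have "\<not> (\<forall>i. \<alpha> i = int (phi (\<tau> i)))" using i by (metis less_irrefl)
  then show ?thesis unfolding pz by simp
next
  case False
  define m where "m i = nat (\<alpha> i - int (phi (\<tau> i)))" for i
  have ge: "\<alpha> i \<ge> int (phi (\<tau> i))" for i using False by (auto simp: not_less)
  \<comment> \<open>The entry 0 of \<alpha> can only meet the column numbered 0. Its factor is h_0 =
    1, so N - 1 factors remain.\<close>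
  have i0: "\<alpha> i0 = int (phi (\<tau> i0))" using ge[of i0] \<alpha>(2) by simp
  have "(\<Prod>i\<in>UNIV. hz (\<alpha> i - int (phi (\<tau> i))) U) = (\<Prod>i\<in>UNIV - {i0}. csym (m i) U)" for U
  proof -
    have "(\<Prod>i\<in>UNIV. hz (\<alpha> i - int (phi (\<tau> i))) U) = hz (\<alpha> i0 - int (phi (\<tau> i0))) U * (\<Prod>i\<in>UNIV - {i0}. hz (\<alpha> i - int (phi (\<tau> i))) U)"
      by (rule prod.remove) auto
    then show ?thesis using ge by (simp add: i0 hz_0) (simp add: hz_def m_def)
  qed
  moreover have mk: "m k = 0 \<longleftrightarrow> \<alpha> k = int (phi (\<tau> k))" for k
    using ge[of k] by (auto simp: m_def)
  moreover have "(\<forall>k\<in>UNIV - {i0}. m k = 0) \<longleftrightarrow> (\<forall>i. \<alpha> i = int (phi (\<tau> i)))"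
    using i0 mk by (metis DiffI UNIV_I singletonD)
  ultimately show ?thesis using expectation_prod_csym[where m = m and ?k0.0 = i0] by simp
qed

text \<open>At most one permutation contributes: \<alpha> has to be a rearrangement of N consecutive
  integers, in which case the Schur function is a signed power of the determinant.\<close>

lemma expectation_det_row_mat:
  fixes \<alpha> :: "'n \<Rightarrow> int"
  shows "expectation (\<lambda>U. det (row_mat (\<lambda>m. hz m U) \<alpha>)) =
    (\<Sum>\<tau> | \<tau> permutes (UNIV :: 'n set). of_int (sign \<tau>) * (if \<exists>k. \<forall>i. \<alpha> i = int (phi (\<tau> i)) + k then 1 else 0))"
proof -
  \<comment> \<open>Translating by the minimum makes all entries nonnegative and one of them 0, as
    \<open>expectation_prod_hz\<close> requires.\<close>
  define k0 where "k0 = Min (range \<alpha>)"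
  define \<beta> where "\<beta> i = \<alpha> i - k0" for i
  have "k0 \<in> range \<alpha>" unfolding k0_def by (intro Min_in) auto
  then obtain i0 where i0: "\<beta> i0 = 0" by (auto simp: \<beta>_def)
  have \<beta>: "\<beta> i \<ge> 0" for i by (simp add: \<beta>_def k0_def)
  have "expectation (\<lambda>U. det (row_mat (\<lambda>m. hz m U) \<alpha>)) = expectation (\<lambda>U. det (row_mat (\<lambda>m. hz m U) \<beta>))"
  proof (rule Bochner_Integration.integral_cong[OF refl])
    fix U assume "U \<in> space \<mu>"
    then have "U \<in> special_unitary" by (simp add: space_eq)
    then show "det (row_mat (\<lambda>m. hz m U) \<alpha>) = det (row_mat (\<lambda>m. hz m U) \<beta>)"
      using det_row_mat_shift[OF lin_rec_hz, of U \<beta> k0] by (simp add: \<beta>_def special_unitary_def)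
  qed
  also have "\<dots> = (\<Sum>\<tau> | \<tau> permutes (UNIV :: 'n set). of_int (sign \<tau>) * expectation (\<lambda>U. \<Prod>i\<in>UNIV. hz (\<beta> i - int (phi (\<tau> i))) U))"
    unfolding det_def row_mat_def
    by (simp add: Bochner_Integration.integral_sum bm_integrable bm_mult bm_const bm_prod bm_hz)
  also have "\<dots> = (\<Sum>\<tau> | \<tau> permutes (UNIV :: 'n set). of_int (sign \<tau>) * (if \<exists>k. \<forall>i. \<alpha> i = int (phi (\<tau> i)) + k then 1 else 0))"
  proof (intro sum.cong refl arg_cong2[where f = "(*)"])
    fix \<tau> assume "\<tau> \<in> {\<tau>. \<tau> permutes (UNIV :: 'n set)}"
    then have surj: "surj \<tau>" by (simp add: permutes_surj)
    have "(\<forall>i. \<beta> i = int (phi (\<tau> i))) \<longleftrightarrow> (\<exists>k. \<forall>i. \<alpha> i = int (phi (\<tau> i)) + k)"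
    proof
      assume "\<exists>k. \<forall>i. \<alpha> i = int (phi (\<tau> i)) + k"
      then obtain k where k: "\<And>i. \<alpha> i = int (phi (\<tau> i)) + k" by blast
      obtain j :: 'n where "phi j = 0" using ex_phi[of 0, where ?'n = 'n] by auto
      then obtain i where i: "phi (\<tau> i) = 0" using surj by (metis surjD)
      have "k \<ge> k0" using k[of i] i by (simp add: k0_def) (metis Min_le finite finite_imageI rangeI)
      moreover have "k \<le> k0" using k[of i0] i0 by (simp add: \<beta>_def)
      ultimately show "\<forall>i. \<beta> i = int (phi (\<tau> i))" using k by (simp add: \<beta>_def)
    qed (auto simp: \<beta>_def intro!: exI[of _ k0] simp: algebra_simps)
    then show "expectation (\<lambda>U. \<Prod>i\<in>UNIV. hz (\<beta> i - int (phi (\<tau> i))) U) = (if \<exists>k. \<forall>i. \<alpha> i = int (phi (\<tau> i)) + k then 1 else 0)"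
      by (simp add: expectation_prod_hz[of \<beta> i0 \<tau>, OF \<beta> i0])
  qed
  finally show ?thesis .
qed

text \<open>A finite Cauchy-Binet expansion: rowwise expansion over \<alpha> leaves, after
  integration, only rearrangements of k, ..., k + N - 1, and their signed sum is a Toeplitz
  determinant. Both ends have to lie in [-K, K], which gives the range of k.\<close>

lemma expectation_truncated:
  fixes c :: "int \<Rightarrow> complex"
  shows "expectation (\<lambda>U. det (\<chi> (i :: 'n) (j :: 'n). \<Sum>n\<in>{- K..K}. c (n - int (phi i)) * hz (n - int (phi j)) U)) =
    (\<Sum>k\<in>{- K..K - int CARD('n) + 1}. det (\<chi> (i :: 'n) (j :: 'n). c (k + int (phi j) - int (phi i))))"
proof -
  define A :: "('n \<Rightarrow> int) set" where "A = PiE UNIV (\<lambda>_. {- K..K})"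
  define P where "P = {\<tau>. \<tau> permutes (UNIV :: 'n set)}"
  define w where "w \<alpha> = (\<Prod>i\<in>UNIV. c (\<alpha> i - int (phi i)))" for \<alpha> :: "'n \<Rightarrow> int"
  have finA: "finite A" unfolding A_def by (intro finite_PiE) auto
  have "det (\<chi> (i :: 'n) (j :: 'n). \<Sum>n\<in>{- K..K}. c (n - int (phi i)) * hz (n - int (phi j)) U) =
      (\<Sum>\<alpha>\<in>A. w \<alpha> * det (row_mat (\<lambda>m. hz m U) \<alpha>))" for U
  proof -
    have "det (\<chi> (i :: 'n) (j :: 'n). \<Sum>n\<in>{- K..K}. c (n - int (phi i)) * hz (n - int (phi j)) U) =
       (\<Sum>\<tau>\<in>P. of_int (sign \<tau>) * (\<Sum>\<alpha>\<in>A. \<Prod>i\<in>UNIV. c (\<alpha> i - int (phi i)) * hz (\<alpha> i - int (phi (\<tau> i))) U))"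
      unfolding det_def P_def A_def vec_lambda_beta by (subst prod_sum_PiE) auto
    also have "\<dots> = (\<Sum>\<alpha>\<in>A. \<Sum>\<tau>\<in>P. of_int (sign \<tau>) * (\<Prod>i\<in>UNIV. c (\<alpha> i - int (phi i)) * hz (\<alpha> i - int (phi (\<tau> i))) U))"
      unfolding sum_distrib_left by (rule sum.swap)
    also have "\<dots> = (\<Sum>\<alpha>\<in>A. w \<alpha> * det (row_mat (\<lambda>m. hz m U) \<alpha>))"
      by (simp add: det_def row_mat_def w_def P_def sum_distrib_left prod.distrib mult_ac)
    finally show ?thesis .
  qed
  moreover have "bm (\<lambda>U. det (row_mat (\<lambda>m. hz m U) \<alpha>))" for \<alpha> :: "'n \<Rightarrow> int"
    unfolding det_def row_mat_def by (simp, intro bm_intros bm_hz)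
  ultimately have "expectation (\<lambda>U. det (\<chi> (i :: 'n) (j :: 'n). \<Sum>n\<in>{- K..K}. c (n - int (phi i)) * hz (n - int (phi j)) U)) =
      (\<Sum>\<alpha>\<in>A. w \<alpha> * expectation (\<lambda>U. det (row_mat (\<lambda>m. hz m U) \<alpha>)))"
    by (simp add: Bochner_Integration.integral_sum bm_integrable bm_mult bm_const)
  also have "\<dots> = (\<Sum>\<alpha>\<in>A. \<Sum>\<tau>\<in>P. of_int (sign \<tau>) * (if \<exists>k. \<forall>i. \<alpha> i = int (phi (\<tau> i)) + k then w \<alpha> else 0))"
    unfolding expectation_det_row_mat P_def[symmetric] sum_distrib_left by (intro sum.cong) auto
  also have "\<dots> = (\<Sum>\<tau>\<in>P. \<Sum>\<alpha>\<in>A. of_int (sign \<tau>) * (if \<exists>k. \<forall>i. \<alpha> i = int (phi (\<tau> i)) + k then w \<alpha> else 0))"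
    by (rule sum.swap)
  also have "\<dots> = (\<Sum>\<tau>\<in>P. of_int (sign \<tau>) * (\<Sum>k\<in>{- K..K - int CARD('n) + 1}. w (\<lambda>i. int (phi (\<tau> i)) + k)))"
    unfolding sum_distrib_left[symmetric]
  proof (intro sum.cong refl arg_cong2[where f = "(*)"])
    fix \<tau> assume "\<tau> \<in> P"
    then have surj: "surj \<tau>" by (simp add: P_def permutes_surj)
    obtain j1 :: 'n where j1: "phi (\<tau> j1) = 0"
      using ex_phi[of 0, where ?'n = 'n] surj by (metis surjD zero_less_card_finite)
    obtain j2 :: 'n where j2: "phi (\<tau> j2) = CARD('n) - 1"
      using ex_phi[of "CARD('n) - 1", where ?'n = 'n] surj by (metis surjD zero_less_card_finite diff_less zero_less_one)
    have "(\<Sum>\<alpha>\<in>A. if \<exists>k. \<forall>i. \<alpha> i = int (phi (\<tau> i)) + k then w \<alpha> else 0) =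
       (\<Sum>\<alpha>\<in>{\<alpha> \<in> A. \<exists>k. \<forall>i. \<alpha> i = int (phi (\<tau> i)) + k}. w \<alpha>)"
      using finA by (simp add: sum.inter_filter)
    also have "{\<alpha> \<in> A. \<exists>k. \<forall>i. \<alpha> i = int (phi (\<tau> i)) + k} = (\<lambda>k i. int (phi (\<tau> i)) + k) ` {- K..K - int CARD('n) + 1}"
    proof (intro equalityI subsetI)
      fix \<alpha> assume "\<alpha> \<in> {\<alpha> \<in> A. \<exists>k. \<forall>i. \<alpha> i = int (phi (\<tau> i)) + k}"
      then obtain k where k: "\<And>i. \<alpha> i = int (phi (\<tau> i)) + k" and A: "\<And>i. \<alpha> i \<in> {- K..K}"
        by (auto simp: A_def PiE_def Pi_def)
      have "int (CARD('n) - 1) = int CARD('n) - 1" by (simp add: of_nat_diff)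
      then have "k \<in> {- K..K - int CARD('n) + 1}"
        using A[of j1] A[of j2] k[of j1] k[of j2] j1 j2 by auto
      moreover have "\<alpha> = (\<lambda>i. int (phi (\<tau> i)) + k)" using k by auto
      ultimately show "\<alpha> \<in> (\<lambda>k i. int (phi (\<tau> i)) + k) ` {- K..K - int CARD('n) + 1}"
        by blast
    next
      fix \<alpha> assume "\<alpha> \<in> (\<lambda>k i. int (phi (\<tau> i)) + k) ` {- K..K - int CARD('n) + 1}"
      then obtain k where k: "k \<in> {- K..K - int CARD('n) + 1}" "\<alpha> = (\<lambda>i. int (phi (\<tau> i)) + k)" by blast
      have "\<alpha> i \<in> {- K..K}" for i using k phi_less[of "\<tau> i"] by auto
      then show "\<alpha> \<in> {\<alpha> \<in> A. \<exists>k. \<forall>i. \<alpha> i = int (phi (\<tau> i)) + k}"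
        using k by (auto simp: A_def PiE_def Pi_def)
    qed
    also have "(\<Sum>\<alpha>\<in>(\<lambda>k i. int (phi (\<tau> i)) + k) ` {- K..K - int CARD('n) + 1}. w \<alpha>) =
        (\<Sum>k\<in>{- K..K - int CARD('n) + 1}. w (\<lambda>i. int (phi (\<tau> i)) + k))"
      by (subst sum.reindex) (auto simp: inj_on_def fun_eq_iff)
    finally show "(\<Sum>\<alpha>\<in>A. if \<exists>k. \<forall>i. \<alpha> i = int (phi (\<tau> i)) + k then w \<alpha> else 0) =
        (\<Sum>k\<in>{- K..K - int CARD('n) + 1}. w (\<lambda>i. int (phi (\<tau> i)) + k))" .
  qed
  also have "\<dots> = (\<Sum>k\<in>{- K..K - int CARD('n) + 1}. \<Sum>\<tau>\<in>P. of_int (sign \<tau>) * w (\<lambda>i. int (phi (\<tau> i)) + k))"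
    unfolding sum_distrib_left by (rule sum.swap)
  also have "\<dots> = (\<Sum>k\<in>{- K..K - int CARD('n) + 1}. det (\<chi> (i :: 'n) (j :: 'n). c (k + int (phi j) - int (phi i))))"
    by (simp add: det_def P_def w_def add.commute)
  finally show ?thesis .
qed

end

section \<open>Interpolation and partial fractions\<close>

text \<open>The left side is the divided difference of q at W, that is, the top coefficient of the
  Lagrange interpolant, and this interpolant is q itself.\<close>

lemma sum_divided_differences:
  fixes W :: "'a::field set" and q :: "'a poly"
  assumes "finite W" "degree q < card W"
  shows "(\<Sum>w\<in>W. poly q w / (\<Prod>v\<in>W - {w}. w - v)) = coeff q (card W - 1)"
proof -
  define B where "B w = (\<Prod>v\<in>W - {w}. [:- v, 1:])" for w
  define L where "L = (\<Sum>w\<in>W. smult (poly q w / (\<Prod>v\<in>W - {w}. w - v)) (B w))"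
  have deg_B: "degree (B w) = card W - 1" and lead_B: "coeff (B w) (card W - 1) = 1" if "w \<in> W" for w
  proof -
    have "degree (B w) = (\<Sum>v\<in>W - {w}. degree [:- v, 1:])"
      unfolding B_def by (rule degree_prod_sum_eq) auto
    then show d: "degree (B w) = card W - 1" using that assms by (simp add: card_Diff_singleton)
    have "lead_coeff (B w) = 1" unfolding B_def by (simp add: lead_coeff_prod)
    then show "coeff (B w) (card W - 1) = 1" by (simp add: d)
  qed
  have "L = q"
  proof (rule poly_eqI_degree[of W])
    fix u assume u: "u \<in> W"
    have "poly L u = (\<Sum>w\<in>W. if w = u then poly q u else 0)"
      unfolding L_def poly_sum
    proof (intro sum.cong refl)
      fix w assume w: "w \<in> W"
      show "poly (smult (poly q w / (\<Prod>v\<in>W - {w}. w - v)) (B w)) u = (if w = u then poly q u else 0)"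
      proof (cases "w = u")
        case True
        have "(\<Prod>v\<in>W - {u}. u - v) \<noteq> 0" using assms by auto
        then show ?thesis using True by (simp add: B_def poly_prod)
      next
        case False
        have "poly (B w) u = 0" unfolding B_def poly_prod
          using assms u False by (intro prod_zero) auto
        then show ?thesis using False by simp
      qed
    qed
    then show "poly L u = poly q u" using u assms by simp
  next
    have "degree L \<le> card W - 1"
      unfolding L_def by (intro degree_sum_le assms order_trans[OF degree_smult_le]) (simp add: deg_B)
    then show "degree L < card W" using assms by linarith
  qed (use assms in auto)
  then have "coeff q (card W - 1) = coeff L (card W - 1)" by simp
  also have "\<dots> = (\<Sum>w\<in>W. poly q w / (\<Prod>v\<in>W - {w}. w - v) * coeff (B w) (card W - 1))"
    by (simp add: L_def coeff_sum)
  also have "\<dots> = (\<Sum>w\<in>W. poly q w / (\<Prod>v\<in>W - {w}. w - v))"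
    by (intro sum.cong refl) (simp only: lead_B mult_1_right)
  finally show ?thesis ..
qed

text \<open>The divided difference at S together with the node 0. The degree may exceed that of an
  interpolant through S by one, and the top coefficient measures the resulting error.\<close>

lemma lagrange_at_0:
  fixes S :: "'a::field set" and q :: "'a poly"
  assumes S: "finite S" "0 \<notin> S" and q: "degree q \<le> card S"
  shows "(\<Sum>x\<in>S. poly q x * (\<Prod>y\<in>S - {x}. y / (y - x))) = poly q 0 - coeff q (card S) * (\<Prod>x\<in>S. - x)"
proof -
  let ?W = "insert 0 S" and ?P = "\<Prod>x\<in>S. - x"
  have P0: "?P \<noteq> 0" using S by auto
  have dd: "(\<Sum>w\<in>?W. poly q w / (\<Prod>v\<in>?W - {w}. w - v)) = coeff q (card S)"
    using sum_divided_differences[of ?W q] S q by simp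
  have W0: "?W - {0} = S" using S by auto
  have summand: "poly q x / (\<Prod>v\<in>?W - {x}. x - v) * ?P = - (poly q x * (\<Prod>y\<in>S - {x}. y / (y - x)))" if x: "x \<in> S" for x
  proof -
    have x0: "x \<noteq> 0" using x S by auto
    have W: "?W - {x} = insert 0 (S - {x})" using x0 by auto
    have a1: "(\<Prod>v\<in>?W - {x}. x - v) = x * (\<Prod>y\<in>S - {x}. x - y)"
      unfolding W using S by simp
    have a2: "?P = - x * (\<Prod>y\<in>S - {x}. - y)"
      using S x by (subst prod.remove[of _ x]) auto
    have a3: "(\<Prod>y\<in>S - {x}. - y) / (\<Prod>y\<in>S - {x}. x - y) = (\<Prod>y\<in>S - {x}. y / (y - x))"
      unfolding prod_dividef[symmetric] by (intro prod.cong refl) (metis minus_diff_eq minus_divide_divide)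
    show ?thesis unfolding a1 a2 a3[symmetric] using x0 by simp
  qed
  have t: "(\<Sum>x\<in>S. poly q x / (\<Prod>v\<in>?W - {x}. x - v) * ?P) = (\<Sum>x\<in>S. - (poly q x * (\<Prod>y\<in>S - {x}. y / (y - x))))"
    by (rule sum.cong[OF refl summand])
  have "coeff q (card S) * ?P = (\<Sum>w\<in>?W. poly q w / (\<Prod>v\<in>?W - {w}. w - v) * ?P)"
    unfolding dd[symmetric] by (rule sum_distrib_right)
  also have "\<dots> = poly q 0 + (\<Sum>x\<in>S. - (poly q x * (\<Prod>y\<in>S - {x}. y / (y - x))))"
    unfolding sum.insert[OF S] W0 t using P0 by simp
  finally show ?thesis by (simp add: sum_negf algebra_simps)
qed

lemma prod_less_1:
  assumes "finite Z" "Z \<noteq> {}" "Z \<subseteq> {0<..<1 :: real}"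
  shows "0 < \<Prod>Z" "\<Prod>Z < 1"
proof -
  show "0 < \<Prod>Z" using assms by (intro prod_pos) auto
  obtain z where z: "z \<in> Z" using assms by blast
  have "\<Prod>Z = z * \<Prod>(Z - {z})" using assms z by (simp add: prod.remove)
  also have "\<dots> \<le> z * 1" using assms z by (intro mult_left_mono prod_le_1) auto
  also have "\<dots> < 1" using assms z by auto
  finally show "\<Prod>Z < 1" .
qed

text \<open>The coefficient of 1 / (1 - x z) in the partial fractions of the symbol: the other
  factors taken at the pole z = 1 / x.\<close>

definition pf_coeff :: "real set \<Rightarrow> real set \<Rightarrow> real \<Rightarrow> real" where
  "pf_coeff X Y x = 1 / ((\<Prod>x'\<in>X - {x}. 1 - x' / x) * (\<Prod>y\<in>Y. 1 - x * y))"

text \<open>The Laurent coefficients on the unit circle of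
  \<open>1 / (\<Prod>x\<in>X. 1 - x z) (\<Prod>y\<in>Y. 1 - y / z)\<close>, by partial fractions; the two expressions agree
  for \<open>\<bar>n\<bar> < N\<close>.\<close>

definition laurent_coeff :: "real set \<Rightarrow> real set \<Rightarrow> int \<Rightarrow> real" where
  "laurent_coeff X Y n =
    (if 0 \<le> n then \<Sum>x\<in>X. pf_coeff X Y x * x powi n else \<Sum>y\<in>Y. pf_coeff Y X y * y powi (- n))"

text \<open>Flavour parameters form sets, so that the cardinality expresses distinctness and the
  poles are simple. Nodes are inverted, hence 0 is excluded.\<close>

locale node_sets =
  fixes X Y :: "real set" and N :: nat
  assumes finX: "finite X" and finY: "finite Y" and cardX: "card X = N" and cardY: "card Y = N"
    and Npos: "N > 0" and X01: "X \<subseteq> {0<..<1}" and Y01: "Y \<subseteq> {0<..<1}"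
begin

lemma Xp: "x \<in> X \<Longrightarrow> 0 < x \<and> x < 1" using X01 by auto
lemma Yp: "x \<in> Y \<Longrightarrow> 0 < x \<and> x < 1" using Y01 by auto
lemma xy1: "x \<in> X \<Longrightarrow> y \<in> Y \<Longrightarrow> x * y < 1"
  using Xp[of x] Yp[of y] mult_strict_mono[of x 1 y 1] by simp

lemma prod_node_diff:
  assumes x: "x \<in> X"
  shows "(\<Prod>v\<in>X - {x}. x - v) = x powi (int N - 1) * (\<Prod>v\<in>X - {x}. 1 - v / x)"
proof -
  have "(\<Prod>v\<in>X - {x}. x - v) = (\<Prod>v\<in>X - {x}. x * (1 - v / x))"
    using Xp[OF x] by (intro prod.cong) (auto simp: field_simps)
  then show ?thesis
    using x finX cardX Npos by (simp add: prod.distrib card_Diff_singleton power_int_def nat_diff_distrib)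
qed

text \<open>In the variable 1 / z the poles are the x and the 1 / y. Up to a common factor the
  difference is the divided difference of the monomial of exponent n + N - 1 at these 2N points,
  which is 0 for exponents 0, ..., 2N - 2.\<close>

lemma partial_fractions_overlap:
  assumes n: "- int N \<le> n" "n \<le> int N - 1"
  shows "(\<Sum>x\<in>X. pf_coeff X Y x * x powi n) - (\<Sum>y\<in>Y. pf_coeff Y X y * y powi (- n)) =
    (if n = - int N then - ((-1) ^ N / \<Prod>X) else 0)"
proof -
  define W where "W = X \<union> inverse ` Y"
  have disj: "X \<inter> inverse ` Y = {}"
  proof -
    have "x \<noteq> inverse y" if "x \<in> X" "y \<in> Y" for x y
      using Xp[OF that(1)] Yp[OF that(2)] one_less_inverse[of y] by auto
    then show ?thesis by auto
  qed
  have inj: "inj_on inverse Y" by (auto simp: inj_on_def)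
  have finW: "finite W" and cardW: "card W = 2 * N"
    using finX finY disj inj by (simp_all add: W_def card_Un_disjoint card_image cardX cardY)
  have W0: "0 \<notin> W" using Xp[of 0] Yp[of 0] by (auto simp: W_def)
  define PY where "PY = (\<Prod>y\<in>Y. - y)"
  have PY0: "PY \<noteq> 0" using finY Yp by (auto simp: PY_def)
  have splitX: "(\<Prod>v\<in>W - {x}. f v) = (\<Prod>v\<in>X - {x}. f v) * (\<Prod>y\<in>Y. f (inverse y))" if "x \<in> X" for x and f :: "real \<Rightarrow> real"
  proof -
    have "W - {x} = (X - {x}) \<union> inverse ` Y" using that disj by (auto simp: W_def)
    moreover have "(X - {x}) \<inter> inverse ` Y = {}" using disj by auto
    ultimately show ?thesis using finX finY by (simp add: prod.union_disjoint prod.reindex[OF inj])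
  qed
  have splitY: "(\<Prod>v\<in>W - {inverse y}. f v) = (\<Prod>v\<in>X. f v) * (\<Prod>y\<in>Y - {y}. f (inverse y))" if "y \<in> Y" for y and f :: "real \<Rightarrow> real"
  proof -
    have "W - {inverse y} = X \<union> inverse ` (Y - {y})" using that disj by (auto simp: W_def)
    moreover have "X \<inter> inverse ` (Y - {y}) = {}" using disj by auto
    ultimately show ?thesis
      using finX finY inj_on_subset[OF inj, of "Y - {y}"] by (simp add: prod.union_disjoint prod.reindex)
  qed
  have tX: "x powi (n + int N - 1) / (\<Prod>v\<in>W - {x}. x - v) = PY * (pf_coeff X Y x * x powi n)" if x: "x \<in> X" for x
  proof -
    have x0: "x > 0" using Xp[OF x] by simp
    note 1 = prod_node_diff[OF x]
    have "(\<Prod>y\<in>Y. x - inverse y) * PY = (\<Prod>y\<in>Y. 1 - x * y)"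
      unfolding PY_def prod.distrib[symmetric] using Yp by (intro prod.cong) (auto simp: field_simps)
    then have 2: "(\<Prod>y\<in>Y. x - inverse y) = (\<Prod>y\<in>Y. 1 - x * y) / PY"
      using PY0 by (simp add: field_simps)
    have 3: "x powi (n + int N - 1) = x powi (int N - 1) * x powi n"
      using x0 by (simp flip: power_int_add add: algebra_simps)
    have 4: "x powi (int N - 1) \<noteq> 0" using x0 by simp
    have gen: "a * b / (a * d * (e / PY)) = PY * (1 / (d * e) * b)" if "a \<noteq> 0" for a b d e :: real
      using that PY0 by simp
    show ?thesis unfolding splitX[OF x] 1 2 3 pf_coeff_def by (rule gen[OF 4])
  qed
  have tY: "inverse y powi (n + int N - 1) / (\<Prod>v\<in>W - {inverse y}. inverse y - v) = - (PY * (pf_coeff Y X y * y powi (- n)))" if y: "y \<in> Y" for y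
  proof -
    have y0: "y > 0" using Yp[OF y] by simp
    have "(\<Prod>x\<in>X. inverse y - x) = (\<Prod>x\<in>X. inverse y * (1 - y * x))"
      using y0 by (intro prod.cong) (auto simp: field_simps)
    also have "\<dots> = inverse y powi (int N) * (\<Prod>x\<in>X. 1 - y * x)"
      using finX cardX by (simp add: prod.distrib)
    finally have 1: "(\<Prod>x\<in>X. inverse y - x) = inverse y powi (int N) * (\<Prod>x\<in>X. 1 - y * x)" .
    have "(\<Prod>v\<in>Y - {y}. inverse y - inverse v) * (\<Prod>v\<in>Y - {y}. - v) = (\<Prod>v\<in>Y - {y}. 1 - v / y)"
      unfolding prod.distrib[symmetric] using Yp y0 by (intro prod.cong) (auto simp: field_simps)
    moreover have "PY = - y * (\<Prod>v\<in>Y - {y}. - v)"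
      unfolding PY_def using y finY by (subst prod.remove[of _ y]) auto
    ultimately have 2: "(\<Prod>v\<in>Y - {y}. inverse y - inverse v) = - y * (\<Prod>v\<in>Y - {y}. 1 - v / y) / PY"
      using PY0 by (simp add: field_simps)
    have i0: "inverse y \<noteq> 0" using y0 by simp
    have "n + int N - 1 = int N + (n + (- 1))" by simp
    then have "inverse y powi (n + int N - 1) = inverse y powi (int N) * (inverse y powi n * inverse y powi (-1))"
      by (simp only: power_int_add[OF disjI1[OF i0]])
    also have "\<dots> = inverse y powi (int N) * (y powi (- n) * y)"
      using y0 by (simp add: power_int_minus power_int_inverse)
    finally have 3: "inverse y powi (n + int N - 1) = inverse y powi (int N) * (y powi (- n) * y)" .
    have 4: "inverse y powi int N \<noteq> 0" using y0 by simp
    have gen: "a * (b * y) / (a * d * (- y * e / PY)) = - (PY * (1 / (e * d) * b))" if "a \<noteq> 0" for a b d e :: real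
      using that y0 PY0 by (simp add: field_simps)
    show ?thesis unfolding splitY[OF y] 1 2 3 pf_coeff_def by (rule gen[OF 4])
  qed
  have "(\<Sum>w\<in>W. w powi (n + int N - 1) / (\<Prod>v\<in>W - {w}. w - v)) =
     (\<Sum>x\<in>X. x powi (n + int N - 1) / (\<Prod>v\<in>W - {x}. x - v)) + (\<Sum>y\<in>Y. inverse y powi (n + int N - 1) / (\<Prod>v\<in>W - {inverse y}. inverse y - v))"
    unfolding W_def using finX finY disj by (simp add: sum.union_disjoint sum.reindex[OF inj])
  also have "\<dots> = PY * ((\<Sum>x\<in>X. pf_coeff X Y x * x powi n) - (\<Sum>y\<in>Y. pf_coeff Y X y * y powi (- n)))"
    by (simp add: tX tY sum_negf sum_distrib_left right_diff_distrib)
  finally have key: "(\<Sum>x\<in>X. pf_coeff X Y x * x powi n) - (\<Sum>y\<in>Y. pf_coeff Y X y * y powi (- n)) =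
      (\<Sum>w\<in>W. w powi (n + int N - 1) / (\<Prod>v\<in>W - {w}. w - v)) / PY"
    using PY0 by simp
  show ?thesis
  proof (cases "n = - int N")
    case False
    define e where "e = nat (n + int N - 1)"
    have e: "n + int N - 1 = int e" "e < 2 * N - 1" using n False by (auto simp: e_def)
    have "(\<Sum>w\<in>W. poly (monom 1 e) w / (\<Prod>v\<in>W - {w}. w - v)) = coeff (monom 1 e) (card W - 1)"
      by (rule sum_divided_differences[OF finW]) (use e cardW in \<open>simp add: degree_monom_eq\<close>)
    also have "\<dots> = 0" using e cardW by simp
    finally show ?thesis unfolding key e(1) using False by (simp add: poly_monom)
  next
    case True
    \<comment> \<open>Here the exponent is - 1. Adjoining the node 0 turns the sum into a part of
      the divided difference of the constant 1, and the term at 0 gives the value.\<close>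
    have "(\<Sum>x\<in>insert 0 W. poly 1 x / (\<Prod>v\<in>insert 0 W - {x}. x - v)) = coeff 1 (card (insert 0 W) - 1)"
      by (rule sum_divided_differences) (use finW in \<open>auto simp: card_gt_0_iff\<close>)
    also have "\<dots> = 0" using finW W0 cardW Npos by simp
    also have "(\<Sum>x\<in>insert 0 W. poly 1 x / (\<Prod>v\<in>insert 0 W - {x}. x - v)) =
        1 / (\<Prod>v\<in>W. - v) + (\<Sum>w\<in>W. w powi (n + int N - 1) / (\<Prod>v\<in>W - {w}. w - v))"
    proof -
      have "insert 0 W - {0} = W" using W0 by auto
      moreover have "1 / (\<Prod>v\<in>insert 0 W - {w}. w - v) = w powi (n + int N - 1) / (\<Prod>v\<in>W - {w}. w - v)" if "w \<in> W" for w
      proof -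
        have "insert 0 W - {w} = insert 0 (W - {w})" using that W0 by auto
        then show ?thesis using finW W0 True by (simp add: power_int_minus divide_inverse)
      qed
      ultimately show ?thesis using finW W0 by simp
    qed
    finally have s: "(\<Sum>w\<in>W. w powi (n + int N - 1) / (\<Prod>v\<in>W - {w}. w - v)) = - (1 / (\<Prod>v\<in>W. - v))" by simp
    have "(\<Prod>v\<in>W. - v) = (\<Prod>x\<in>X. - x) * (\<Prod>y\<in>Y. - inverse y)"
      unfolding W_def using finX finY disj by (simp add: prod.union_disjoint prod.reindex[OF inj])
    also have "(\<Prod>y\<in>Y. - inverse y) = 1 / PY"
      by (simp add: PY_def prod_dividef[symmetric] divide_inverse prod_inversef[symmetric])
    also have "(\<Prod>x\<in>X. - x) = (-1) ^ N * \<Prod>X"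
      using prod.distrib[of "\<lambda>_. -1" "\<lambda>x. x" X] by (simp add: cardX)
    finally have "(\<Prod>v\<in>W. - v) = (-1) ^ N * \<Prod>X / PY" by simp
    then show ?thesis unfolding key s using True PY0 by (cases "even N") simp_all
  qed
qed

lemma laurent_coeff_X: "- int N < n \<Longrightarrow> laurent_coeff X Y n = (\<Sum>x\<in>X. pf_coeff X Y x * x powi n)"
  using partial_fractions_overlap[of n] by (auto simp: laurent_coeff_def)

lemma laurent_coeff_Y: "n < int N \<Longrightarrow> laurent_coeff X Y n = (\<Sum>y\<in>Y. pf_coeff Y X y * y powi (- n))"
  using partial_fractions_overlap[of n] by (auto simp: laurent_coeff_def)

text \<open>The denominator of the symbol times z^N; the factor z^N is the source of the shifts by N
  below.\<close>

definition den_poly :: "real poly" where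
  "den_poly = (\<Prod>x\<in>X. [:1, - x:]) * (\<Prod>y\<in>Y. [:- y, 1:])"

lemma degree_den_poly: "degree den_poly = 2 * N"
  and coeff_den_poly: "coeff den_poly (2 * N) = (-1) ^ N * \<Prod>X"
proof -
  have nz: "[:1, - x:] \<noteq> (0 :: real poly)" "[:- y, 1:] \<noteq> (0 :: real poly)" for x y by auto
  have "degree (\<Prod>x\<in>X. [:1, - x:]) = (\<Sum>x\<in>X. degree [:1, - x:])"
    by (rule degree_prod_sum_eq) auto
  moreover have "(\<Sum>x\<in>X. degree [:1, - x:]) = (\<Sum>x\<in>X. 1)" using Xp by (intro sum.cong) auto
  moreover have "degree (\<Prod>y\<in>Y. [:- y, 1:]) = (\<Sum>y\<in>Y. degree [:- y, 1:])"
    by (rule degree_prod_sum_eq) auto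
  moreover have "(\<Prod>x\<in>X. [:1, - x:]) \<noteq> 0" "(\<Prod>y\<in>Y. [:- y, 1:]) \<noteq> 0"
    using finX finY by auto
  ultimately show d: "degree den_poly = 2 * N"
    unfolding den_poly_def by (subst degree_mult_eq) (simp_all add: cardX cardY)
  have "lead_coeff den_poly = (\<Prod>x\<in>X. lead_coeff [:1, - x:]) * (\<Prod>y\<in>Y. lead_coeff [:- y, 1:])"
    unfolding den_poly_def lead_coeff_mult lead_coeff_prod ..
  also have "(\<Prod>x\<in>X. lead_coeff [:1, - x:]) = (\<Prod>x\<in>X. - 1 * x)"
    using Xp by (intro prod.cong) auto
  also have "\<dots> = (-1) ^ N * \<Prod>X" unfolding prod.distrib by (simp add: cardX)
  finally show "coeff den_poly (2 * N) = (-1) ^ N * \<Prod>X" by (simp add: d)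
qed

text \<open>Coefficientwise, symbol times denominator is z^N. For n < N the indices n - 2N, ..., n
  all lie where the Y expansion is valid, for n > N where the X expansion is. For n = N only the
  index - N leaves the X range, with a known defect.\<close>

lemma laurent_coeff_recurrence:
  "(\<Sum>r\<le>2 * N. coeff den_poly r * laurent_coeff X Y (n - int r)) = (if n = int N then 1 else 0)"
proof -
  have poly_den: "poly den_poly z = (\<Sum>r\<le>2 * N. coeff den_poly r * z ^ r)" for z
    by (simp add: poly_altdef degree_den_poly)
  define fX where "fX m = (\<Sum>x\<in>X. pf_coeff X Y x * x powi m)" for m
  define fY where "fY m = (\<Sum>y\<in>Y. pf_coeff Y X y * y powi (- m))" for m
  have 1: "(\<Sum>r\<le>2 * N. coeff den_poly r * fX (n - int r)) = 0"
  proof -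
    have "(\<Sum>r\<le>2 * N. coeff den_poly r * fX (n - int r)) = (\<Sum>x\<in>X. pf_coeff X Y x * x powi n * poly den_poly (1 / x))"
      unfolding fX_def poly_den sum_distrib_left
    proof (subst sum.swap, intro sum.cong refl)
      fix x r assume "x \<in> X"
      then have "x powi (n - int r) = x powi n * (1 / x) ^ r"
        using Xp[of x] power_int_diff[of x n "int r"] by (simp add: power_divide)
      then show "coeff den_poly r * (pf_coeff X Y x * x powi (n - int r)) = pf_coeff X Y x * x powi n * (coeff den_poly r * (1 / x) ^ r)"
        by simp
    qed
    also have "\<dots> = 0"
    proof (intro sum.neutral ballI)
      fix x assume x: "x \<in> X"
      then have "(\<Prod>x'\<in>X. 1 + - x' * (1 / x)) = 0"
        using finX Xp[OF x] by (intro prod_zero bexI[of _ x]) auto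
      then show "pf_coeff X Y x * x powi n * poly den_poly (1 / x) = 0"
        by (simp add: den_poly_def poly_prod)
    qed
    finally show ?thesis .
  qed
  have 2: "(\<Sum>r\<le>2 * N. coeff den_poly r * fY (n - int r)) = 0"
  proof -
    have "(\<Sum>r\<le>2 * N. coeff den_poly r * fY (n - int r)) = (\<Sum>y\<in>Y. pf_coeff Y X y * y powi (- n) * poly den_poly y)"
      unfolding fY_def poly_den sum_distrib_left
    proof (subst sum.swap, intro sum.cong refl)
      fix y r assume "y \<in> Y"
      then have "y powi (- (n - int r)) = y powi (- n) * y ^ r"
        using Yp[of y] power_int_add[of y "- n" "int r"] by simp
      then show "coeff den_poly r * (pf_coeff Y X y * y powi (- (n - int r))) = pf_coeff Y X y * y powi (- n) * (coeff den_poly r * y ^ r)"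
        by simp
    qed
    also have "\<dots> = 0"
    proof (intro sum.neutral ballI)
      fix y assume y: "y \<in> Y"
      then have "(\<Prod>y'\<in>Y. - y' + y) = 0"
        using finY by (intro prod_zero bexI[of _ y]) auto
      then show "pf_coeff Y X y * y powi (- n) * poly den_poly y = 0"
        by (simp add: den_poly_def poly_prod)
    qed
    finally show ?thesis .
  qed
  consider "n < int N" | "n > int N" | "n = int N" by linarith
  then show ?thesis
  proof cases
    case 1
    then have "(\<Sum>r\<le>2 * N. coeff den_poly r * laurent_coeff X Y (n - int r)) = (\<Sum>r\<le>2 * N. coeff den_poly r * fY (n - int r))"
      by (intro sum.cong refl) (simp add: laurent_coeff_Y fY_def)
    then show ?thesis using 1 2 by simp
  next
    case 2
    then have "(\<Sum>r\<le>2 * N. coeff den_poly r * laurent_coeff X Y (n - int r)) = (\<Sum>r\<le>2 * N. coeff den_poly r * fX (n - int r))"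
      by (intro sum.cong refl) (simp add: laurent_coeff_X fX_def)
    then show ?thesis using 1 2 by simp
  next
    case 3
    have "laurent_coeff X Y (n - int r) = fX (n - int r) + (if r = 2 * N then (-1) ^ N / \<Prod>X else 0)" if "r \<le> 2 * N" for r
    proof (cases "r = 2 * N")
      case True
      then show ?thesis
        using 3 Npos partial_fractions_overlap[of "- int N"] by (simp add: laurent_coeff_Y fX_def)
    next
      case False
      then show ?thesis using 3 that by (simp add: laurent_coeff_X fX_def)
    qed
    then have "(\<Sum>r\<le>2 * N. coeff den_poly r * laurent_coeff X Y (n - int r)) =
        (\<Sum>r\<le>2 * N. coeff den_poly r * fX (n - int r) + (if r = 2 * N then coeff den_poly r * ((-1) ^ N / \<Prod>X) else 0))"
      by (intro sum.cong refl) (simp add: algebra_simps)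
    also have "\<dots> = coeff den_poly (2 * N) * ((-1) ^ N / \<Prod>X)"
      unfolding sum.distrib 1 by simp
    also have "\<dots> = 1"
      unfolding coeff_den_poly using finX Xp by (auto simp: field_simps simp flip: power_mult_distrib)
    finally show ?thesis using 3 by simp
  qed
qed

lemma laurent_coeff_decay:
  obtains C r where "0 < r" "r < 1" "C \<ge> 0" "\<And>n. \<bar>laurent_coeff X Y n\<bar> \<le> C * r ^ nat \<bar>n\<bar>"
proof -
  define r where "r = Max (X \<union> Y)"
  have ne: "X \<noteq> {}" using cardX Npos by auto
  have "r \<in> X \<union> Y" unfolding r_def using ne finX finY by (intro Max_in) auto
  then have r: "0 < r" "r < 1" using Xp Yp by auto
  have le: "z \<le> r" if "z \<in> X \<union> Y" for z unfolding r_def using that finX finY by (intro Max_ge) auto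
  define C where "C = (\<Sum>x\<in>X. \<bar>pf_coeff X Y x\<bar>) + (\<Sum>y\<in>Y. \<bar>pf_coeff Y X y\<bar>)"
  have bound: "\<bar>\<Sum>z\<in>Z. a z * z ^ k\<bar> \<le> (\<Sum>z\<in>Z. \<bar>a z\<bar>) * r ^ k" if "Z \<subseteq> X \<union> Y" for Z a k
  proof -
    have "\<bar>\<Sum>z\<in>Z. a z * z ^ k\<bar> \<le> (\<Sum>z\<in>Z. \<bar>a z * z ^ k\<bar>)" by (rule sum_abs)
    also have "\<dots> \<le> (\<Sum>z\<in>Z. \<bar>a z\<bar> * r ^ k)"
    proof (rule sum_mono)
      fix z assume "z \<in> Z"
      then have "z \<in> X \<union> Y" using that by auto
      then have "0 < z" "z \<le> r" using Xp Yp le by auto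
      then show "\<bar>a z * z ^ k\<bar> \<le> \<bar>a z\<bar> * r ^ k"
        by (simp add: abs_mult mult_left_mono power_mono)
    qed
    finally show ?thesis by (simp add: sum_distrib_right)
  qed
  have "\<bar>laurent_coeff X Y n\<bar> \<le> C * r ^ nat \<bar>n\<bar>" for n
  proof (cases "0 \<le> n")
    case True
    then have "\<bar>laurent_coeff X Y n\<bar> \<le> (\<Sum>x\<in>X. \<bar>pf_coeff X Y x\<bar>) * r ^ nat n"
      using bound[of X "pf_coeff X Y" "nat n"] by (simp add: laurent_coeff_def power_int_def)
    also have "\<dots> \<le> C * r ^ nat n"
      using r by (intro mult_right_mono) (auto simp: C_def sum_nonneg)
    finally show ?thesis using True by simp
  next
    case False
    then have "\<bar>laurent_coeff X Y n\<bar> \<le> (\<Sum>y\<in>Y. \<bar>pf_coeff Y X y\<bar>) * r ^ nat (- n)"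
      using bound[of Y "pf_coeff Y X" "nat (- n)"] by (simp add: laurent_coeff_def power_int_def)
    also have "\<dots> \<le> C * r ^ nat (- n)"
      using r by (intro mult_right_mono) (auto simp: C_def sum_nonneg)
    finally show ?thesis using False by simp
  qed
  moreover have "C \<ge> 0" by (simp add: C_def sum_nonneg)
  ultimately show ?thesis using that[of r C] r by blast
qed

end

section \<open>Toeplitz determinants\<close>

text \<open>The polynomial D in the forward shift, applied to G.\<close>

definition op_poly :: "complex poly \<Rightarrow> (int \<Rightarrow> complex) \<Rightarrow> int \<Rightarrow> complex" where
  "op_poly D G m = (\<Sum>r\<le>degree D. coeff D r * G (m + int r))"

lemma op_poly_altdef: "degree D \<le> n \<Longrightarrow> op_poly D G m = (\<Sum>r\<le>n. coeff D r * G (m + int r))"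
  unfolding op_poly_def by (rule sum.mono_neutral_left) (auto simp: coeff_eq_0)

lemma op_poly_linear_factor: "op_poly ([:a, b:] * D) G m = a * op_poly D G m + b * op_poly D G (m + 1)"
proof -
  have cf: "coeff ([:a, b:] * D) r = a * coeff D r + b * (case r of 0 \<Rightarrow> 0 | Suc s \<Rightarrow> coeff D s)" for r
    by (cases r) simp_all
  have "degree ([:a, b:] * D) \<le> Suc (degree D)"
    by (rule order_trans[OF degree_mult_le]) auto
  then have "op_poly ([:a, b:] * D) G m = (\<Sum>r\<le>Suc (degree D). coeff ([:a, b:] * D) r * G (m + int r))"
    by (rule op_poly_altdef)
  also have "\<dots> = (\<Sum>r\<le>Suc (degree D). a * (coeff D r * G (m + int r))) +
      (\<Sum>r\<le>Suc (degree D). b * ((case r of 0 \<Rightarrow> 0 | Suc s \<Rightarrow> coeff D s) * G (m + int r)))"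
    unfolding cf by (simp add: sum.distrib[symmetric] algebra_simps del: sum.atMost_Suc)
  also have "(\<Sum>r\<le>Suc (degree D). a * (coeff D r * G (m + int r))) = a * op_poly D G m"
    unfolding sum_distrib_left[symmetric] by (subst op_poly_altdef[symmetric]) auto
  also have "(\<Sum>r\<le>Suc (degree D). b * ((case r of 0 \<Rightarrow> 0 | Suc s \<Rightarrow> coeff D s) * G (m + int r))) = b * op_poly D G (m + 1)"
    unfolding sum_distrib_left[symmetric] op_poly_def by (subst sum.atMost_Suc_shift) (simp add: add_ac)
  finally show ?thesis .
qed

lemma lin_rec_op_poly:
  assumes "lin_rec N p G"
  shows "lin_rec N p (op_poly D G)"
proof -
  have "(\<Sum>r\<le>N. p r * op_poly D G (m - int r)) = 0" for m
  proof -
    have "(\<Sum>r\<le>N. p r * op_poly D G (m - int r)) = (\<Sum>s\<le>degree D. coeff D s * (\<Sum>r\<le>N. p r * G (m + int s - int r)))"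
      unfolding op_poly_def sum_distrib_left by (subst sum.swap) (simp add: algebra_simps)
    also have "\<dots> = 0" using assms by (simp add: lin_rec_def)
    finally show ?thesis .
  qed
  then show ?thesis using assms by (simp add: lin_rec_def)
qed

text \<open>Each linear factor of the difference operator comes out as one determinant
  \<open>det (lin a b U)\<close>.\<close>

lemma det_row_mat_op_poly:
  fixes \<alpha> :: "'n::finite \<Rightarrow> int" and U :: "complex^'n^'n"
  assumes "lin_rec CARD('n) (coeff (rev_char_poly U)) G" "finite I"
  shows "det (row_mat (op_poly ((\<Prod>i\<in>I. [:a i, b i:]) * D) G) \<alpha>) = det (row_mat (op_poly D G) \<alpha>) * (\<Prod>i\<in>I. det (lin (a i) (b i) U))"
  using assms(2)
proof (induction I rule: finite_induct)
  case (insert x I)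
  let ?E = "(\<Prod>i\<in>I. [:a i, b i:]) * D"
  have "row_mat (op_poly ((\<Prod>i\<in>insert x I. [:a i, b i:]) * D) G) \<alpha> =
      row_mat (\<lambda>m. a x * op_poly ?E G m + b x * op_poly ?E G (m + 1)) \<alpha>"
    using insert.hyps by (simp add: row_mat_def op_poly_linear_factor[symmetric] mult.assoc del: mult_pCons_left)
  then show ?case
    using insert by (simp add: det_row_mat_lin[OF lin_rec_op_poly[OF assms(1)]])
qed simp

lemma summable_geometric_int:
  assumes "0 < s" "s < (1 :: real)"
  shows "(\<lambda>n :: int. s ^ nat \<bar>n\<bar>) summable_on UNIV"
proof -
  have g: "(\<lambda>n. s ^ n) summable_on (UNIV :: nat set)"
    using assms by (subst summable_on_UNIV_nonneg_real_iff) auto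
  have "(\<lambda>n :: int. s ^ nat \<bar>n\<bar>) summable_on range int"
    using g by (subst summable_on_reindex) (auto simp: o_def inj_on_def)
  moreover have "(\<lambda>n :: int. s ^ nat \<bar>n\<bar>) summable_on range (\<lambda>n. - int (Suc n))"
  proof (subst summable_on_reindex)
    have "(\<lambda>n. s * s ^ n) summable_on (UNIV :: nat set)" by (intro summable_on_cmult_right g)
    moreover have "nat \<bar>- int (Suc n)\<bar> = Suc n" for n by simp
    ultimately show "((\<lambda>n :: int. s ^ nat \<bar>n\<bar>) \<circ> (\<lambda>n. - int (Suc n))) summable_on UNIV"
      by (simp add: o_def del: of_nat_Suc)
  qed (auto simp: inj_on_def)
  ultimately have "(\<lambda>n :: int. s ^ nat \<bar>n\<bar>) summable_on (range int \<union> range (\<lambda>n. - int (Suc n)))"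
    by (rule summable_on_Un_disjoint) auto
  moreover have "range int \<union> range (\<lambda>n. - int (Suc n)) = UNIV"
  proof -
    have "m \<in> range int \<union> range (\<lambda>n. - int (Suc n))" for m
      by (cases m rule: int_cases) auto
    then show ?thesis by auto
  qed
  ultimately show ?thesis by simp
qed

lemma has_sum_sum:
  fixes f :: "'a \<Rightarrow> 'b \<Rightarrow> complex"
  assumes "\<And>i. i \<in> I \<Longrightarrow> (f i has_sum S i) A"
  shows "((\<lambda>x. \<Sum>i\<in>I. f i x) has_sum (\<Sum>i\<in>I. S i)) A"
  using assms by (induction I rule: infinite_finite_induct) (auto intro: has_sum_add)

lemma has_sum_symmetric_limit:
  fixes f :: "int \<Rightarrow> complex"
  assumes "(f has_sum S) UNIV"
  shows "(\<lambda>K. \<Sum>n\<in>{- int K..int K}. f n) \<longlonglongrightarrow> S"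
proof -
  have "filterlim (\<lambda>K. {- int K..int K}) (finite_subsets_at_top UNIV) sequentially"
    unfolding filterlim_finite_subsets_at_top
  proof (intro allI impI)
    fix X :: "int set" assume "finite X \<and> X \<subseteq> UNIV"
    then have X: "finite X" by simp
    define M where "M = Max (insert 0 ((\<lambda>n. nat \<bar>n\<bar>) ` X))"
    have "X \<subseteq> {- int K..int K}" if "K \<ge> M" for K
    proof
      fix n assume "n \<in> X"
      then have "nat \<bar>n\<bar> \<le> M" using X unfolding M_def by (intro Max_ge) auto
      then show "n \<in> {- int K..int K}" using that by auto
    qed
    then show "\<forall>\<^sub>F K in sequentially. finite {- int K..int K} \<and> X \<subseteq> {- int K..int K} \<and> {- int K..int K} \<subseteq> UNIV"
      by (auto simp: eventually_sequentially)
  qed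
  then show ?thesis
    using assms unfolding has_sum_def by (rule filterlim_compose[rotated])
qed

lemma norm_det_le:
  fixes A :: "complex^'n^'n"
  assumes "\<And>i j. cmod (A $ i $ j) \<le> B"
  shows "cmod (det A) \<le> (\<Sum>p | p permutes (UNIV :: 'n set). B ^ CARD('n))"
  unfolding det_def
proof (rule sum_norm_le)
  fix p :: "'n \<Rightarrow> 'n"
  have "cmod (\<Prod>i\<in>UNIV. A $ i $ p i) \<le> (\<Prod>i\<in>(UNIV :: 'n set). B)"
    unfolding prod_norm[symmetric] by (rule prod_mono) (use assms in auto)
  moreover have "cmod (of_int (sign p)) = 1" by (simp add: sign_def)
  ultimately show "cmod (of_int (sign p) * (\<Prod>i\<in>UNIV. A $ i $ p i)) \<le> B ^ CARD('n)"
    by (simp add: norm_mult)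
qed

section \<open>From truncated sums to the full symbol\<close>

context su_haar
begin

text \<open>The series f(z) = sum of c_n z^n in the shift, applied to \<open>hz\<close>. Accordingly
  \<open>det (row_mat (gen_hz c U) _)\<close> at the consecutive rows plays the role of det
  f(U).\<close>

definition gen_hz :: "(int \<Rightarrow> complex) \<Rightarrow> complex^'n^'n \<Rightarrow> int \<Rightarrow> complex" where
  "gen_hz c U m = (\<Sum>\<^sub>\<infinity>n. c n * hz (n + m) U)"

lemma gen_hz_bound:
  assumes "0 < r" "r < 1" "C \<ge> 0" "\<And>n. cmod (c n) \<le> C * r ^ nat \<bar>n\<bar>"
  obtains g where "g summable_on UNIV" "\<And>n. g n \<ge> 0"
    "\<And>U n m. U \<in> special_unitary \<Longrightarrow> \<bar>m\<bar> \<le> int CARD('n) \<Longrightarrow> cmod (c n * hz (n + m) U) \<le> g n"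
    "\<And>U m. U \<in> special_unitary \<Longrightarrow> ((\<lambda>n. c n * hz (n + m) U) has_sum gen_hz c U m) UNIV"
proof -
  \<comment> \<open>Any q strictly between r and 1 works: decay r^n against growth (1/q)^n leaves
    the summable (r/q)^n.\<close>
  define q where "q = (1 + r) / 2"
  have q: "0 < q" "q < 1" "r < q" using assms by (auto simp: q_def)
  obtain K where K: "K \<ge> 0" "\<And>U m. U \<in> special_unitary \<Longrightarrow> cmod (hz m U) \<le> K * (1 / q) ^ nat \<bar>m\<bar>"
    using norm_hz_le[OF q(1,2)] by blast
  define g where "g M n = C * K * (1 / q) ^ M * (r / q) ^ nat \<bar>n\<bar>" for M and n :: int
  have le: "cmod (c n * hz (n + m) U) \<le> g M n" if U: "U \<in> special_unitary" and m: "\<bar>m\<bar> \<le> int M" for U n m M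
  proof -
    have "nat \<bar>n + m\<bar> \<le> M + nat \<bar>n\<bar>" using m by linarith
    then have "(1 / q) ^ nat \<bar>n + m\<bar> \<le> (1 / q) ^ (M + nat \<bar>n\<bar>)"
      using q by (intro power_increasing) auto
    then have "cmod (hz (n + m) U) \<le> K * (1 / q) ^ (M + nat \<bar>n\<bar>)"
      using K(2)[OF U, of "n + m"] K(1) by (meson mult_left_mono order_trans)
    then have "cmod (c n * hz (n + m) U) \<le> (C * r ^ nat \<bar>n\<bar>) * (K * (1 / q) ^ (M + nat \<bar>n\<bar>))"
      unfolding norm_mult using assms by (intro mult_mono) auto
    then show ?thesis by (simp add: g_def power_add power_divide mult_ac)
  qed
  have sum: "g M summable_on UNIV" for M
    unfolding g_def using q assms by (intro summable_on_cmult_right summable_geometric_int) auto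
  have g0: "g M n \<ge> 0" for M n using q K assms by (simp add: g_def)
  have hs: "((\<lambda>n. c n * hz (n + m) U) has_sum gen_hz c U m) UNIV" if U: "U \<in> special_unitary" for U m
  proof -
    have "(\<lambda>n. cmod (c n * hz (n + m) U)) summable_on UNIV"
    proof (rule summable_on_comparison_test[OF sum[of "nat \<bar>m\<bar>"]])
      have m: "\<bar>m\<bar> \<le> int (nat \<bar>m\<bar>)" by (simp only: int_nat_eq abs_ge_zero if_True order_refl)
      show "cmod (c n * hz (n + m) U) \<le> g (nat \<bar>m\<bar>) n" for n
        using le[OF U m] .
      show "0 \<le> cmod (c n * hz (n + m) U)" for n by (rule norm_ge_zero)
    qed
    then show ?thesis unfolding gen_hz_def by (rule has_sum_infsum[OF abs_summable_summable])
  qed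
  show ?thesis
  proof (rule that[of "g CARD('n)"])
    show "g CARD('n) summable_on UNIV" by (rule sum)
    show "g CARD('n) n \<ge> 0" for n by (rule g0)
    show "cmod (c n * hz (n + m) U) \<le> g CARD('n) n" if "U \<in> special_unitary" "\<bar>m\<bar> \<le> int CARD('n)" for U n m
      using that by (rule le)
    show "((\<lambda>n. c n * hz (n + m) U) has_sum gen_hz c U m) UNIV" if "U \<in> special_unitary" for U m
      using that by (rule hs)
  qed
qed

text \<open>Dominated convergence in \<open>expectation_truncated\<close>. The truncated entries are
  bounded by the sum of g for all K and U at once, and \<open>norm_det_le\<close> carries the bound
  over to determinants.\<close>

lemma expectation_toeplitz:
  assumes "0 < r" "r < 1" "C \<ge> 0" "\<And>n. cmod (c n) \<le> C * r ^ nat \<bar>n\<bar>"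
  shows "(\<lambda>K. \<Sum>k\<in>{- int K..int K - int CARD('n) + 1}. det (\<chi> (i :: 'n) (j :: 'n). c (k + int (phi j) - int (phi i))))
    \<longlonglongrightarrow> expectation (\<lambda>U. det (row_mat (gen_hz c U) (\<lambda>i :: 'n. int (phi i))))"
proof -
  obtain g where g: "g summable_on UNIV" "\<And>n. g n \<ge> 0"
    "\<And>U n m. U \<in> special_unitary \<Longrightarrow> \<bar>m\<bar> \<le> int CARD('n) \<Longrightarrow> cmod (c n * hz (n + m) U) \<le> g n"
    "\<And>U m. U \<in> special_unitary \<Longrightarrow> ((\<lambda>n. c n * hz (n + m) U) has_sum gen_hz c U m) UNIV"
    by (rule gen_hz_bound[OF assms]) (rule that, assumption+)
  define T where "T K U = (\<chi> (i :: 'n) (j :: 'n). \<Sum>n\<in>{- int K..int K}. c (n - int (phi i)) * hz (n - int (phi j)) U)" for K U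
  define B where "B = infsum g UNIV"
  have diff: "\<bar>int (phi i) - int (phi j)\<bar> \<le> int CARD('n)" for i j :: 'n
    using phi_less[of i] phi_less[of j] by linarith
  have T_bound: "cmod (T K U $ i $ j) \<le> B" if U: "U \<in> special_unitary" for K U i j
  proof -
    have "cmod (T K U $ i $ j) \<le> (\<Sum>n\<in>{- int K..int K}. g (n - int (phi i)))"
      unfolding T_def vec_lambda_beta
    proof (rule sum_norm_le)
      fix n show "cmod (c (n - int (phi i)) * hz (n - int (phi j)) U) \<le> g (n - int (phi i))"
        using g(3)[OF U diff[of i j], of "n - int (phi i)"] by simp
    qed
    also have "\<dots> = sum g ((\<lambda>n. n - int (phi i)) ` {- int K..int K})"
      by (subst sum.reindex) (auto simp: inj_on_def)
    also have "\<dots> \<le> B" unfolding B_def using g by (intro finite_sum_le_infsum) auto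
    finally show ?thesis .
  qed
  have T_lim: "(\<lambda>K. T K U $ i $ j) \<longlonglongrightarrow> row_mat (gen_hz c U) (\<lambda>i :: 'n. int (phi i)) $ i $ j" if U: "U \<in> special_unitary" for U i j
  proof -
    have "bij_betw (\<lambda>n. n - int (phi i)) UNIV UNIV"
      by (rule bij_betw_byWitness[of _ "\<lambda>n. n + int (phi i)"]) auto
    from has_sum_reindex_bij_betw[OF this, of "\<lambda>n. c n * hz (n + (int (phi i) - int (phi j))) U"]
    have "((\<lambda>n. c (n - int (phi i)) * hz (n - int (phi j)) U) has_sum gen_hz c U (int (phi i) - int (phi j))) UNIV"
      using g(4)[OF U, of "int (phi i) - int (phi j)"] by simp
    from has_sum_symmetric_limit[OF this] show ?thesis by (simp add: T_def row_mat_def)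
  qed
  have "(\<lambda>K. expectation (\<lambda>U. det (T K U))) \<longlonglongrightarrow> expectation (\<lambda>U. det (row_mat (gen_hz c U) (\<lambda>i :: 'n. int (phi i))))"
  proof (rule integral_dominated_convergence[where w = "\<lambda>_. \<Sum>p | p permutes (UNIV :: 'n set). B ^ CARD('n)"])
    have meas: "(\<lambda>U. det (T K U)) \<in> borel_measurable \<mu>" for K
      unfolding det_def T_def by (rule bm_measurable, simp, intro bm_intros bm_hz)
    then show "(\<lambda>U. det (T K U)) \<in> borel_measurable \<mu>" for K .
    have lim: "(\<lambda>K. det (T K U)) \<longlonglongrightarrow> det (row_mat (gen_hz c U) (\<lambda>i :: 'n. int (phi i)))" if "U \<in> space \<mu>" for U
      unfolding det_def by (intro tendsto_sum tendsto_mult tendsto_const tendsto_prod T_lim) (use that in \<open>simp add: space_eq\<close>)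
    then show "AE U in \<mu>. (\<lambda>K. det (T K U)) \<longlonglongrightarrow> det (row_mat (gen_hz c U) (\<lambda>i :: 'n. int (phi i)))"
      by (rule AE_I2)
    show "(\<lambda>U. det (row_mat (gen_hz c U) (\<lambda>i :: 'n. int (phi i)))) \<in> borel_measurable \<mu>"
      by (rule borel_measurable_LIMSEQ_metric[OF meas lim])
    show "AE U in \<mu>. norm (det (T K U)) \<le> (\<Sum>p | p permutes (UNIV :: 'n set). B ^ CARD('n))" for K
      by (rule AE_I2, rule norm_det_le) (simp add: T_bound space_eq)
  qed simp
  then show ?thesis unfolding T_def expectation_truncated .
qed

text \<open>After the shift is removed this is the Jacobi-Trudi determinant of the empty partition,
  which is triangular with diagonal h_0 = 1.\<close>

lemma det_row_mat_hz: 
  assumes "U \<in> special_unitary"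
  shows "det (row_mat (\<lambda>m. hz (m + k) U) (\<lambda>i :: 'n. int (phi i))) = 1"
proof -
  have "det (row_mat (\<lambda>m. hz (m + k) U) (\<lambda>i :: 'n. int (phi i))) = det (row_mat (\<lambda>m. hz m U) (\<lambda>i :: 'n. int (phi i) + k))"
    by (simp add: row_mat_def algebra_simps)
  also have "\<dots> = det (row_mat (\<lambda>m. hz m U) (\<lambda>i :: 'n. int (phi i)))"
    using assms by (intro det_row_mat_shift[OF lin_rec_hz]) (auto simp: special_unitary_def)
  also have "\<dots> = (\<Prod>i\<in>UNIV. row_mat (\<lambda>m. hz m U) (\<lambda>i :: 'n. int (phi i)) $ i $ i)"
  proof (rule det_lower_triangular_phi)
    fix i j :: 'n assume "phi i < phi j"
    then show "row_mat (\<lambda>m. hz m U) (\<lambda>i :: 'n. int (phi i)) $ i $ j = 0"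
      using phi_less[of j] by (simp add: row_mat_def) (intro hz_neg, auto)
  qed
  also have "\<dots> = 1" by (simp add: row_mat_def hz_0)
  finally show ?thesis .
qed

end

section \<open>Toeplitz determinants for N distinct nodes on each side\<close>

lemma map_poly_of_real_mult:
  "map_poly complex_of_real (p * q) = map_poly of_real p * map_poly of_real q"
  by (rule poly_eqI) (simp add: coeff_map_poly coeff_mult)

lemma map_poly_of_real_prod:
  "map_poly complex_of_real (\<Prod>i\<in>I. f i) = (\<Prod>i\<in>I. map_poly of_real (f i))"
  by (induction I rule: infinite_finite_induct) (auto simp: map_poly_of_real_mult)

lemma det_of_real: "det (\<chi> i j. complex_of_real (A $ i $ j)) = of_real (det A)"
  by (simp add: det_def)

text \<open>A Toeplitz matrix made of N geometric sequences factors as Vandermonde, diagonal,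
  Vandermonde. Both a and k sit in the diagonal, so \<delta> depends on the nodes only and may be
  computed for one convenient choice.\<close>

lemma toeplitz_factor:
  fixes z :: "'b \<Rightarrow> real"
  assumes "finite S" "card S = CARD('n::finite)" and nz: "\<And>s. s \<in> S \<Longrightarrow> z s \<noteq> 0"
  obtains \<delta> where "\<And>a k. det (\<chi> (i :: 'n) (j :: 'n). \<Sum>s\<in>S. a s * z s powi (k + int (phi j) - int (phi i))) =
      (\<Prod>s\<in>S. a s * z s powi k) * \<delta>"
proof -
  obtain \<xi> :: "'n \<Rightarrow> 'b" where \<xi>: "bij_betw \<xi> UNIV S"
    using finite_same_card_bij[of "UNIV :: 'n set" S] assms by auto
  have \<xi>S: "\<xi> l \<in> S" for l using \<xi> by (auto simp: bij_betw_def)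
  define L :: "real^'n^'n" where "L = (\<chi> i l. z (\<xi> l) powi (- int (phi i)))"
  define R :: "real^'n^'n" where "R = (\<chi> l j. z (\<xi> l) powi int (phi j))"
  show ?thesis
  proof (rule that[of "det L * det R"])
    fix a :: "'b \<Rightarrow> real" and k
    have "(\<chi> (i :: 'n) (j :: 'n). \<Sum>s\<in>S. a s * z s powi (k + int (phi j) - int (phi i))) = L ** (\<chi> l. (a (\<xi> l) * z (\<xi> l) powi k) *s R $ l)"
    proof -
      have "(\<Sum>s\<in>S. a s * z s powi (k + int (phi j) - int (phi i))) = (L ** (\<chi> l. (a (\<xi> l) * z (\<xi> l) powi k) *s R $ l)) $ i $ j" for i j
      proof -
        have "(\<Sum>s\<in>S. a s * z s powi (k + int (phi j) - int (phi i))) = (\<Sum>l\<in>UNIV. a (\<xi> l) * z (\<xi> l) powi (k + int (phi j) - int (phi i)))"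
          by (rule sum.reindex_bij_betw[OF \<xi>, symmetric])
        also have "\<dots> = (\<Sum>l\<in>UNIV. L $ i $ l * (a (\<xi> l) * z (\<xi> l) powi k * R $ l $ j))"
          using nz[OF \<xi>S] by (intro sum.cong refl) (simp add: L_def R_def power_int_add power_int_diff power_int_minus field_simps)
        finally show ?thesis by (simp add: matrix_matrix_mult_def)
      qed
      then show ?thesis by (simp add: vec_eq_iff)
    qed
    then have "det (\<chi> (i :: 'n) (j :: 'n). \<Sum>s\<in>S. a s * z s powi (k + int (phi j) - int (phi i))) = det L * ((\<Prod>l\<in>UNIV. a (\<xi> l) * z (\<xi> l) powi k) * det R)"
      by (simp add: det_mul det_rows_mul)
    also have "(\<Prod>l\<in>UNIV. a (\<xi> l) * z (\<xi> l) powi k) = (\<Prod>s\<in>S. a s * z s powi k)"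
      by (rule prod.reindex_bij_betw[OF \<xi>])
    finally show "det (\<chi> (i :: 'n) (j :: 'n). \<Sum>s\<in>S. a s * z s powi (k + int (phi j) - int (phi i))) = (\<Prod>s\<in>S. a s * z s powi k) * (det L * det R)"
      by simp
  qed
qed

context node_sets
begin

text \<open>For empty Y the symbol is 1 over the product of the 1 - x z. Its coefficients vanish in
  negative degrees, which in this range is a statement about divided differences of
  monomials.\<close>

lemma pf_coeff_empty_sum:
  assumes "- int N < n" "n \<le> 0"
  shows "(\<Sum>x\<in>X. pf_coeff X {} x * x powi n) = (if n = 0 then 1 else 0)"
proof -
  define e where "e = nat (n + int N - 1)"
  have e: "n + int N - 1 = int e" "e \<le> N - 1" "e = N - 1 \<longleftrightarrow> n = 0" using assms Npos by (auto simp: e_def)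
  have "(\<Sum>x\<in>X. pf_coeff X {} x * x powi n) = (\<Sum>x\<in>X. poly (monom 1 e) x / (\<Prod>v\<in>X - {x}. x - v))"
  proof (intro sum.cong refl)
    fix x assume x: "x \<in> X"
    have x0: "x > 0" using Xp[OF x] by simp
    note 1 = prod_node_diff[OF x]
    have "x ^ e = x powi (int N - 1) * x powi n"
      using x0 e(1) by (simp flip: power_int_add power_int_of_nat add: algebra_simps)
    then show "pf_coeff X {} x * x powi n = poly (monom 1 e) x / (\<Prod>v\<in>X - {x}. x - v)"
      unfolding 1 using x0 by (simp add: pf_coeff_def poly_monom)
  qed
  also have "\<dots> = coeff (monom 1 e) (card X - 1)"
    using e Npos by (intro sum_divided_differences finX) (simp add: degree_monom_eq cardX)
  finally show ?thesis using e by (simp add: cardX)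
qed

text \<open>The differences of row and column numbers stay below N in absolute value. Hence for
  nonnegative k all entries follow the X expansion, and for nonpositive k the Y expansion.\<close>

lemma toeplitz_dets:
  assumes N: "N = CARD('n::finite)"
  defines "\<Delta> \<equiv> \<lambda>k. det (\<chi> (i :: 'n) (j :: 'n). laurent_coeff X Y (k + int (phi j) - int (phi i)))"
  shows "k \<ge> 0 \<Longrightarrow> \<Delta> k = (\<Prod>X) ^ nat k * (\<Prod>x\<in>X. \<Prod>y\<in>Y. 1 / (1 - x * y))"
    and "k \<le> 0 \<Longrightarrow> \<Delta> k = (\<Prod>Y) ^ nat (- k) * (\<Prod>x\<in>X. \<Prod>y\<in>Y. 1 / (1 - x * y))"
proof -
  have nzX: "x \<noteq> 0" if "x \<in> X" for x using Xp[OF that] by simp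
  have nzY: "inverse y \<noteq> 0" if "y \<in> Y" for y using Yp[OF that] by simp
  obtain \<delta> where \<delta>: "\<And>a k. det (\<chi> (i :: 'n) (j :: 'n). \<Sum>x\<in>X. a x * x powi (k + int (phi j) - int (phi i))) =
      (\<Prod>x\<in>X. a x * x powi k) * \<delta>"
    by (rule toeplitz_factor[where ?'n = 'n and z = "\<lambda>x. x", OF finX cardX[unfolded N] nzX]) (assumption, rule that, assumption)
  obtain \<epsilon> where \<epsilon>: "\<And>a k. det (\<chi> (i :: 'n) (j :: 'n). \<Sum>y\<in>Y. a y * inverse y powi (k + int (phi j) - int (phi i))) =
      (\<Prod>y\<in>Y. a y * inverse y powi k) * \<epsilon>"
    by (rule toeplitz_factor[where ?'n = 'n and z = inverse, OF finY cardY[unfolded N] nzY]) (assumption, rule that, assumption)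
  have diff: "\<bar>int (phi j) - int (phi i)\<bar> < int N" for i j :: 'n
    using phi_less[of i] phi_less[of j] N by linarith
  have X0: "\<Delta> k = (\<Prod>X) ^ nat k * ((\<Prod>x\<in>X. pf_coeff X Y x) * \<delta>)" if "k \<ge> 0" for k
  proof -
    have "laurent_coeff X Y (k + int (phi j) - int (phi i)) = (\<Sum>x\<in>X. pf_coeff X Y x * x powi (k + int (phi j) - int (phi i)))" for i j :: 'n
      using diff[of j i] that by (intro laurent_coeff_X) linarith
    then have "\<Delta> k = (\<Prod>x\<in>X. pf_coeff X Y x * x powi k) * \<delta>"
      unfolding \<Delta>_def by (simp add: \<delta>)
    then show ?thesis using that by (simp add: prod.distrib power_int_def prod_power_distrib)
  qed
  have Y0: "\<Delta> k = (\<Prod>Y) ^ nat (- k) * ((\<Prod>y\<in>Y. pf_coeff Y X y) * \<epsilon>)" if "k \<le> 0" for k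
  proof -
    have "laurent_coeff X Y (k + int (phi j) - int (phi i)) = (\<Sum>y\<in>Y. pf_coeff Y X y * inverse y powi (k + int (phi j) - int (phi i)))" for i j :: 'n
    proof -
      have "laurent_coeff X Y (k + int (phi j) - int (phi i)) = (\<Sum>y\<in>Y. pf_coeff Y X y * y powi (- (k + int (phi j) - int (phi i))))"
        using diff[of j i] that by (intro laurent_coeff_Y) linarith
      also have "\<dots> = (\<Sum>y\<in>Y. pf_coeff Y X y * inverse y powi (k + int (phi j) - int (phi i)))"
        by (simp only: power_int_minus power_int_inverse)
      finally show ?thesis .
    qed
    then have "\<Delta> k = (\<Prod>y\<in>Y. pf_coeff Y X y * inverse y powi k) * \<epsilon>"
      unfolding \<Delta>_def by (simp add: \<epsilon>)
    also have "\<dots> = (\<Prod>y\<in>Y. pf_coeff Y X y * y ^ nat (- k)) * \<epsilon>"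
    proof -
      have "inverse y powi k = y ^ nat (- k)" for y :: real
        using that by (cases "k = 0") (auto simp: power_int_def)
      then show ?thesis by simp
    qed
    finally show ?thesis by (simp add: prod.distrib prod_power_distrib)
  qed
  \<comment> \<open>The convenient choice: for empty Y and k = 0 the Toeplitz matrix is
    unitriangular. This fixes \<delta>, and restoring Y only multiplies the coefficients by the
    Cauchy product.\<close>
  have "(\<Prod>x\<in>X. pf_coeff X {} x) * \<delta> = 1"
  proof -
    have "(\<Prod>x\<in>X. pf_coeff X {} x) * \<delta> = det (\<chi> (i :: 'n) (j :: 'n). \<Sum>x\<in>X. pf_coeff X {} x * x powi (0 + int (phi j) - int (phi i)))"
      unfolding \<delta> by simp
    also have "\<dots> = (\<Prod>i\<in>(UNIV :: 'n set). (\<chi> (i :: 'n) (j :: 'n). \<Sum>x\<in>X. pf_coeff X {} x * x powi (0 + int (phi j) - int (phi i))) $ i $ i)"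
    proof (rule det_upper_triangular_phi)
      fix i j :: 'n assume "phi j < phi i"
      then show "(\<chi> (i :: 'n) (j :: 'n). \<Sum>x\<in>X. pf_coeff X {} x * x powi (0 + int (phi j) - int (phi i))) $ i $ j = 0"
        using diff[of j i] pf_coeff_empty_sum[of "int (phi j) - int (phi i)"] by auto
    qed
    also have "\<dots> = 1" using pf_coeff_empty_sum[of 0] Npos by simp
    finally show ?thesis .
  qed
  moreover have "pf_coeff X Y x = pf_coeff X {} x * (\<Prod>y\<in>Y. 1 / (1 - x * y))" for x
    by (simp add: pf_coeff_def prod_dividef)
  ultimately have d: "(\<Prod>x\<in>X. pf_coeff X Y x) * \<delta> = (\<Prod>x\<in>X. \<Prod>y\<in>Y. 1 / (1 - x * y))"
    by (simp add: prod.distrib mult_ac)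
  show "k \<ge> 0 \<Longrightarrow> \<Delta> k = (\<Prod>X) ^ nat k * (\<Prod>x\<in>X. \<Prod>y\<in>Y. 1 / (1 - x * y))"
    using X0 d by simp
  \<comment> \<open>Both expansions are valid at k = 0, which carries the constant over to the other
    side.\<close>
  have "(\<Prod>y\<in>Y. pf_coeff Y X y) * \<epsilon> = (\<Prod>x\<in>X. \<Prod>y\<in>Y. 1 / (1 - x * y))"
    using X0[of 0] Y0[of 0] d by simp
  then show "k \<le> 0 \<Longrightarrow> \<Delta> k = (\<Prod>Y) ^ nat (- k) * (\<Prod>x\<in>X. \<Prod>y\<in>Y. 1 / (1 - x * y))"
    using Y0 by simp
qed

text \<open>Two geometric series that share the term k = 0, hence the final - 1.\<close>

lemma toeplitz_sum_limit:
  assumes N: "N = CARD('n::finite)"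
  shows "(\<lambda>K. \<Sum>k\<in>{- int K..int K - int CARD('n) + 1}. det (\<chi> (i :: 'n) (j :: 'n). laurent_coeff X Y (k + int (phi j) - int (phi i))))
    \<longlonglongrightarrow> (\<Prod>x\<in>X. \<Prod>y\<in>Y. 1 / (1 - x * y)) * (1 / (1 - \<Prod>X) + 1 / (1 - \<Prod>Y) - 1)"
proof -
  define D where "D = (\<Prod>x\<in>X. \<Prod>y\<in>Y. 1 / (1 - x * y))"
  define \<Delta> where "\<Delta> k = det (\<chi> (i :: 'n) (j :: 'n). laurent_coeff X Y (k + int (phi j) - int (phi i)))" for k
  have \<Delta>: "k \<ge> 0 \<Longrightarrow> \<Delta> k = (\<Prod>X) ^ nat k * D" "k \<le> 0 \<Longrightarrow> \<Delta> k = (\<Prod>Y) ^ nat (- k) * D" for k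
    unfolding \<Delta>_def D_def using toeplitz_dets[OF N] by auto
  have PX: "0 < \<Prod>X" "\<Prod>X < 1" and PY: "0 < \<Prod>Y" "\<Prod>Y < 1"
  proof -
    have "X \<noteq> {}" "Y \<noteq> {}" using cardX cardY Npos by force+
    then show "0 < \<Prod>X" "\<Prod>X < 1" "0 < \<Prod>Y" "\<Prod>Y < 1"
      using prod_less_1[OF finX _ X01] prod_less_1[OF finY _ Y01] by auto
  qed
  have eq: "(\<Sum>k\<in>{- int K..int K - int N + 1}. \<Delta> k) = D * (\<Sum>k<K + 2 - N. (\<Prod>X) ^ k) + D * (\<Sum>k<Suc K. (\<Prod>Y) ^ k) - D" if "K \<ge> N" for K
  proof -
    have "{- int K..int K - int N + 1} = (\<lambda>k. - int (Suc k)) ` {..<K} \<union> int ` {..<K + 2 - N}"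
    proof (intro equalityI subsetI)
      fix k assume k: "k \<in> {- int K..int K - int N + 1}"
      show "k \<in> (\<lambda>k. - int (Suc k)) ` {..<K} \<union> int ` {..<K + 2 - N}"
      proof (cases "k < 0")
        case True
        then have "k = - int (Suc (nat (- k - 1)))" "nat (- k - 1) < K" using k by auto
        then show ?thesis by blast
      next
        case False
        then have "k = int (nat k)" "nat k < K + 2 - N" using k that by auto
        then show ?thesis by blast
      qed
    qed (use that in auto)
    then have "(\<Sum>k\<in>{- int K..int K - int N + 1}. \<Delta> k) = (\<Sum>k\<in>(\<lambda>k. - int (Suc k)) ` {..<K}. \<Delta> k) + (\<Sum>k\<in>int ` {..<K + 2 - N}. \<Delta> k)"
      by (simp only:) (rule sum.union_disjoint, auto)
    also have "(\<Sum>k\<in>(\<lambda>k. - int (Suc k)) ` {..<K}. \<Delta> k) = (\<Sum>k<K. D * (\<Prod>Y) ^ Suc k)"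
    proof (subst sum.reindex)
      have "nat (- (- int (Suc k))) = Suc k" for k by simp
      then show "sum (\<Delta> \<circ> (\<lambda>k. - int (Suc k))) {..<K} = (\<Sum>k<K. D * (\<Prod>Y) ^ Suc k)"
        by (intro sum.cong refl) (simp only: o_def, subst \<Delta>(2), auto)
    qed (auto simp: inj_on_def)
    also have "\<dots> = D * (\<Sum>k<Suc K. (\<Prod>Y) ^ k) - D"
      by (subst sum.lessThan_Suc_shift) (simp add: sum_distrib_left distrib_left)
    also have "(\<Sum>k\<in>int ` {..<K + 2 - N}. \<Delta> k) = D * (\<Sum>k<K + 2 - N. (\<Prod>X) ^ k)"
      by (subst sum.reindex) (auto simp: sum_distrib_left \<Delta>(1) mult.commute)
    finally show ?thesis by simp
  qed
  have "(\<lambda>n. \<Sum>k<n. (\<Prod>X) ^ k) \<longlonglongrightarrow> 1 / (1 - \<Prod>X)" "(\<lambda>n. \<Sum>k<n. (\<Prod>Y) ^ k) \<longlonglongrightarrow> 1 / (1 - \<Prod>Y)"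
    using geometric_sums[of "\<Prod>X"] geometric_sums[of "\<Prod>Y"] PX PY by (auto simp: sums_def)
  note geo = this
  have "filterlim (\<lambda>K. K + 2 - N) sequentially sequentially"
    by (rule filterlim_at_top_mono[OF filterlim_minus_const_nat_at_top[of N]]) (auto intro: always_eventually)
  then have "(\<lambda>K. \<Sum>k<K + 2 - N. (\<Prod>X) ^ k) \<longlonglongrightarrow> 1 / (1 - \<Prod>X)"
    by (rule filterlim_compose[OF geo(1)])
  then have "(\<lambda>K. D * (\<Sum>k<K + 2 - N. (\<Prod>X) ^ k) + D * (\<Sum>k<Suc K. (\<Prod>Y) ^ k) - D) \<longlonglongrightarrow> D * (1 / (1 - \<Prod>X)) + D * (1 / (1 - \<Prod>Y)) - D"
    using LIMSEQ_Suc[OF geo(2)] by (intro tendsto_add tendsto_diff tendsto_mult tendsto_const)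
  moreover have "\<forall>\<^sub>F K in sequentially. D * (\<Sum>k<K + 2 - N. (\<Prod>X) ^ k) + D * (\<Sum>k<Suc K. (\<Prod>Y) ^ k) - D = (\<Sum>k\<in>{- int K..int K - int N + 1}. \<Delta> k)"
    by (rule eventually_sequentiallyI[of N]) (rule eq[symmetric])
  ultimately have "(\<lambda>K. \<Sum>k\<in>{- int K..int K - int N + 1}. \<Delta> k) \<longlonglongrightarrow> D * (1 / (1 - \<Prod>X)) + D * (1 / (1 - \<Prod>Y)) - D"
    by (rule Lim_transform_eventually)
  then show ?thesis by (simp add: \<Delta>_def D_def N algebra_simps)
qed

end

section \<open>The integral with N distinct nodes on each side\<close>

context su_haar
begin

text \<open>The integrand with one node per flavour: X refines the parameter t' and Y refines
  t.\<close>

definition weight :: "real set \<Rightarrow> real set \<Rightarrow> complex^'n^'n \<Rightarrow> complex" where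
  "weight X Y U = (\<Prod>x\<in>X. 1 / det (lin 1 (- of_real x) U)) * (\<Prod>y\<in>Y. 1 / cnj (det (lin 1 (- of_real y) U)))"

text \<open>The denominator, read as a difference operator, undoes the symbol: it sends
  \<open>gen_hz c U\<close> to \<open>hz\<close> shifted by N, whose determinant is 1. Its linear
  factors contribute the determinants in \<open>weight\<close>, so the determinant of
  \<open>gen_hz\<close> is \<open>weight\<close> and the Toeplitz sum applies.\<close>

lemma expectation_weight:
  assumes nodes: "node_sets X Y CARD('n)"
  shows "expectation (weight X Y) =
    of_real ((\<Prod>x\<in>X. \<Prod>y\<in>Y. 1 / (1 - x * y)) * (1 / (1 - \<Prod>X) + 1 / (1 - \<Prod>Y) - 1))"
proof -
  interpret node_sets X Y "CARD('n)" by (rule nodes)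
  define c where "c n = complex_of_real (laurent_coeff X Y n)" for n
  define D where "D = (\<Prod>x\<in>X. [:1, - complex_of_real x:]) * (\<Prod>y\<in>Y. [:- complex_of_real y, 1:])"
  have D: "D = map_poly of_real den_poly"
    unfolding D_def den_poly_def map_poly_of_real_mult map_poly_of_real_prod
    by (simp add: map_poly_pCons)
  obtain r C where Cr: "0 < r" "r < 1" "C \<ge> 0" "\<And>n. \<bar>laurent_coeff X Y n\<bar> \<le> C * r ^ nat \<bar>n\<bar>"
    by (rule laurent_coeff_decay) (rule that, assumption+)
  have c: "cmod (c n) \<le> C * r ^ nat \<bar>n\<bar>" for n using Cr(4) by (simp add: c_def)
  have hs: "((\<lambda>n. c n * hz (n + m) U) has_sum gen_hz c U m) UNIV" if "U \<in> special_unitary" for U m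
  proof -
    obtain g :: "int \<Rightarrow> real" where "\<And>U m. U \<in> special_unitary \<Longrightarrow> ((\<lambda>n. c n * hz (n + m) U) has_sum gen_hz c U m) UNIV"
      by (rule gen_hz_bound[OF Cr(1-3) c]) (rule that, assumption)
    then show ?thesis using that .
  qed
  have "det (row_mat (gen_hz c U) (\<lambda>i :: 'n. int (phi i))) = weight X Y U" if U: "U \<in> space \<mu>" for U
  proof -
    have U: "U \<in> special_unitary" using U by (simp add: space_eq)
    have rec: "lin_rec CARD('n) (coeff (rev_char_poly U)) (gen_hz c U)"
      unfolding lin_rec_def
    proof (intro conjI allI)
      show "coeff (rev_char_poly U) 0 = 1" by (rule coeff_rev_char_poly_0)
      fix m
      have "((\<lambda>n. \<Sum>s\<le>CARD('n). coeff (rev_char_poly U) s * (c n * hz (n + (m - int s)) U)) has_sum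
          (\<Sum>s\<le>CARD('n). coeff (rev_char_poly U) s * gen_hz c U (m - int s))) UNIV"
        by (intro has_sum_sum has_sum_cmult_right hs U)
      moreover have "(\<Sum>s\<le>CARD('n). coeff (rev_char_poly U) s * (c n * hz (n + (m - int s)) U)) = 0" for n
      proof -
        have "(\<Sum>s\<le>CARD('n). coeff (rev_char_poly U) s * (c n * hz (n + (m - int s)) U)) =
            c n * (\<Sum>s\<le>CARD('n). coeff (rev_char_poly U) s * hz (n + m - int s) U)"
          by (simp add: sum_distrib_left algebra_simps)
        then show ?thesis using lin_rec_hz[OF U] by (simp add: lin_rec_def)
      qed
      ultimately have "((\<lambda>n :: int. 0) has_sum (\<Sum>s\<le>CARD('n). coeff (rev_char_poly U) s * gen_hz c U (m - int s))) UNIV"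
        by simp
      then show "(\<Sum>s\<le>CARD('n). coeff (rev_char_poly U) s * gen_hz c U (m - int s)) = 0"
        by (rule has_sum_unique[OF _ has_sum_0_simp])
    qed
    have op: "op_poly D (gen_hz c U) m = hz (m + int CARD('n)) U" for m
    proof -
      have sh: "((\<lambda>n. c (n - int s) * hz (n + m) U) has_sum gen_hz c U (m + int s)) UNIV" for s
      proof -
        have "bij_betw (\<lambda>n. n - int s) UNIV UNIV"
          by (rule bij_betw_byWitness[of _ "\<lambda>n. n + int s"]) auto
        from has_sum_reindex_bij_betw[OF this, of "\<lambda>n. c n * hz (n + (m + int s)) U"]
        show ?thesis using hs[OF U, of "m + int s"] by (simp add: add_ac)
      qed
      have "degree D \<le> 2 * CARD('n)" unfolding D degree_den_poly[symmetric] by (intro degree_le) (simp add: coeff_map_poly coeff_eq_0)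
      then have "op_poly D (gen_hz c U) m = (\<Sum>s\<le>2 * CARD('n). coeff D s * gen_hz c U (m + int s))"
        by (rule op_poly_altdef)
      moreover have "((\<lambda>n. \<Sum>s\<le>2 * CARD('n). coeff D s * (c (n - int s) * hz (n + m) U)) has_sum
          (\<Sum>s\<le>2 * CARD('n). coeff D s * gen_hz c U (m + int s))) UNIV"
        by (intro has_sum_sum has_sum_cmult_right sh)
      moreover have "(\<Sum>s\<le>2 * CARD('n). coeff D s * (c (n - int s) * hz (n + m) U)) = (if n = int CARD('n) then hz (n + m) U else 0)" for n
      proof -
        have "(\<Sum>s\<le>2 * CARD('n). coeff D s * (c (n - int s) * hz (n + m) U)) =
            of_real (\<Sum>s\<le>2 * CARD('n). coeff den_poly s * laurent_coeff X Y (n - int s)) * hz (n + m) U"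
          unfolding of_real_sum sum_distrib_right by (intro sum.cong refl) (simp add: D coeff_map_poly c_def)
        then show ?thesis unfolding laurent_coeff_recurrence by simp
      qed
      moreover have "((\<lambda>n. if n = int CARD('n) then hz (n + m) U else 0) has_sum hz (int CARD('n) + m) U) UNIV"
        by (rule has_sum_finite_neutralI[of "{int CARD('n)}"]) auto
      ultimately show ?thesis by (simp add: has_sum_unique add.commute)
    qed
    have one: "op_poly 1 (gen_hz c U) = gen_hz c U" by (simp add: op_poly_def fun_eq_iff)
    \<comment> \<open>The factors of \<open>D\<close> are now split off one by one; those of Y give
      det(U - y), which is the conjugate of det(1 - yU).\<close>
    have "1 = det (row_mat (op_poly D (gen_hz c U)) (\<lambda>i :: 'n. int (phi i)))"
      unfolding op[abs_def] by (rule det_row_mat_hz[OF U, symmetric])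
    also have "\<dots> = det (row_mat (op_poly ((\<Prod>y\<in>Y. [:- complex_of_real y, 1:]) * 1) (gen_hz c U)) (\<lambda>i :: 'n. int (phi i))) *
        (\<Prod>x\<in>X. det (lin 1 (- of_real x) U))"
      unfolding D_def by (subst det_row_mat_op_poly[OF rec finX]) simp
    also have "\<dots> = det (row_mat (gen_hz c U) (\<lambda>i :: 'n. int (phi i))) * (\<Prod>y\<in>Y. det (lin (- of_real y) 1 U)) * (\<Prod>x\<in>X. det (lin 1 (- of_real x) U))"
      unfolding det_row_mat_op_poly[OF rec finY] one ..
    also have "(\<Prod>y\<in>Y. det (lin (- of_real y) 1 U)) = (\<Prod>y\<in>Y. cnj (det (lin 1 (- of_real y) U)))"
      using det_lin_special_unitary[OF U, of "- of_real _" 1] by (intro prod.cong refl) simp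
    finally have e: "det (row_mat (gen_hz c U) (\<lambda>i :: 'n. int (phi i))) * (\<Prod>y\<in>Y. cnj (det (lin 1 (- of_real y) U))) * (\<Prod>x\<in>X. det (lin 1 (- of_real x) U)) = 1" ..
    have w: "weight X Y U = 1 / ((\<Prod>y\<in>Y. cnj (det (lin 1 (- of_real y) U))) * (\<Prod>x\<in>X. det (lin 1 (- of_real x) U)))"
      by (simp add: weight_def prod_dividef)
    have "a = 1 / (b * d)" if "a * b * d = 1" for a b d :: complex
      using that by (cases "b * d = 0") (auto simp: field_simps)
    then show ?thesis unfolding w using e by blast
  qed
  then have E: "expectation (weight X Y) = expectation (\<lambda>U. det (row_mat (gen_hz c U) (\<lambda>i :: 'n. int (phi i))))"
    by (intro Bochner_Integration.integral_cong) auto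
  have "(\<lambda>K. \<Sum>k\<in>{- int K..int K - int CARD('n) + 1}. det (\<chi> (i :: 'n) (j :: 'n). c (k + int (phi j) - int (phi i)))) \<longlonglongrightarrow> expectation (weight X Y)"
    unfolding E by (rule expectation_toeplitz[OF Cr(1-3) c])
  moreover have "(\<lambda>K. \<Sum>k\<in>{- int K..int K - int CARD('n) + 1}. det (\<chi> (i :: 'n) (j :: 'n). c (k + int (phi j) - int (phi i)))) =
      (\<lambda>K. of_real (\<Sum>k\<in>{- int K..int K - int CARD('n) + 1}. det (\<chi> (i :: 'n) (j :: 'n). laurent_coeff X Y (k + int (phi j) - int (phi i)))))"
    using det_of_real[of "\<chi> (i :: 'n) (j :: 'n). laurent_coeff X Y (_ + int (phi j) - int (phi i))"] by (simp add: c_def)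
  ultimately have "(\<lambda>K. complex_of_real (\<Sum>k\<in>{- int K..int K - int CARD('n) + 1}. det (\<chi> (i :: 'n) (j :: 'n). laurent_coeff X Y (k + int (phi j) - int (phi i)))))
      \<longlonglongrightarrow> expectation (weight X Y)" by simp
  then show ?thesis
    by (rule LIMSEQ_unique[OF _ tendsto_of_real[OF toeplitz_sum_limit[where ?'n = 'n, OF refl]]])
qed

end

section \<open>One flavour more than colours\<close>

text \<open>The Lagrange basis polynomial of the node x, evaluated at 0.\<close>

definition lag :: "real set \<Rightarrow> real \<Rightarrow> real" where
  "lag X x = (\<Prod>y\<in>X - {x}. y / (y - x))"

text \<open>Cauchy's product; with all nodes merged it becomes the prefactor of the Hilbert
  series.\<close>

definition coprod :: "real set \<Rightarrow> real set \<Rightarrow> real" where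
  "coprod X Y = (\<Prod>x\<in>X. \<Prod>y\<in>Y. 1 / (1 - x * y))"

definition lin_prod :: "real set \<Rightarrow> real poly" where
  "lin_prod Y = (\<Prod>y\<in>Y. [:1, - y:])"

lemma poly_lin_prod: "poly (lin_prod Y) x = (\<Prod>y\<in>Y. 1 - x * y)"
  by (simp add: lin_prod_def poly_prod)

lemma degree_lin_prod: "degree (lin_prod Y) \<le> card Y"
proof -
  have "degree (lin_prod Y) \<le> (\<Sum>y\<in>Y. degree [:1, - y:])"
  proof (cases "finite Y")
    case True
    then show ?thesis unfolding lin_prod_def using degree_prod_sum_le[of Y "\<lambda>y. [:1, - y:]"] by (simp add: o_def)
  qed (simp add: lin_prod_def)
  also have "\<dots> \<le> (\<Sum>y\<in>Y. 1)" by (rule sum_mono) simp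
  finally show ?thesis by simp
qed

lemma coeff_lin_prod: "finite Y \<Longrightarrow> coeff (lin_prod Y) (card Y) = (\<Prod>y\<in>Y. - y)"
proof (induction Y rule: finite_induct)
  case (insert y Y)
  have "lin_prod (insert y Y) = [:1, - y:] * lin_prod Y" using insert by (simp add: lin_prod_def)
  moreover have "coeff (lin_prod Y) (Suc (card Y)) = 0"
    using degree_lin_prod[of Y] by (intro coeff_eq_0) simp
  ultimately show ?case using insert by simp
qed (simp add: lin_prod_def)

text \<open>The interpolated polynomial has the value 1 at 0 and degree card Y; the top-degree error
  of \<open>lagrange_at_0\<close> shows up only for equal cardinalities.\<close>

lemma lagrange_lin_prod:
  assumes "finite X" "0 \<notin> X" "card Y \<le> card X" "finite Y"
  shows "(\<Sum>x\<in>X. (\<Prod>y\<in>Y. 1 - x * y) * lag X x) = 1 - (if card Y = card X then \<Prod>X * \<Prod>Y else 0)"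
proof -
  have "(\<Sum>x\<in>X. (\<Prod>y\<in>Y. 1 - x * y) * lag X x) = 1 - coeff (lin_prod Y) (card X) * (\<Prod>x\<in>X. - x)"
    using lagrange_at_0[of X "lin_prod Y"] assms degree_lin_prod[of Y] by (simp add: poly_lin_prod lag_def)
  moreover have "coeff (lin_prod Y) (card X) = (if card Y = card X then (\<Prod>y\<in>Y. - y) else 0)"
    using coeff_lin_prod[OF assms(4)] degree_lin_prod[of Y] assms(3) by (auto intro: coeff_eq_0)
  moreover have "(\<Prod>y\<in>Y. - y) * (\<Prod>x\<in>X. - x) = \<Prod>X * \<Prod>Y" if "card Y = card X"
  proof -
    have neg: "(\<Prod>x\<in>Z. - x) = (-1) ^ card Z * \<Prod>Z" for Z :: "real set"
      using prod.distrib[of "\<lambda>_. -1" "\<lambda>x. x" Z] by simp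
    show ?thesis unfolding neg that by (simp flip: power_mult_distrib add: mult_ac)
  qed
  ultimately show ?thesis by simp
qed

locale big_node_sets =
  fixes X Y :: "real set" and N :: nat
  assumes finX: "finite X" and finY: "finite Y" and cardX: "card X = Suc N" and cardY: "card Y = Suc N"
    and Npos: "N > 0" and X01: "X \<subseteq> {0<..<1}" and Y01: "Y \<subseteq> {0<..<1}"
begin

lemma X0: "0 \<notin> X" using X01 by auto
lemma Y0: "0 \<notin> Y" using Y01 by auto

lemma xy1: "x \<in> X \<Longrightarrow> y \<in> Y \<Longrightarrow> 1 - x * y \<noteq> 0"
  using X01 Y01 mult_strict_mono[of x 1 y 1] by (auto simp: subset_eq)

lemma flip: "big_node_sets Y X N"
  using finX finY cardX cardY Npos X01 Y01 by unfold_locales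

lemma node_sets_remove: "x \<in> X \<Longrightarrow> y \<in> Y \<Longrightarrow> node_sets (X - {x}) (Y - {y}) N"
  using finX finY cardX cardY Npos X01 Y01 by unfold_locales (auto simp: card_Diff_singleton)

text \<open>The factor 1 - x y common to both removals is given to the first product. The second
  then has only N factors, so the sum over the N + 1 nodes y interpolates it without error.\<close>

lemma coprod_remove:
  assumes "x \<in> X" "y \<in> Y"
  shows "coprod (X - {x}) (Y - {y}) = coprod X Y * (\<Prod>y'\<in>Y. 1 - x * y') * (\<Prod>x'\<in>X - {x}. 1 - y * x')"
proof -
  have "coprod X Y = (\<Prod>y'\<in>Y. 1 / (1 - x * y')) * (\<Prod>x'\<in>X - {x}. \<Prod>y'\<in>Y. 1 / (1 - x' * y'))"
    unfolding coprod_def using finX assms by (simp add: prod.remove)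
  also have "(\<Prod>x'\<in>X - {x}. \<Prod>y'\<in>Y. 1 / (1 - x' * y')) = (\<Prod>x'\<in>X - {x}. 1 / (1 - x' * y) * (\<Prod>y'\<in>Y - {y}. 1 / (1 - x' * y')))"
    using finY assms by (intro prod.cong refl) (simp add: prod.remove)
  also have "\<dots> = (\<Prod>x'\<in>X - {x}. 1 / (1 - x' * y)) * coprod (X - {x}) (Y - {y})"
    by (simp only: prod.distrib coprod_def)
  finally have "coprod X Y = (\<Prod>y'\<in>Y. 1 / (1 - x * y')) * ((\<Prod>x'\<in>X - {x}. 1 / (1 - x' * y)) * coprod (X - {x}) (Y - {y}))" .
  moreover have "(\<Prod>y'\<in>Y. 1 / (1 - x * y')) * (\<Prod>y'\<in>Y. 1 - x * y') = 1"
    unfolding prod.distrib[symmetric] using xy1 assms by (intro prod.neutral) auto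
  moreover have "(\<Prod>x'\<in>X - {x}. 1 / (1 - x' * y)) * (\<Prod>x'\<in>X - {x}. 1 - y * x') = 1"
    unfolding prod.distrib[symmetric] using xy1 assms by (intro prod.neutral) (auto simp: mult.commute)
  moreover have "k = c * a' * b'" if "c = a * (b * k)" "a * a' = 1" "b * b' = 1" for a b c k a' b' :: real
    using that by algebra
  ultimately show ?thesis by blast
qed

lemma double_sum:
  "(\<Sum>x\<in>X. \<Sum>y\<in>Y. lag X x * lag Y y * coprod (X - {x}) (Y - {y}) * f x) =
    coprod X Y * (\<Sum>x\<in>X. (\<Prod>y\<in>Y. 1 - x * y) * lag X x * f x)"
proof -
  have "(\<Sum>y\<in>Y. lag X x * lag Y y * coprod (X - {x}) (Y - {y}) * f x) =
      coprod X Y * ((\<Prod>y\<in>Y. 1 - x * y) * lag X x * f x)" if x: "x \<in> X" for x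
  proof -
    have "(\<Sum>y\<in>Y. lag X x * lag Y y * coprod (X - {x}) (Y - {y}) * f x) =
        coprod X Y * ((\<Prod>y\<in>Y. 1 - x * y) * lag X x * f x) * (\<Sum>y\<in>Y. (\<Prod>x'\<in>X - {x}. 1 - y * x') * lag Y y)"
      unfolding sum_distrib_left by (intro sum.cong refl) (simp add: coprod_remove[OF x])
    also have "(\<Sum>y\<in>Y. (\<Prod>x'\<in>X - {x}. 1 - y * x') * lag Y y) = 1"
      using x finX finY Y0 by (subst lagrange_lin_prod) (auto simp: card_Diff_singleton cardX cardY)
    finally show ?thesis by simp
  qed
  then show ?thesis by (simp add: sum_distrib_left)
qed

text \<open>Shows that the product of all nodes is not a node, so that it can be adjoined as a
  further one.\<close>

lemma prod_X_less: "x \<in> X \<Longrightarrow> \<Prod>X < x"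
proof -
  assume x: "x \<in> X"
  have "\<Prod>(X - {x}) < 1"
  proof (rule prod_less_1)
    show "X - {x} \<noteq> {}" using cardX Npos x finX by (metis card.empty card_Suc_Diff1 less_irrefl old.nat.inject)
  qed (use finX X01 in auto)
  then have "x * \<Prod>(X - {x}) < x * 1" using x X01 by (intro mult_strict_left_mono) auto
  then show ?thesis using x finX by (simp add: prod.remove)
qed

text \<open>With p the product of X, the last factor is x / (x - p) = 1 - p / (p - x), and p / (p -
  x) is precisely what the basis value at x gains when p becomes a node. So the sum is interpolation
  through X minus interpolation through X and p, plus the term at p.\<close>

lemma baryon_sum:
  "(\<Sum>x\<in>X. (\<Prod>y\<in>Y. 1 - x * y) * lag X x * (1 / (1 - \<Prod>(X - {x})))) =
    (\<Prod>y\<in>Y. 1 - \<Prod>X * y) / (\<Prod>x\<in>X. 1 - \<Prod>(X - {x})) - \<Prod>X * \<Prod>Y"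
proof -
  define p where "p = \<Prod>X"
  define R where "R x = (\<Prod>y\<in>Y. 1 - x * y)" for x
  have px: "p < x" "x \<noteq> 0" if "x \<in> X" for x using prod_X_less[OF that] that X01 by (auto simp: p_def)
  have p0: "p > 0" unfolding p_def using X01 by (intro prod_pos) auto
  have pX: "p \<notin> X" using px by auto
  have rem: "1 / (1 - \<Prod>(X - {x})) = x / (x - p)" if "x \<in> X" for x
  proof -
    have "p = x * \<Prod>(X - {x})" unfolding p_def using that finX by (simp add: prod.remove)
    then have "x - p = x * (1 - \<Prod>(X - {x}))" by (simp add: right_diff_distrib)
    then show ?thesis using px(2)[OF that] by simp
  qed
  \<comment> \<open>N + 2 nodes against degree N + 1: no error term.\<close>
  have "(\<Sum>x\<in>insert p X. R x * lag (insert p X) x) = 1"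
    unfolding R_def using finX finY X0 p0 pX by (subst lagrange_lin_prod) (auto simp: cardX cardY)
  moreover have "lag (insert p X) p = (\<Prod>x\<in>X. 1 / (1 - \<Prod>(X - {x})))"
  proof -
    have "insert p X - {p} = X" using pX by auto
    then show ?thesis unfolding lag_def by (intro prod.cong) (auto simp: rem)
  qed
  moreover have "lag (insert p X) x = lag X x * (p / (p - x))" if x: "x \<in> X" for x
  proof -
    have "insert p X - {x} = insert p (X - {x})" using pX x by auto
    then show ?thesis using finX pX by (simp add: lag_def)
  qed
  ultimately have 1: "R p * (\<Prod>x\<in>X. 1 / (1 - \<Prod>(X - {x}))) + (\<Sum>x\<in>X. R x * (lag X x * (p / (p - x)))) = 1"
    using finX pX by simp
  have 2: "(\<Sum>x\<in>X. R x * lag X x) = 1 - p * \<Prod>Y"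
    unfolding R_def p_def using finX finY X0 by (subst lagrange_lin_prod) (auto simp: cardX cardY)
  have "(\<Sum>x\<in>X. R x * lag X x * (1 / (1 - \<Prod>(X - {x})))) = (\<Sum>x\<in>X. R x * lag X x - R x * (lag X x * (p / (p - x))))"
  proof (intro sum.cong refl)
    fix x assume x: "x \<in> X"
    have q: "x / (x - p) = 1 - p / (p - x)" using px[OF x] by (simp add: field_simps)
    show "R x * lag X x * (1 / (1 - \<Prod>(X - {x}))) = R x * lag X x - R x * (lag X x * (p / (p - x)))"
      unfolding rem[OF x] q by (simp add: right_diff_distrib)
  qed
  also have "\<dots> = R p * (\<Prod>x\<in>X. 1 / (1 - \<Prod>(X - {x}))) - p * \<Prod>Y"
    unfolding sum_subtractf 2 using 1 by simp
  finally show ?thesis by (simp add: R_def p_def prod_dividef)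
qed

end

text \<open>The value of the integral for N + 1 distinct nodes on each side; merging the nodes
  yields the unrefined series.\<close>

definition sqcd_closed_form :: "real set \<Rightarrow> real set \<Rightarrow> real" where
  "sqcd_closed_form X Y = coprod X Y *
    ((\<Prod>y\<in>Y. 1 - \<Prod>X * y) / (\<Prod>x\<in>X. 1 - \<Prod>(X - {x})) +
     (\<Prod>x\<in>X. 1 - \<Prod>Y * x) / (\<Prod>y\<in>Y. 1 - \<Prod>(Y - {y})) - 1 - \<Prod>X * \<Prod>Y)"

text \<open>Each baryonic sum carries an error - (product of X)(product of Y), and the constant - 1
  returns one of the two with a plus sign.\<close>

lemma (in big_node_sets) closed_form_sum:
  "(\<Sum>x\<in>X. \<Sum>y\<in>Y. lag X x * lag Y y *
      (coprod (X - {x}) (Y - {y}) * (1 / (1 - \<Prod>(X - {x})) + 1 / (1 - \<Prod>(Y - {y})) - 1))) = sqcd_closed_form X Y"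
proof -
  interpret F: big_node_sets Y X N by (rule flip)
  have sym: "coprod A B = coprod B A" for A B
    unfolding coprod_def by (subst prod.swap) (simp add: mult.commute)
  have "(\<Sum>x\<in>X. \<Sum>y\<in>Y. lag X x * lag Y y *
      (coprod (X - {x}) (Y - {y}) * (1 / (1 - \<Prod>(X - {x})) + 1 / (1 - \<Prod>(Y - {y})) - 1))) =
    (\<Sum>x\<in>X. \<Sum>y\<in>Y. lag X x * lag Y y * coprod (X - {x}) (Y - {y}) * (1 / (1 - \<Prod>(X - {x})))) +
    (\<Sum>x\<in>X. \<Sum>y\<in>Y. lag X x * lag Y y * coprod (X - {x}) (Y - {y}) * (1 / (1 - \<Prod>(Y - {y})))) -
    (\<Sum>x\<in>X. \<Sum>y\<in>Y. lag X x * lag Y y * coprod (X - {x}) (Y - {y}) * 1)"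
    unfolding sum.distrib[symmetric] sum_subtractf[symmetric] by (intro sum.cong refl) (simp add: algebra_simps)
  also have "(\<Sum>x\<in>X. \<Sum>y\<in>Y. lag X x * lag Y y * coprod (X - {x}) (Y - {y}) * (1 / (1 - \<Prod>(Y - {y})))) =
     (\<Sum>y\<in>Y. \<Sum>x\<in>X. lag Y y * lag X x * coprod (Y - {y}) (X - {x}) * (1 / (1 - \<Prod>(Y - {y}))))"
    by (subst sum.swap) (intro sum.cong refl, simp add: sym mult_ac)
  also have "\<dots> = coprod Y X * ((\<Prod>x\<in>X. 1 - \<Prod>Y * x) / (\<Prod>y\<in>Y. 1 - \<Prod>(Y - {y})) - \<Prod>Y * \<Prod>X)"
    unfolding F.double_sum F.baryon_sum ..
  also have "(\<Sum>x\<in>X. \<Sum>y\<in>Y. lag X x * lag Y y * coprod (X - {x}) (Y - {y}) * (1 / (1 - \<Prod>(X - {x})))) =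
     coprod X Y * ((\<Prod>y\<in>Y. 1 - \<Prod>X * y) / (\<Prod>x\<in>X. 1 - \<Prod>(X - {x})) - \<Prod>X * \<Prod>Y)"
    unfolding double_sum baryon_sum ..
  also have "(\<Sum>x\<in>X. \<Sum>y\<in>Y. lag X x * lag Y y * coprod (X - {x}) (Y - {y}) * 1) = coprod X Y * (1 - \<Prod>X * \<Prod>Y)"
    unfolding double_sum using finX finY X0 by (simp add: lagrange_lin_prod cardX cardY)
  finally show ?thesis
    unfolding sqcd_closed_form_def sym[of Y X] by (simp add: algebra_simps)
qed

section \<open>Bounds on the integrand, N + 1 flavours, and the limit of merging nodes\<close>

lemma norm_eigenvalue_unitary:
  assumes U: "unitary U" and z: "z \<in># eigenvalues U"
  shows "cmod z = 1"
proof -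
  have "char_polynomial U \<noteq> 0" using char_polynomial_monic(2)[of U] by auto
  then have "poly (char_polynomial U) z = 0"
    using z unfolding eigenvalues_def by simp
  then have "det (lin z (-1) U) = 0" by (simp add: poly_char_polynomial)
  then have "\<nexists>B. B ** lin z (-1) U = mat 1"
    by (metis det_I det_mul mult_zero_right zero_neq_one)
  then obtain v where v: "lin z (-1) U *v v = 0" "v \<noteq> 0"
    unfolding matrix_left_invertible_ker by blast
  have "(U *v v) $ i = z * v $ i" for i
  proof -
    have "(lin z (-1) U *v v) $ i = z * v $ i - (U *v v) $ i"
      by (simp add: matrix_vector_mult_def lin_nth left_diff_distrib sum_subtractf
          if_distrib[of "\<lambda>x. x * _"] cong: if_cong)
    then show ?thesis using v by simp
  qed
  then have "hip (U *v v) (U *v v) = z * cnj z * hip v v"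
    by (simp add: hip_def sum_distrib_left mult_ac)
  then have "z * cnj z = 1" using v hip_unitary[OF U, of v v] by (simp add: hip_self)
  then have "(cmod z)\<^sup>2 = 1" by (metis complex_norm_square of_real_eq_1_iff)
  then show ?thesis by (metis norm_ge_zero one_power2 power2_eq_iff_nonneg zero_le_one)
qed

text \<open>Each eigenvalue z lies on the unit circle, so |1 - x z| is at least 1 - x. The bound is
  uniform in U and dominates the integrands when the nodes move.\<close>

lemma norm_det_lin_ge:
  fixes U :: "complex^'n^'n"
  assumes U: "unitary U" and x: "0 \<le> x" "x \<le> 1"
  shows "(1 - x) ^ CARD('n) \<le> cmod (det (lin 1 (- of_real x) U))"
proof -
  have "(1 - x) ^ size M \<le> cmod (\<Prod>z\<in>#M. 1 + - of_real x * z)" if "\<And>z. z \<in># M \<Longrightarrow> cmod z = 1" for M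
    using that
  proof (induction M)
    case (add z M)
    have "1 - x \<le> cmod (1 + - of_real x * z)"
      using norm_triangle_ineq2[of 1 "of_real x * z"] add.prems[of z] x by (simp add: norm_mult)
    then have "(1 - x) * (1 - x) ^ size M \<le> cmod (1 + - of_real x * z) * cmod (\<Prod>z\<in>#M. 1 + - of_real x * z)"
      using add x by (intro mult_mono) auto
    then show ?case by (simp add: norm_mult)
  qed simp
  from this[of "eigenvalues U"] show ?thesis
    using norm_eigenvalue_unitary[OF U] by (simp add: det_lin_eigenvalues char_polynomial_eigenvalues)
qed

lemma det_lin_nonzero:
  assumes "unitary U" "0 \<le> x" "x < 1"
  shows "det (lin 1 (- of_real x) U) \<noteq> 0"
proof -
  have "0 < (1 - x) ^ CARD('a)" using assms by simp
  then show ?thesis using norm_det_lin_ge[OF assms(1), of x] assms by (metis less_le_not_le norm_zero order_less_imp_le)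
qed

context su_haar
begin

lemma norm_inverse_det_le:
  assumes "U \<in> space \<mu>" "0 \<le> x" "x \<le> \<rho>" "\<rho> < 1"
  shows "cmod (1 / det (lin 1 (- of_real x) U)) \<le> (1 / (1 - \<rho>)) ^ CARD('n)"
proof -
  have "(1 - \<rho>) ^ CARD('n) \<le> (1 - x) ^ CARD('n)" using assms by (intro power_mono) auto
  also have "\<dots> \<le> cmod (det (lin 1 (- of_real x) U))"
    using assms by (intro norm_det_lin_ge unitary_space) auto
  finally have le: "(1 - \<rho>) ^ CARD('n) \<le> cmod (det (lin 1 (- of_real x) U))" .
  have pos: "0 < (1 - \<rho>) ^ CARD('n)" using assms by simp
  have "1 / cmod (det (lin 1 (- of_real x) U)) \<le> 1 / (1 - \<rho>) ^ CARD('n)"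
    using divide_left_mono[OF le, of 1] mult_pos_pos[OF less_le_trans[OF pos le] pos] by simp
  then show ?thesis by (simp add: norm_divide power_divide)
qed

lemma bm_inverse_det:
  assumes "0 \<le> x" "x < 1"
  shows "bm (\<lambda>U. 1 / det (lin 1 (- of_real x) U))"
proof (rule bmI)
  have "bm (\<lambda>U. det (lin 1 (- of_real x) U))"
    unfolding det_def lin_nth by (intro bm_intros)
  then show "(\<lambda>U. 1 / det (lin 1 (- of_real x) U)) \<in> borel_measurable \<mu>"
    using bm_measurable by (intro borel_measurable_divide) auto
qed (use norm_inverse_det_le[of _ x x] assms in auto)

lemma bm_weight:
  assumes "X \<subseteq> {0<..<1}" "Y \<subseteq> {0<..<1}"
  shows "bm (weight X Y)"
proof -
  have "weight X Y = (\<lambda>U. (\<Prod>x\<in>X. 1 / det (lin 1 (- of_real x) U)) * (\<Prod>y\<in>Y. cnj (1 / det (lin 1 (- of_real y) U))))"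
    by (simp add: weight_def fun_eq_iff)
  then show ?thesis using assms by (simp only:) (intro bm_mult bm_prod bm_cnj bm_inverse_det, auto)
qed

text \<open>\<open>det (1 - xU)\<close> has degree \<open>N\<close> in \<open>x\<close> and the value \<open>1\<close> at \<open>0\<close>, so Lagrange interpolation at \<open>0\<close>
  through \<open>N + 1\<close> nodes removes one flavour.\<close>

lemma lagrange_weight:
  assumes "finite X" "X \<subseteq> {0<..<1}" "card X = Suc CARD('n)" and U: "U \<in> space \<mu>"
  shows "(\<Prod>x\<in>X. 1 / det (lin 1 (- of_real x) U)) =
    (\<Sum>x\<in>X. of_real (lag X x) * (\<Prod>x'\<in>X - {x}. 1 / det (lin 1 (- of_real x') U)))"
proof -
  define P where "P x = det (lin 1 (- complex_of_real x) U)" for x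
  have P0: "P x \<noteq> 0" if "x \<in> X" for x
    unfolding P_def using that assms by (intro det_lin_nonzero unitary_space) auto
  have inj: "inj_on complex_of_real X" by (auto simp: inj_on_def)
  have "(\<Sum>z\<in>of_real ` X. poly (rev_char_poly U) z * (\<Prod>y\<in>of_real ` X - {z}. y / (y - z))) =
      poly (rev_char_poly U) 0 - coeff (rev_char_poly U) (card (complex_of_real ` X)) * (\<Prod>x\<in>of_real ` X. - x)"
    using assms degree_rev_char_poly[of U] inj by (intro lagrange_at_0) (auto simp: card_image)
  also have "\<dots> = 1"
    using assms degree_rev_char_poly[of U] inj by (simp add: card_image coeff_eq_0 poly_0_coeff_0 coeff_rev_char_poly_0)
  also have "(\<Sum>z\<in>of_real ` X. poly (rev_char_poly U) z * (\<Prod>y\<in>of_real ` X - {z}. y / (y - z))) =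
      (\<Sum>x\<in>X. P x * of_real (lag X x))"
  proof (subst sum.reindex[OF inj], intro sum.cong refl)
    fix x assume x: "x \<in> X"
    have "complex_of_real ` X - {of_real x} = complex_of_real ` (X - {x})" by auto
    then have "(\<Prod>y\<in>complex_of_real ` X - {of_real x}. y / (y - of_real x)) = of_real (lag X x)"
      by (simp add: prod.reindex[OF inj_on_subset[OF inj]] lag_def)
    then show "((\<lambda>z. poly (rev_char_poly U) z * (\<Prod>y\<in>of_real ` X - {z}. y / (y - z))) \<circ> of_real) x = P x * of_real (lag X x)"
      by (simp add: poly_rev_char_poly P_def)
  qed
  finally have one: "(\<Sum>x\<in>X. P x * of_real (lag X x)) = 1" .
  \<comment> \<open>Multiplying by 1 = sum of P(x) lag(x) cancels one denominator in each
    term.\<close>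
  have "(\<Prod>x\<in>X. 1 / P x) = (\<Prod>x\<in>X. 1 / P x) * (\<Sum>x\<in>X. P x * of_real (lag X x))" by (simp add: one)
  also have "\<dots> = (\<Sum>x\<in>X. of_real (lag X x) * (\<Prod>x'\<in>X - {x}. 1 / P x'))"
    unfolding sum_distrib_left
  proof (intro sum.cong refl)
    fix x assume x: "x \<in> X"
    have "(\<Prod>x\<in>X. 1 / P x) = 1 / P x * (\<Prod>x'\<in>X - {x}. 1 / P x')"
      using assms x by (simp add: prod.remove)
    then show "(\<Prod>x\<in>X. 1 / P x) * (P x * of_real (lag X x)) = of_real (lag X x) * (\<Prod>x'\<in>X - {x}. 1 / P x')"
      using P0[OF x] by simp
  qed
  finally show ?thesis by (simp add: P_def)
qed

lemma expectation_weight_Suc: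
  assumes "big_node_sets X Y CARD('n)"
  shows "expectation (weight X Y) = of_real (sqcd_closed_form X Y)"
proof -
  interpret big_node_sets X Y "CARD('n)" by (rule assms)
  have "weight X Y U = (\<Sum>x\<in>X. \<Sum>y\<in>Y. of_real (lag X x * lag Y y) * weight (X - {x}) (Y - {y}) U)" if U: "U \<in> space \<mu>" for U
  proof -
    have "(\<Prod>y\<in>Y. 1 / cnj (det (lin 1 (- of_real y) U))) = cnj (\<Prod>y\<in>Y. 1 / det (lin 1 (- of_real y) U))" by simp
    also have "\<dots> = (\<Sum>y\<in>Y. of_real (lag Y y) * (\<Prod>y'\<in>Y - {y}. 1 / cnj (det (lin 1 (- of_real y') U))))"
      unfolding lagrange_weight[OF finY Y01 cardY U] by simp
    finally show ?thesis
      unfolding weight_def lagrange_weight[OF finX X01 cardX U]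
      by (simp add: sum_product mult_ac)
  qed
  then have "expectation (weight X Y) = expectation (\<lambda>U. \<Sum>x\<in>X. \<Sum>y\<in>Y. of_real (lag X x * lag Y y) * weight (X - {x}) (Y - {y}) U)"
    by (intro Bochner_Integration.integral_cong) auto
  also have "\<dots> = (\<Sum>x\<in>X. \<Sum>y\<in>Y. of_real (lag X x * lag Y y) * expectation (weight (X - {x}) (Y - {y})))"
  proof -
    have "integrable \<mu> (weight (X - {x}) (Y - {y}))" for x y
      using X01 Y01 by (intro bm_integrable bm_weight) auto
    then show ?thesis by (simp add: Bochner_Integration.integral_sum)
  qed
  also have "\<dots> = (\<Sum>x\<in>X. \<Sum>y\<in>Y. of_real (lag X x * lag Y y *
      (coprod (X - {x}) (Y - {y}) * (1 / (1 - \<Prod>(X - {x})) + 1 / (1 - \<Prod>(Y - {y})) - 1))))"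
  proof (intro sum.cong refl)
    fix x y assume xy: "x \<in> X" "y \<in> Y"
    show "of_real (lag X x * lag Y y) * expectation (weight (X - {x}) (Y - {y})) =
      complex_of_real (lag X x * lag Y y *
      (coprod (X - {x}) (Y - {y}) * (1 / (1 - \<Prod>(X - {x})) + 1 / (1 - \<Prod>(Y - {y})) - 1)))"
      unfolding expectation_weight[OF node_sets_remove[OF xy]] coprod_def of_real_mult ..
  qed
  also have "\<dots> = of_real (sqcd_closed_form X Y)"
    unfolding closed_form_sum[symmetric] of_real_sum ..
  finally show ?thesis .
qed

text \<open>The offset i + 1 rather than i keeps all nodes positive when t = 0.\<close>

definition flavour_nodes :: "real \<Rightarrow> real \<Rightarrow> real set" where
  "flavour_nodes t \<epsilon> = (\<lambda>i. t + (real i + 1) * \<epsilon>) ` {..CARD('n)}"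

lemma prod_flavour_nodes: "\<epsilon> > 0 \<Longrightarrow> (\<Prod>x\<in>flavour_nodes t \<epsilon>. f x) = (\<Prod>i\<le>CARD('n). f (t + (real i + 1) * \<epsilon>))"
  unfolding flavour_nodes_def by (subst prod.reindex) (auto simp: inj_on_def)

lemma prod_flavour_nodes_remove:
  "\<epsilon> > 0 \<Longrightarrow> i \<le> CARD('n) \<Longrightarrow> \<Prod>(flavour_nodes t \<epsilon> - {t + (real i + 1) * \<epsilon>}) = (\<Prod>j\<in>{..CARD('n)} - {i}. t + (real j + 1) * \<epsilon>)"
proof -
  assume e: "\<epsilon> > 0" and i: "i \<le> CARD('n)"
  have inj: "inj (\<lambda>i. t + (real i + 1) * \<epsilon>)" using e by (auto simp: inj_on_def)
  have "flavour_nodes t \<epsilon> - {t + (real i + 1) * \<epsilon>} = (\<lambda>i. t + (real i + 1) * \<epsilon>) ` ({..CARD('n)} - {i})"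
    unfolding flavour_nodes_def using e by auto
  then show ?thesis by (simp add: prod.reindex inj_on_subset[OF inj])
qed

lemma expectation_unrefined:
  assumes N: "CARD('n) \<ge> 2" and t: "0 \<le> t" "t < 1" "0 \<le> t'" "t' < 1"
  shows "expectation (\<lambda>U. (1 / det (lin 1 (- of_real t') U)) ^ (CARD('n) + 1) * (1 / cnj (det (lin 1 (- of_real t) U))) ^ (CARD('n) + 1)) =
    of_real ((1 / (1 - t' * t)) ^ (CARD('n) + 1)\<^sup>2 *
      ((1 - t' ^ (CARD('n) + 1) * t) ^ (CARD('n) + 1) / (1 - t' ^ CARD('n)) ^ (CARD('n) + 1) +
       (1 - t ^ (CARD('n) + 1) * t') ^ (CARD('n) + 1) / (1 - t ^ CARD('n)) ^ (CARD('n) + 1) - 1 -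
       t' ^ (CARD('n) + 1) * t ^ (CARD('n) + 1)))"
proof -
  \<comment> \<open>A common upper bound for all nodes, still below 1; the dominating constant
    depends on it alone.\<close>
  define \<rho> where "\<rho> = (1 + max t t') / 2"
  have \<rho>: "max t t' < \<rho>" "\<rho> < 1" "0 < \<rho>" using t by (auto simp: \<rho>_def)
  \<comment> \<open>The divisor N + 1 is the largest multiple of \<epsilon> in a node, so every node
    stays at or below \<rho>.\<close>
  define \<epsilon> where "\<epsilon> n = (\<rho> - max t t') / (real CARD('n) + 1) * (1 / (real n + 1))" for n
  have \<epsilon>0: "\<epsilon> n > 0" for n using \<rho> by (simp add: \<epsilon>_def)
  have \<epsilon>lim: "\<epsilon> \<longlonglongrightarrow> 0"
    unfolding \<epsilon>_def using tendsto_mult_right_zero[OF lim_1_over_n] by real_asymp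
  have node: "0 < s + (real i + 1) * \<epsilon> n" "s + (real i + 1) * \<epsilon> n \<le> \<rho>"
    if "s = t \<or> s = t'" "i \<le> CARD('n)" for s i n
  proof -
    show "0 < s + (real i + 1) * \<epsilon> n" using that t \<epsilon>0[of n] by (auto intro!: add_nonneg_pos)
    have "(real i + 1) * \<epsilon> n \<le> (real CARD('n) + 1) * \<epsilon> n" using that \<epsilon>0[of n] by (intro mult_right_mono) auto
    also have "\<dots> = (\<rho> - max t t') * (1 / (real n + 1))" by (simp add: \<epsilon>_def)
    also have "\<dots> \<le> (\<rho> - max t t') * 1" using \<rho> by (intro mult_left_mono) auto
    finally show "s + (real i + 1) * \<epsilon> n \<le> \<rho>" using that by auto
  qed
  define A where "A s n = flavour_nodes s (\<epsilon> n)" for s n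
  have A: "finite (A s n)" "card (A s n) = Suc CARD('n)" "A s n \<subseteq> {0<..<1}" if "s = t \<or> s = t'" for s n
  proof -
    show "finite (A s n)" by (simp add: A_def flavour_nodes_def)
    show "card (A s n) = Suc CARD('n)"
      unfolding A_def flavour_nodes_def using \<epsilon>0[of n] by (subst card_image) (auto simp: inj_on_def)
    show "A s n \<subseteq> {0<..<1}"
    proof
      fix x assume "x \<in> A s n"
      then obtain i where "i \<le> CARD('n)" "x = s + (real i + 1) * \<epsilon> n"
        by (auto simp: A_def flavour_nodes_def)
      then show "x \<in> {0<..<1}" using node[OF that, of i n] \<rho> by simp
    qed
  qed
  have nodes: "big_node_sets (A t' n) (A t n) CARD('n)" for n
    using A[of t n] A[of t' n] N by unfold_locales auto
  have nl: "(\<lambda>n. s + (real i + 1) * \<epsilon> n) \<longlonglongrightarrow> s" for s i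
    using tendsto_add[OF tendsto_const[of s] tendsto_mult_right_zero[OF \<epsilon>lim, of "real i + 1"]] by simp
  have pA: "(\<Prod>x\<in>A s n. f x) = (\<Prod>i\<le>CARD('n). f (s + (real i + 1) * \<epsilon> n))" for s n and f :: "real \<Rightarrow> 'b::comm_monoid_mult"
    unfolding A_def by (rule prod_flavour_nodes[OF \<epsilon>0])
  have weight_eq: "weight (A t' n) (A t n) U = (\<Prod>i\<le>CARD('n). 1 / det (lin 1 (- of_real (t' + (real i + 1) * \<epsilon> n)) U)) *
      (\<Prod>i\<le>CARD('n). 1 / cnj (det (lin 1 (- of_real (t + (real i + 1) * \<epsilon> n)) U)))" for n U
    unfolding weight_def pA ..
  define B where "B = ((1 / (1 - \<rho>)) ^ CARD('n)) ^ (CARD('n) + 1)"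
  have det_lim: "(\<lambda>n. det (lin 1 (- complex_of_real (s + (real i + 1) * \<epsilon> n)) U)) \<longlonglongrightarrow> det (lin 1 (- of_real s) U)" for s i and U :: "complex^'n^'n"
  proof -
    have "(\<lambda>n. poly (rev_char_poly U) (complex_of_real (s + (real i + 1) * \<epsilon> n))) \<longlonglongrightarrow> poly (rev_char_poly U) (of_real s)"
      by (intro tendsto_poly tendsto_of_real nl)
    then show ?thesis by (simp only: poly_rev_char_poly)
  qed
  have L1: "(\<lambda>n. expectation (weight (A t' n) (A t n))) \<longlonglongrightarrow>
    expectation (\<lambda>U. (1 / det (lin 1 (- of_real t') U)) ^ (CARD('n) + 1) * (1 / cnj (det (lin 1 (- of_real t) U))) ^ (CARD('n) + 1))"
  proof (rule integral_dominated_convergence[where w = "\<lambda>_. B * B"])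
    have meas: "weight (A t' n) (A t n) \<in> borel_measurable \<mu>" for n
      using A by (intro bm_measurable bm_weight) auto
    then show "weight (A t' n) (A t n) \<in> borel_measurable \<mu>" for n .
    have lim: "(\<lambda>n. weight (A t' n) (A t n) U) \<longlonglongrightarrow>
      (1 / det (lin 1 (- of_real t') U)) ^ (CARD('n) + 1) * (1 / cnj (det (lin 1 (- of_real t) U))) ^ (CARD('n) + 1)" if U: "U \<in> space \<mu>" for U
    proof -
      have nz: "det (lin 1 (- of_real t') U) \<noteq> 0" "det (lin 1 (- of_real t) U) \<noteq> 0"
        using det_lin_nonzero[OF unitary_space[OF U]] t by auto
      have "(\<lambda>n. \<Prod>i\<le>CARD('n). 1 / det (lin 1 (- of_real (t' + (real i + 1) * \<epsilon> n)) U)) \<longlonglongrightarrow> (\<Prod>i\<le>CARD('n). 1 / det (lin 1 (- of_real t') U))"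
        by (intro tendsto_prod tendsto_divide tendsto_const det_lim nz)
      moreover have "(\<lambda>n. \<Prod>i\<le>CARD('n). 1 / cnj (det (lin 1 (- of_real (t + (real i + 1) * \<epsilon> n)) U))) \<longlonglongrightarrow> (\<Prod>i\<le>CARD('n). 1 / cnj (det (lin 1 (- of_real t) U)))"
        using nz by (intro tendsto_prod tendsto_divide tendsto_const tendsto_cnj det_lim) simp
      ultimately have "(\<lambda>n. weight (A t' n) (A t n) U) \<longlonglongrightarrow> (\<Prod>i\<le>CARD('n). 1 / det (lin 1 (- of_real t') U)) * (\<Prod>i\<le>CARD('n). 1 / cnj (det (lin 1 (- of_real t) U)))"
        unfolding weight_eq by (rule tendsto_mult)
      then show ?thesis by simp
    qed
    then show "AE U in \<mu>. (\<lambda>n. weight (A t' n) (A t n) U) \<longlonglongrightarrow>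
      (1 / det (lin 1 (- of_real t') U)) ^ (CARD('n) + 1) * (1 / cnj (det (lin 1 (- of_real t) U))) ^ (CARD('n) + 1)"
      by (rule AE_I2)
    show "(\<lambda>U. (1 / det (lin 1 (- of_real t') U)) ^ (CARD('n) + 1) * (1 / cnj (det (lin 1 (- of_real t) U))) ^ (CARD('n) + 1)) \<in> borel_measurable \<mu>"
      by (rule borel_measurable_LIMSEQ_metric[OF meas lim])
    show "AE U in \<mu>. norm (weight (A t' n) (A t n) U) \<le> B * B" for n
    proof (rule AE_I2)
      fix U assume U: "U \<in> space \<mu>"
      have b: "(\<Prod>i\<le>CARD('n). cmod (1 / det (lin 1 (- of_real (s + (real i + 1) * \<epsilon> n)) U))) \<le> B" if s: "s = t \<or> s = t'" for s
      proof -
        have "(\<Prod>i\<le>CARD('n). cmod (1 / det (lin 1 (- of_real (s + (real i + 1) * \<epsilon> n)) U))) \<le> (\<Prod>i\<le>CARD('n). (1 / (1 - \<rho>)) ^ CARD('n))"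
          using node[OF s, of _ n] \<rho> by (intro prod_mono conjI norm_ge_zero norm_inverse_det_le[OF U]) (auto intro: less_imp_le)
        then show ?thesis by (simp add: B_def)
      qed
      have "norm (weight (A t' n) (A t n) U) =
        (\<Prod>i\<le>CARD('n). cmod (1 / det (lin 1 (- of_real (t' + (real i + 1) * \<epsilon> n)) U))) *
        (\<Prod>i\<le>CARD('n). cmod (1 / det (lin 1 (- of_real (t + (real i + 1) * \<epsilon> n)) U)))"
        unfolding weight_eq norm_mult prod_norm[symmetric] by (simp add: norm_divide)
      also have "\<dots> \<le> B * B" using \<rho> by (intro mult_mono b prod_nonneg) (auto simp: B_def)
      finally show "norm (weight (A t' n) (A t n) U) \<le> B * B" .
    qed
  qed simp
  have L2: "(\<lambda>n. sqcd_closed_form (A t' n) (A t n)) \<longlonglongrightarrow>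
     (1 / (1 - t' * t)) ^ (CARD('n) + 1)\<^sup>2 *
      ((1 - t' ^ (CARD('n) + 1) * t) ^ (CARD('n) + 1) / (1 - t' ^ CARD('n)) ^ (CARD('n) + 1) +
       (1 - t ^ (CARD('n) + 1) * t') ^ (CARD('n) + 1) / (1 - t ^ CARD('n)) ^ (CARD('n) + 1) - 1 -
       t' ^ (CARD('n) + 1) * t ^ (CARD('n) + 1))"
  proof -
    have PA: "(\<lambda>n. \<Prod>(A s n)) \<longlonglongrightarrow> s ^ (CARD('n) + 1)" for s
    proof -
      have "(\<lambda>n. \<Prod>i\<le>CARD('n). s + (real i + 1) * \<epsilon> n) \<longlonglongrightarrow> (\<Prod>i\<le>CARD('n). s)"
        by (intro tendsto_prod nl)
      then show ?thesis unfolding pA by simp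
    qed
    have lt: "t' * t \<noteq> 1" using t mult_strict_mono[of t' 1 t 1] by auto
    have c: "(\<lambda>n. coprod (A t' n) (A t n)) \<longlonglongrightarrow> (1 / (1 - t' * t)) ^ (CARD('n) + 1)\<^sup>2"
    proof -
      have "(\<lambda>n. \<Prod>i\<le>CARD('n). \<Prod>j\<le>CARD('n). 1 / (1 - (t' + (real i + 1) * \<epsilon> n) * (t + (real j + 1) * \<epsilon> n))) \<longlonglongrightarrow>
          (\<Prod>i\<le>CARD('n). \<Prod>j\<le>CARD('n). 1 / (1 - t' * t))"
        using lt by (intro tendsto_prod tendsto_divide tendsto_diff tendsto_mult tendsto_const nl) auto
      then show ?thesis unfolding coprod_def pA by (simp add: power2_eq_square power_mult[symmetric] del: power_Suc)
    qed
    have num: "(\<lambda>n. \<Prod>y\<in>A s n. 1 - \<Prod>(A r n) * y) \<longlonglongrightarrow> (1 - r ^ (CARD('n) + 1) * s) ^ (CARD('n) + 1)" for r s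
    proof -
      have "(\<lambda>n. \<Prod>i\<le>CARD('n). 1 - \<Prod>(A r n) * (s + (real i + 1) * \<epsilon> n)) \<longlonglongrightarrow> (\<Prod>i\<le>CARD('n). 1 - r ^ (CARD('n) + 1) * s)"
        by (intro tendsto_prod tendsto_diff tendsto_mult tendsto_const PA nl)
      then show ?thesis unfolding pA[of _ s] by simp
    qed
    have den: "(\<lambda>n. \<Prod>x\<in>A s n. 1 - \<Prod>(A s n - {x})) \<longlonglongrightarrow> (1 - s ^ CARD('n)) ^ (CARD('n) + 1)" for s
    proof -
      have "(\<lambda>n. \<Prod>i\<le>CARD('n). 1 - (\<Prod>j\<in>{..CARD('n)} - {i}. s + (real j + 1) * \<epsilon> n)) \<longlonglongrightarrow>
          (\<Prod>i\<le>CARD('n). 1 - (\<Prod>j\<in>{..CARD('n)} - {i}. s))"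
        by (intro tendsto_prod tendsto_diff tendsto_const nl)
      also have "(\<Prod>i\<le>CARD('n). 1 - (\<Prod>j\<in>{..CARD('n)} - {i}. s)) = (\<Prod>i\<le>CARD('n). 1 - s ^ CARD('n))"
        by (intro prod.cong refl) (simp add: card_Diff_singleton)
      also have "(\<lambda>n. \<Prod>i\<le>CARD('n). 1 - (\<Prod>j\<in>{..CARD('n)} - {i}. s + (real j + 1) * \<epsilon> n)) = (\<lambda>n. \<Prod>x\<in>A s n. 1 - \<Prod>(A s n - {x}))"
        unfolding pA by (intro ext prod.cong refl) (simp add: A_def prod_flavour_nodes_remove[OF \<epsilon>0])
      finally show ?thesis by simp
    qed
    have nz: "(1 - s ^ CARD('n)) ^ (CARD('n) + 1) \<noteq> 0" if "s = t \<or> s = t'" for s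
      using that t power_strict_mono[of s 1 "CARD('n)"] by auto
    show ?thesis unfolding sqcd_closed_form_def
      using nz by (intro tendsto_mult tendsto_add tendsto_diff tendsto_divide tendsto_const c num den PA) auto
  qed
  show ?thesis
    by (rule LIMSEQ_unique[OF L1[unfolded expectation_weight_Suc[OF nodes]] tendsto_of_real[OF L2]])
qed

end

text \<open>The coefficient depends on k = m + n only and vanishes for k > N, so the rectangle
  shrinks to a triangle. The sum over n then telescopes to 1 - q^(k+1), and the two parts are the
  binomial expansions of (1 - T)^(N+1) and (1 - q T)^(N+1).\<close>

lemma binomial_double_sum:
  fixes q T :: real
  assumes "T \<noteq> 1"
  shows "(1 - q) * (\<Sum>m=0..N. \<Sum>n=0..N + 1. (-1) ^ (m + n) * real ((N + 1) choose (m + n + 1)) *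
      (T ^ (m + n + 1) / (1 - T) ^ (N + 1)) * q ^ n) = (1 - q * T) ^ (N + 1) / (1 - T) ^ (N + 1) - 1"
proof -
  define g where "g k = (-1) ^ k * real ((N + 1) choose (k + 1)) * T ^ (k + 1)" for k
  have g0: "g k = 0" if "k > N" for k using that by (simp add: g_def binomial_eq_0 del: binomial_Suc_Suc)
  then have g0': "k < Suc N" if "g k \<noteq> 0" for k using that by (meson not_less_eq)
  have binom: "(1 - c * T) ^ (N + 1) = 1 - (\<Sum>k\<le>N. g k * c ^ (k + 1))" for c
  proof -
    have "(1 - c * T) ^ (N + 1) = (\<Sum>k\<le>N + 1. real ((N + 1) choose k) * (- c * T) ^ k)"
      using binomial_ring[of "- c * T" 1 "N + 1"] by simp
    also have "\<dots> = 1 + (\<Sum>k\<le>N. real ((N + 1) choose (k + 1)) * (- c * T) ^ (k + 1))"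
      unfolding Suc_eq_plus1[symmetric] by (subst sum.atMost_Suc_shift) simp
    also have "(\<Sum>k\<le>N. real ((N + 1) choose (k + 1)) * (- c * T) ^ (k + 1)) = - (\<Sum>k\<le>N. g k * c ^ (k + 1))"
      unfolding sum_negf[symmetric]
    proof (intro sum.cong refl)
      fix k
      have "- c * T = (-1) * (c * T)" by simp
      then have pw: "(- c * T) ^ (k + 1) = (-1) ^ (k + 1) * (c ^ (k + 1) * T ^ (k + 1))"
        by (simp only: power_mult_distrib)
      then show "real ((N + 1) choose (k + 1)) * (- c * T) ^ (k + 1) = - (g k * c ^ (k + 1))"
        unfolding pw g_def by (simp add: mult_ac del: binomial_Suc_Suc)
    qed
    finally show ?thesis by simp
  qed
  have "(\<Sum>m=0..N. \<Sum>n=0..N + 1. g (m + n) * q ^ n) = (\<Sum>(m, n)\<in>{0..N} \<times> {0..N + 1}. g (m + n) * q ^ n)"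
    by (rule sum.cartesian_product)
  also have "\<dots> = (\<Sum>(n, m)\<in>{(i, j). i + j < Suc N}. g (m + n) * q ^ n)"
  proof -
    have "(\<Sum>(m, n)\<in>{0..N} \<times> {0..N + 1}. g (m + n) * q ^ n) = (\<Sum>(m, n)\<in>{(m, n). n + m < Suc N}. g (m + n) * q ^ n)"
      by (rule sum.mono_neutral_right) (auto dest!: g0')
    also have "\<dots> = (\<Sum>(n, m)\<in>{(i, j). i + j < Suc N}. g (m + n) * q ^ n)"
      by (rule sum.reindex_bij_witness[of _ "\<lambda>(a, b). (b, a)" "\<lambda>(a, b). (b, a)"]) auto
    finally show ?thesis .
  qed
  also have "\<dots> = (\<Sum>k<Suc N. \<Sum>n\<le>k. g (k - n + n) * q ^ n)"
    by (rule sum.triangle_reindex)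
  also have "\<dots> = (\<Sum>k\<le>N. g k * (\<Sum>n\<le>k. q ^ n))"
    by (simp add: lessThan_Suc_atMost sum_distrib_left)
  finally have "(1 - q) * (\<Sum>m=0..N. \<Sum>n=0..N + 1. g (m + n) * q ^ n) = (\<Sum>k\<le>N. g k * ((1 - q) * (\<Sum>n\<le>k. q ^ n)))"
    by (simp add: sum_distrib_left mult_ac)
  also have "\<dots> = (\<Sum>k\<le>N. g k * 1 ^ (k + 1) - g k * q ^ (k + 1))"
    using sum_gp_basic[of q] by (intro sum.cong refl) (simp add: right_diff_distrib)
  also have "\<dots> = (1 - q * T) ^ (N + 1) - (1 - T) ^ (N + 1)"
    using binom[of 1] binom[of q] by (simp add: sum_subtractf)
  finally have "(1 - q) * (\<Sum>m=0..N. \<Sum>n=0..N + 1. g (m + n) * q ^ n) / (1 - T) ^ (N + 1) = (1 - q * T) ^ (N + 1) / (1 - T) ^ (N + 1) - 1"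
    using assms by (simp add: diff_divide_distrib)
  moreover have "(\<Sum>m=0..N. \<Sum>n=0..N + 1. (-1) ^ (m + n) * real ((N + 1) choose (m + n + 1)) *
      (T ^ (m + n + 1) / (1 - T) ^ (N + 1)) * q ^ n) = (\<Sum>m=0..N. \<Sum>n=0..N + 1. g (m + n) * q ^ n) / (1 - T) ^ (N + 1)"
    unfolding sum_divide_distrib by (intro sum.cong refl) (simp add: g_def)
  ultimately show ?thesis by simp
qed

text \<open>Because det U = 1, the product of the 1 - t / z equals det(U - t), which by reflection
  is the conjugate of det(1 - tU).\<close>

lemma (in su_haar) sqcd_hilbert_series_det:
  "sqcd_hilbert_series \<mu> M t t' =
    expectation (\<lambda>U. (1 / det (lin 1 (- of_real t') U)) ^ M * (1 / cnj (det (lin 1 (- of_real t) U))) ^ M)"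
  unfolding sqcd_hilbert_series_def
proof (rule Bochner_Integration.integral_cong[OF refl])
  fix U assume "U \<in> space \<mu>"
  then have U: "U \<in> special_unitary" by (simp add: space_eq)
  have z: "z \<noteq> 0" if "z \<in># eigenvalues U" for z
    using norm_eigenvalue_unitary[OF _ that] U by (auto simp: special_unitary_iff)
  have "(\<Prod>z\<in>#eigenvalues U. 1 - of_real t / z) * (\<Prod>z\<in>#eigenvalues U. 0 + 1 * z) = (\<Prod>z\<in>#eigenvalues U. - of_real t + 1 * z)"
    unfolding prod_mset.distrib[symmetric] using z by (intro arg_cong[where f = prod_mset] image_mset_cong) (simp add: field_simps)
  moreover have "lin 0 1 U = U" by (simp add: lin_def vec_eq_iff)
  ultimately have "(\<Prod>z\<in>#eigenvalues U. 1 - of_real t / z) = det (lin (- of_real t) 1 U)"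
    using U unfolding det_lin_eigenvalues[symmetric] by (simp add: special_unitary_def)
  also have "\<dots> = cnj (det (lin 1 (- of_real t) U))"
    using det_lin_special_unitary[OF U, of "- of_real t" 1] by simp
  finally have 1: "(\<Prod>z\<in>#eigenvalues U. 1 - of_real t / z) = cnj (det (lin 1 (- of_real t) U))" .
  have 2: "(\<Prod>z\<in>#eigenvalues U. 1 - of_real t' * z) = det (lin 1 (- of_real t') U)"
    by (simp add: det_lin_eigenvalues)
  have gen: "(\<Prod>z\<in>#B. 1 / (f z ^ M * h z ^ M)) = (1 / (\<Prod>z\<in>#B. h z)) ^ M * (1 / (\<Prod>z\<in>#B. f z)) ^ M"
    for B and f h :: "complex \<Rightarrow> complex"
    by (induction B) (auto simp: power_mult_distrib power_divide)
  show "(\<Prod>z\<in>#eigenvalues U. 1 / ((1 - complex_of_real t / z) ^ M * (1 - complex_of_real t' * z) ^ M)) =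
      (1 / det (lin 1 (- of_real t') U)) ^ M * (1 / cnj (det (lin 1 (- of_real t) U))) ^ M"
    unfolding gen 1 2 ..
qed

theorem mainTheorem10:
  fixes \<mu> :: "(complex^'n^'n) measure" and N\<^sub>c :: nat and t t' :: real
  assumes "N\<^sub>c = CARD('n)" and "N\<^sub>c \<ge> 2"
    and "normalised_haar_measure special_unitary \<mu>"
    and "0 \<le> t" and "t < 1" and "0 \<le> t'" and "t' < 1"
  shows "sqcd_hilbert_series \<mu> (N\<^sub>c + 1) t t' = complex_of_real (
    1 / (1 - t * t') ^ ((N\<^sub>c + 1)\<^sup>2) *
    (1 - (t * t') ^ (N\<^sub>c + 1) +
     (1 - t * t') * (\<Sum>m=0..N\<^sub>c. \<Sum>n=0..N\<^sub>c + 1.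
        (-1) ^ (m + n) * real ((N\<^sub>c + 1) choose (m + n + 1)) *
        (t ^ ((m + n + 1) * N\<^sub>c) / (1 - t ^ N\<^sub>c) ^ (N\<^sub>c + 1) +
         t' ^ ((m + n + 1) * N\<^sub>c) / (1 - t' ^ N\<^sub>c) ^ (N\<^sub>c + 1)) *
        (t * t') ^ n)))"
proof -
  interpret su_haar \<mu> by unfold_locales (rule assms)
  let ?N = "N\<^sub>c" and ?q = "t * t'"
  \<comment> \<open>The two fractions are separated, and each is put in the form of
    \<open>binomial_double_sum\<close> with T = s^N.\<close>
  let ?S = "\<lambda>s. \<Sum>m=0..?N. \<Sum>n=0..?N + 1. (-1) ^ (m + n) * real ((?N + 1) choose (m + n + 1)) *
      ((s ^ ?N) ^ (m + n + 1) / (1 - s ^ ?N) ^ (?N + 1)) * ?q ^ n"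
  have ne: "s ^ ?N \<noteq> 1" if "0 \<le> s" "s < 1" for s :: real
    using that assms(2) power_strict_mono[of s 1 ?N] by auto
  have "(1 - ?q) * (\<Sum>m=0..?N. \<Sum>n=0..?N + 1. (-1) ^ (m + n) * real ((?N + 1) choose (m + n + 1)) *
        (t ^ ((m + n + 1) * ?N) / (1 - t ^ ?N) ^ (?N + 1) + t' ^ ((m + n + 1) * ?N) / (1 - t' ^ ?N) ^ (?N + 1)) * ?q ^ n)
      = (1 - ?q) * (?S t + ?S t')"
    unfolding sum.distrib[symmetric]
    by (intro arg_cong2[where f = "(*)"] refl sum.cong) (simp only: power_mult mult.commute[of _ ?N], simp only: distrib_left distrib_right)
  also have "\<dots> = ((1 - ?q * t ^ ?N) ^ (?N + 1) / (1 - t ^ ?N) ^ (?N + 1) - 1) + ((1 - ?q * t' ^ ?N) ^ (?N + 1) / (1 - t' ^ ?N) ^ (?N + 1) - 1)"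
    unfolding distrib_left using ne assms by (intro arg_cong2[where f = "(+)"] binomial_double_sum) auto
  finally have sum: "(1 - ?q) * (\<Sum>m=0..?N. \<Sum>n=0..?N + 1. (-1) ^ (m + n) * real ((?N + 1) choose (m + n + 1)) *
        (t ^ ((m + n + 1) * ?N) / (1 - t ^ ?N) ^ (?N + 1) + t' ^ ((m + n + 1) * ?N) / (1 - t' ^ ?N) ^ (?N + 1)) * ?q ^ n) =
      ((1 - ?q * t ^ ?N) ^ (?N + 1) / (1 - t ^ ?N) ^ (?N + 1) - 1) + ((1 - ?q * t' ^ ?N) ^ (?N + 1) / (1 - t' ^ ?N) ^ (?N + 1) - 1)" .
  have q1: "t' ^ (?N + 1) * t = ?q * t' ^ ?N" "t ^ (?N + 1) * t' = ?q * t ^ ?N" "t' * t = ?q"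
    "t' ^ (?N + 1) * t ^ (?N + 1) = ?q ^ (?N + 1)"
    by (simp_all add: power_mult_distrib mult_ac)
  have "sqcd_hilbert_series \<mu> (?N + 1) t t' = of_real ((1 / (1 - ?q)) ^ (?N + 1)\<^sup>2 *
      ((1 - ?q * t' ^ ?N) ^ (?N + 1) / (1 - t' ^ ?N) ^ (?N + 1) +
       (1 - ?q * t ^ ?N) ^ (?N + 1) / (1 - t ^ ?N) ^ (?N + 1) - 1 - ?q ^ (?N + 1)))"
    unfolding sqcd_hilbert_series_det
    using expectation_unrefined[of t t'] assms(2,4-7) unfolding assms(1)[symmetric] q1 by simp
  \<comment> \<open>The closed form A + B - 1 - q^(N+1) is regrouped as 1 - q^(N+1) + (A - 1) + (B -
    1), matching the two double sums.\<close>
  also have "\<dots> = complex_of_real (1 / (1 - ?q) ^ ((?N + 1)\<^sup>2) * (1 - ?q ^ (?N + 1) +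
      (((1 - ?q * t ^ ?N) ^ (?N + 1) / (1 - t ^ ?N) ^ (?N + 1) - 1) + ((1 - ?q * t' ^ ?N) ^ (?N + 1) / (1 - t' ^ ?N) ^ (?N + 1) - 1))))"
    unfolding power_one_over by (rule arg_cong[where f = complex_of_real], rule arg_cong2[where f = "(*)"]) simp_all
  finally show ?thesis unfolding sum .
qed

end
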